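(* Let $\mathcal{M}=(E,\mathcal{L})$ be an oriented matroid and let $X\in L(\mathcal{M})$ be a modular flat of corank $1$. Then the map $\widetilde{\rho}_X:\mathcal{S}(\mathcal{M})\to\mathcal{S}(\mathcal{M}_X)$, $(\sigma,T)\mapsto(\sigma|_X,T|_X)$, is a poset quasi-fibration. Moreover, for every $a\in\mathcal{S}(\mathcal{M}_X)$ the poset fiber $(\widetilde{\rho}_X\downarrow a)$ is homotopy equivalent to the affine Salvetti complex $\mathcal{S}_{\mathrm{aff},g}(\mathcal{N})$ of some oriented matroid $\mathcal{N}$ of rank $2$.
   Context: For sign vectors $\sigma,\tau\in\{+,-,0\}^E$: $-\sigma$ swaps $+$ and $-$; $(\sigma\circ\tau)_e=\sigma_e$ if $\sigma_e\ne0$, else $\tau_e$; $S(\sigma,\tau)=\{e\mid\sigma_e=-\tau_e\neq0\}$; $z(\sigma)=\{e\mid\sigma_e=0\}$; $\sigma|_A$ is the restriction to $A\subseteq E$. An oriented matroid $\mathcal{M}=(E,\mathcal{L})$ is a finite set $E$ and $\mathcal{L}\subseteq\{+,-,0\}^E$ with: $\mathbf 0\in\mathcal{L}$; $\sigma\in\mathcal{L}\Rightarrow-\sigma\in\mathcal{L}$; $\sigma,\tau\in\mathcal{L}\Rightarrow\sigma\circ\tau\in\mathcal{L}$; if $\sigma,\tau\in\mathcal{L}$, $e\in S(\sigma,\tau)$ then there is $\eta\in\mathcal{L}$ with $\eta_e=0$ and $\eta_f=(\sigma\circ\tau)_f=(\tau\circ\sigma)_f$ for $f\notin S(\sigma,\tau)$.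 $\mathcal{L}$ is ordered componentwise via $0<+$, $0<-$; maximal elements are topes $\mathcal{T}$. The rank of $\mathcal{M}$ is the length of a maximal chain in $\mathcal{L}$. Flats: $L(\mathcal{M})=\{z(\sigma)\mid\sigma\in\mathcal{L}\}$ ordered by inclusion, a graded lattice with meet $\cap$ and join $X\vee Y$ the smallest flat containing $X\cup Y$; the rank of a flat is the length of a maximal chain below it; corank $1$ means rank one less than that of the top element $E$. $X$ is modular if $Z\vee(X\wedge Y)=(Z\vee X)\wedge Y$ for all flats $Z\le Y$. The localization at a flat $X$ is $\mathcal{M}_X=(X,\{\sigma|_X\mid\sigma\in\mathcal{L}\})$. The Salvetti poset is $\mathcal{S}(\mathcal{M})=\{(\sigma,T)\mid T\in\mathcal{T},\sigma\le T\}$ with $(\sigma,T)\le(\tau,R)$ iff $\sigma\ge\tau$ and $\sigma\circ R=T$; for $g\in E$ the affine Salvetti poset is $\mathcal{S}_{\mathrm{aff},g}(\mathcal{M})=\{(\sigma,T)\in\mathcal{S}(\mathcal{M})\mid\sigma_g=+,T_g=+\}$. For an order preserving $f:P\to Q$ and $q\in Q$, $(f\downarrow q)=f^{-1}(Q_{\le q})$. Homotopy notions for posets refer to geometric realizations $|\Delta(P)|$ of order complexes. $f$ is a poset quasi-fibration if for all $a\le b$ in $Q$ the inclusion $(f\downarrow a)\hookrightarrow(f\downarrow b)$ is a homotopy equivalence. *)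

theory Defs
  imports "HOL-Analysis.Analysis"
begin

section \<open>Sign vectors\<close>

datatype sign = Neg | Zero | Pos

instantiation sign :: "{zero, uminus, order}"
begin

definition zero_sign :: sign where
  "0 = Zero"

primrec uminus_sign :: "sign \<Rightarrow> sign" where
  "- Neg = Pos"
| "- Zero = Zero"
| "- Pos = Neg"

text \<open>The signs \<open>Pos\<close> and \<open>Neg\<close> are incomparable.\<close>

definition less_eq_sign :: "sign \<Rightarrow> sign \<Rightarrow> bool" where
  "s \<le> t \<longleftrightarrow> s = (0::sign) \<or> s = t"

definition less_sign :: "sign \<Rightarrow> sign \<Rightarrow> bool" where
  "s < t \<longleftrightarrow> s = (0::sign) \<and> t \<noteq> 0"

instance
  by standard (auto simp: less_eq_sign_def less_sign_def)

end

text \<open>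
  A sign vector on a ground set \<open>E\<close> is a function that vanishes outside \<open>E\<close>. Negation and the
  order on sign vectors are the pointwise library instances on functions.
\<close>

type_synonym 'e sign_vector = "'e \<Rightarrow> sign"

definition sign_vectors :: "'e set \<Rightarrow> 'e sign_vector set" where
  "sign_vectors E = {\<sigma>. \<forall>e. e \<notin> E \<longrightarrow> \<sigma> e = 0}"

definition sv_comp :: "'e sign_vector \<Rightarrow> 'e sign_vector \<Rightarrow> 'e sign_vector"  (infixl \<open>\<circ>\<^sub>s\<close> 65) where
  "\<sigma> \<circ>\<^sub>s \<tau> = (\<lambda>e. if \<sigma> e \<noteq> 0 then \<sigma> e else \<tau> e)"

definition separation :: "'e sign_vector \<Rightarrow> 'e sign_vector \<Rightarrow> 'e set" where
  "separation \<sigma> \<tau> = {e. \<sigma> e = - \<tau> e \<and> \<sigma> e \<noteq> 0}"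

definition zero_set :: "'e set \<Rightarrow> 'e sign_vector \<Rightarrow> 'e set" where
  "zero_set E \<sigma> = {e \<in> E. \<sigma> e = 0}"

definition sv_restrict :: "'e set \<Rightarrow> 'e sign_vector \<Rightarrow> 'e sign_vector" where
  "sv_restrict A \<sigma> = (\<lambda>e. if e \<in> A then \<sigma> e else 0)"


section \<open>Oriented matroids\<close>

locale oriented_matroid =
  fixes E :: "'e set" and L :: "'e sign_vector set"
  assumes finite_ground: "finite E"
    and covectors: "L \<subseteq> sign_vectors E"
    and zero_mem: "(\<lambda>_. 0) \<in> L"
    and uminus_mem: "\<sigma> \<in> L \<Longrightarrow> - \<sigma> \<in> L"
    and comp_mem: "\<sigma> \<in> L \<Longrightarrow> \<tau> \<in> L \<Longrightarrow> \<sigma> \<circ>\<^sub>s \<tau> \<in> L"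
    and elimination: "\<sigma> \<in> L \<Longrightarrow> \<tau> \<in> L \<Longrightarrow> e \<in> separation \<sigma> \<tau> \<Longrightarrow>
      \<exists>\<eta>\<in>L. \<eta> e = 0 \<and>
        (\<forall>f \<in> E - separation \<sigma> \<tau>. \<eta> f = (\<sigma> \<circ>\<^sub>s \<tau>) f \<and> (\<sigma> \<circ>\<^sub>s \<tau>) f = (\<tau> \<circ>\<^sub>s \<sigma>) f)"

definition topes :: "'e sign_vector set \<Rightarrow> 'e sign_vector set" where
  "topes L = {T \<in> L. \<forall>\<sigma>\<in>L. T \<le> \<sigma> \<longrightarrow> \<sigma> = T}"

text \<open>
  The length of a chain is its number of elements minus one. In the finite graded posets considered
  below all maximal chains have the same length, so that the maximum is this common length.
\<close>

definition poset_rank :: "'a::order set \<Rightarrow> nat" where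
  "poset_rank P = Max ((\<lambda>C. card C - 1) ` {C. pred_on.maxchain P (<) C})"

definition om_rank :: "'e sign_vector set \<Rightarrow> nat" where
  "om_rank L = poset_rank L"

definition flats :: "'e set \<Rightarrow> 'e sign_vector set \<Rightarrow> 'e set set" where
  "flats E L = zero_set E ` L"

definition flat_join :: "'e set \<Rightarrow> 'e sign_vector set \<Rightarrow> 'e set \<Rightarrow> 'e set \<Rightarrow> 'e set" where
  "flat_join E L X Y = (LEAST Z. Z \<in> flats E L \<and> X \<union> Y \<subseteq> Z)"

definition flat_rank :: "'e set \<Rightarrow> 'e sign_vector set \<Rightarrow> 'e set \<Rightarrow> nat" where
  "flat_rank E L X = poset_rank {Y \<in> flats E L. Y \<subseteq> X}"

definition corank_one :: "'e set \<Rightarrow> 'e sign_vector set \<Rightarrow> 'e set \<Rightarrow> bool" where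
  "corank_one E L X \<longleftrightarrow> flat_rank E L X + 1 = flat_rank E L E"

definition modular_flat :: "'e set \<Rightarrow> 'e sign_vector set \<Rightarrow> 'e set \<Rightarrow> bool" where
  "modular_flat E L X \<longleftrightarrow> X \<in> flats E L \<and>
    (\<forall>Y\<in>flats E L. \<forall>Z\<in>flats E L. Z \<subseteq> Y \<longrightarrow>
      flat_join E L Z (X \<inter> Y) = flat_join E L Z X \<inter> Y)"

text \<open>Covectors of the localization at \<open>X\<close>, whose ground set is \<open>X\<close>.\<close>

definition localization :: "'e set \<Rightarrow> 'e sign_vector set \<Rightarrow> 'e sign_vector set" where
  "localization X L = sv_restrict X ` L"


section \<open>Salvetti posets\<close>

definition salvetti :: "'e sign_vector set \<Rightarrow> ('e sign_vector \<times> 'e sign_vector) set" where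
  "salvetti L = {(\<sigma>, T). \<sigma> \<in> L \<and> T \<in> topes L \<and> \<sigma> \<le> T}"

text \<open>This is not the product order on pairs; the order on first components is reversed.\<close>

definition salvetti_le ::
  "'e sign_vector \<times> 'e sign_vector \<Rightarrow> 'e sign_vector \<times> 'e sign_vector \<Rightarrow> bool" where
  "salvetti_le = (\<lambda>(\<sigma>, T) (\<tau>, R). \<tau> \<le> \<sigma> \<and> \<sigma> \<circ>\<^sub>s R = T)"

definition affine_salvetti ::
  "'e \<Rightarrow> 'e sign_vector set \<Rightarrow> ('e sign_vector \<times> 'e sign_vector) set" where
  "affine_salvetti g L = {(\<sigma>, T) \<in> salvetti L. \<sigma> g = Pos \<and> T g = Pos}"

definition salvetti_restrict ::
  "'e set \<Rightarrow> 'e sign_vector \<times> 'e sign_vector \<Rightarrow> 'e sign_vector \<times> 'e sign_vector" where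
  "salvetti_restrict X = (\<lambda>(\<sigma>, T). (sv_restrict X \<sigma>, sv_restrict X T))"


section \<open>Order complexes and poset quasi-fibrations\<close>

definition order_complex :: "'a set \<Rightarrow> ('a \<Rightarrow> 'a \<Rightarrow> bool) \<Rightarrow> 'a set set" where
  "order_complex P le = {C. finite C \<and> C \<noteq> {} \<and> pred_on.chain P le C}"

text \<open>
  Points are given by barycentric coordinates, extended by zero to the whole type of vertices. Hence
  the inclusion of a subcomplex is the identity function. The topology is that of pointwise
  convergence of coordinates, which is the usual one for finite complexes; only those occur here.
\<close>

definition geometric_realization :: "'v set set \<Rightarrow> ('v \<Rightarrow> real) topology" where
  "geometric_realization K = subtopology (powertop_real UNIV)
    {x. (\<forall>v. 0 \<le> x v) \<and> {v. x v \<noteq> 0} \<in> K \<and> (\<Sum>v | x v \<noteq> 0. x v) = 1}"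

definition poset_space :: "'a set \<Rightarrow> ('a \<Rightarrow> 'a \<Rightarrow> bool) \<Rightarrow> ('a \<Rightarrow> real) topology" where
  "poset_space P le = geometric_realization (order_complex P le)"

definition homotopy_equivalence_map ::
  "'a topology \<Rightarrow> 'b topology \<Rightarrow> ('a \<Rightarrow> 'b) \<Rightarrow> bool" where
  "homotopy_equivalence_map X Y f \<longleftrightarrow> continuous_map X Y f \<and>
    (\<exists>g. continuous_map Y X g \<and>
      homotopic_with (\<lambda>_. True) X X (g \<circ> f) id \<and>
      homotopic_with (\<lambda>_. True) Y Y (f \<circ> g) id)"

definition poset_fiber :: "'a set \<Rightarrow> ('b \<Rightarrow> 'b \<Rightarrow> bool) \<Rightarrow> ('a \<Rightarrow> 'b) \<Rightarrow> 'b \<Rightarrow> 'a set" where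
  "poset_fiber P leQ f q = {p \<in> P. leQ (f p) q}"

definition poset_quasi_fibration ::
  "'a set \<Rightarrow> ('a \<Rightarrow> 'a \<Rightarrow> bool) \<Rightarrow> 'b set \<Rightarrow> ('b \<Rightarrow> 'b \<Rightarrow> bool) \<Rightarrow> ('a \<Rightarrow> 'b) \<Rightarrow> bool" where
  "poset_quasi_fibration P leP Q leQ f \<longleftrightarrow>
    f \<in> P \<rightarrow> Q \<and> monotone_on P leP leQ f \<and>
    (\<forall>a\<in>Q. \<forall>b\<in>Q. leQ a b \<longrightarrow>
      homotopy_equivalence_map
        (poset_space (poset_fiber P leQ f a) leP) (poset_space (poset_fiber P leQ f b) leP) id)"

end

theory Submission
  imports Defs
begin

text \<open>
  Let \<open>\<kappa>\<close> be a covector with zero set \<open>X\<close>. Modularity says that two non-parallel elements outside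
  \<open>X\<close> span a line that meets \<open>X\<close>. Consequently the covectors over a covector \<open>\<rho>\<close> of the localization
  form a line, that is, they are totally ordered by their signs relative to \<open>\<kappa>\<close>, points and open
  intervals alternating, and the order of the points that two elements define is determined by \<open>\<rho>\<close>.
  In particular the fibre over a minimal element \<open>(R, R)\<close> is the affine Salvetti poset of an
  arrangement of lines in the plane.

  For the quasi-fibration property it suffices that the inclusion of the fibre over \<open>(T, T)\<close> into
  that over \<open>(s, R)\<close> is a homotopy equivalence whenever \<open>s \<le> T\<close>. Both are compared with the fibre over
  \<open>(R, R)\<close>, by Quillen's argument for a relation that is closed downwards and has contractible
  fibres. The fibres of this relation are convex parts of lines and half-spaces over a star, and
  these are contractible. The version of Quillen's theorem for inclusions that is needed follows
  from the existence and uniqueness up to homotopy of maps carried by a contractible carrier.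
\<close>

section \<open>Contractible carriers\<close>

text \<open>For \<open>(s, R)\<close> below \<open>(s', R')\<close> in the localization the topes
  \<open>R\<close> and \<open>R'\<close> may differ, and no order preserving map between fibres over
  different topes offers itself as a homotopy inverse. A relation replaces it. \<open>linked\<close>
  mentions neither \<open>s'\<close> nor the tope over which one restricts, so the same relation to
  the fibre over \<open>(R', R')\<close> has contractible fibres both on the fibre over
  \<open>(s', R')\<close> and on its subposet over \<open>(R, R)\<close>. Modularity acts twice. On
  the whole ground set it says that an element outside \<open>X\<close> vanishes at only one point
  of a line. On the zero set of a covector it lets a sign pattern found over one covector of the
  localization be realized over another; this makes the fibres of the relation nonempty. The rest is
  convexity on totally ordered lines. A quasi-fibration asks that the inclusion itself be an
  equivalence, not merely that the spaces be equivalent. Hence the topological part keeps track of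
  maps and argues by two-out-of-three.\<close>

definition rpoints :: "'v set set \<Rightarrow> ('v \<Rightarrow> real) set" where
  "rpoints K = {x. (\<forall>v. 0 \<le> x v) \<and> {v. x v \<noteq> 0} \<in> K \<and> (\<Sum>v | x v \<noteq> 0. x v) = 1}"

definition finite_complex :: "'v set set \<Rightarrow> bool" where
  "finite_complex K \<longleftrightarrow> finite K \<and> (\<forall>S\<in>K. finite S \<and> S \<noteq> {} \<and> (\<forall>T. T \<subseteq> S \<and> T \<noteq> {} \<longrightarrow> T \<in> K))"

lemma geometric_realization_eq:
  "geometric_realization K = subtopology (powertop_real UNIV) (rpoints K)"
  by (simp add: geometric_realization_def rpoints_def)

lemma topspace_geometric_realization [simp]:
  "topspace (geometric_realization K) = rpoints K"
  by (simp add: geometric_realization_eq)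

lemma geometric_realization_subcomplex:
  assumes "K \<subseteq> K'"
  shows "geometric_realization K = subtopology (geometric_realization K') (rpoints K)"
proof -
  have "rpoints K \<subseteq> rpoints K'" using assms by (auto simp: rpoints_def)
  then show ?thesis
    by (simp add: geometric_realization_eq subtopology_subtopology inf.absorb2)
qed

lemma rpoints_mono: "K \<subseteq> K' \<Longrightarrow> rpoints K \<subseteq> rpoints K'"
  by (auto simp: rpoints_def)

lemma rpoints_sum:
  assumes "x \<in> rpoints K" "finite S" "{v. x v \<noteq> 0} \<subseteq> S"
  shows "(\<Sum>v\<in>S. x v) = 1"
proof -
  have "(\<Sum>v\<in>S. x v) = (\<Sum>v | x v \<noteq> 0. x v)"
    using assms by (intro sum.mono_neutral_right) auto
  then show ?thesis using assms by (simp add: rpoints_def)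
qed

lemma rpointsI:
  assumes "\<And>v. 0 \<le> x v" "{v. x v \<noteq> 0} \<in> K" "finite S" "{v. x v \<noteq> 0} \<subseteq> S" "(\<Sum>v\<in>S. x v) = 1"
  shows "x \<in> rpoints K"
proof -
  have "(\<Sum>v\<in>S. x v) = (\<Sum>v | x v \<noteq> 0. x v)"
    using assms by (intro sum.mono_neutral_right) auto
  then show ?thesis using assms by (auto simp add: rpoints_def)
qed

lemma rpoints_simplex:
  assumes "finite S"
  shows "rpoints {T. T \<subseteq> S \<and> T \<noteq> {}} =
    {x. (\<forall>v. 0 \<le> x v) \<and> {v. x v \<noteq> 0} \<subseteq> S \<and> (\<Sum>v\<in>S. x v) = 1}" (is "?L = ?R")
proof
  show "?L \<subseteq> ?R"
    using assms rpoints_sum[of _ "{T. T \<subseteq> S \<and> T \<noteq> {}}" S] by (fastforce simp: rpoints_def)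
next
  show "?R \<subseteq> ?L"
  proof
    fix x assume x: "x \<in> ?R"
    have "{v. x v \<noteq> 0} \<noteq> {}"
    proof
      assume "{v. x v \<noteq> 0} = {}"
      then have "(\<Sum>v\<in>S. x v) = 0" by (intro sum.neutral) auto
      with x show False by simp
    qed
    then show "x \<in> ?L" using x assms by (intro rpointsI[of _ _ S]) auto
  qed
qed

text \<open>A closed subset, cut out by the coordinate sum, of a product of compact intervals and
  singletons. Compactness later makes the cone parametrization of a simplex a quotient map.\<close>

lemma compactin_simplex:
  assumes "finite S"
  shows "compactin (powertop_real UNIV) (rpoints {T. T \<subseteq> S \<and> T \<noteq> {}})"
proof -
  let ?B = "PiE UNIV (\<lambda>v. if v \<in> S then {0..1::real} else {0})"
  let ?C = "{x \<in> topspace (powertop_real UNIV). (\<Sum>v\<in>S. x v) \<in> {1}}"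
  have "compactin (powertop_real UNIV) ?B"
    by (subst compactin_PiE) (auto simp: compactin_euclidean_iff)
  moreover have "closedin (powertop_real UNIV) ?C"
    by (rule closedin_continuous_map_preimage[where Y = euclideanreal])
       (use assms in \<open>auto intro!: continuous_map_sum continuous_map_product_projection\<close>)
  ultimately have "compactin (powertop_real UNIV) (?B \<inter> ?C)"
    by (rule compact_Int_closedin)
  moreover have "?B \<inter> ?C = rpoints {T. T \<subseteq> S \<and> T \<noteq> {}}"
  proof -
    have "x v \<le> 1" if "\<forall>v. 0 \<le> x v" "(\<Sum>v\<in>S. x v) = 1" "v \<in> S" for x :: "'a \<Rightarrow> real" and v
      using member_le_sum[of v S x] that assms by auto
    then show ?thesis
      unfolding rpoints_simplex[OF assms] by (auto simp: PiE_iff split: if_splits) force+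
  qed
  ultimately show ?thesis by simp
qed

lemma compactin_rpoints:
  assumes "finite_complex K"
  shows "compactin (powertop_real UNIV) (rpoints K)"
proof -
  have "rpoints K = \<Union> ((\<lambda>S. rpoints {T. T \<subseteq> S \<and> T \<noteq> {}}) ` K)"
  proof (intro equalityI subsetI)
    fix x assume x: "x \<in> rpoints K"
    then have "{v. x v \<noteq> 0} \<in> K" by (simp add: rpoints_def)
    moreover from this have "{v. x v \<noteq> 0} \<noteq> {}" using assms unfolding finite_complex_def by blast
    then have "x \<in> rpoints {T. T \<subseteq> {v. x v \<noteq> 0} \<and> T \<noteq> {}}"
      using x unfolding rpoints_def by blast
    ultimately show "x \<in> \<Union> ((\<lambda>S. rpoints {T. T \<subseteq> S \<and> T \<noteq> {}}) ` K)" by blast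
  next
    fix x assume "x \<in> \<Union> ((\<lambda>S. rpoints {T. T \<subseteq> S \<and> T \<noteq> {}}) ` K)"
    then obtain S where S: "S \<in> K" "x \<in> rpoints {T. T \<subseteq> S \<and> T \<noteq> {}}" by blast
    have "{T. T \<subseteq> S \<and> T \<noteq> {}} \<subseteq> K" using assms S unfolding finite_complex_def by blast
    then show "x \<in> rpoints K" using S(2) rpoints_mono by blast
  qed
  moreover have "finite K" "\<And>S. S \<in> K \<Longrightarrow> finite S" using assms by (auto simp: finite_complex_def)
  ultimately show ?thesis
    by (auto intro!: compactin_Union compactin_simplex)
qed

lemma Hausdorff_geometric_realization: "Hausdorff_space (geometric_realization K)"
  unfolding geometric_realization_eq
  by (intro Hausdorff_space_subtopology) (simp add: Hausdorff_space_product_topology)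

lemma compact_space_geometric_realization:
  "finite_complex K \<Longrightarrow> compact_space (geometric_realization K)"
  by (simp add: geometric_realization_eq compactin_rpoints compact_space_subtopology)

lemma closedin_rpoints:
  assumes "finite_complex K" "K \<subseteq> K'"
  shows "closedin (geometric_realization K') (rpoints K)"
proof -
  have "compactin (geometric_realization K') (rpoints K)"
    unfolding geometric_realization_eq compactin_subtopology
    using assms compactin_rpoints rpoints_mono by blast
  then show ?thesis
    using Hausdorff_geometric_realization compactin_imp_closedin by blast
qed

lemma continuous_map_geometric_realization:
  "continuous_map X (geometric_realization K) f \<longleftrightarrow>
    (\<forall>v. continuous_map X euclideanreal (\<lambda>x. f x v)) \<and> f ` topspace X \<subseteq> rpoints K"
  unfolding geometric_realization_eq continuous_map_in_subtopology continuous_map_componentwise_UNIV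
  by auto

lemma continuous_map_coordinate [continuous_intros]:
  "continuous_map (geometric_realization K) euclideanreal (\<lambda>x. x v)"
  unfolding geometric_realization_eq
  by (intro continuous_map_from_subtopology continuous_map_product_projection) auto

lemma finite_complex_simplex: "finite S \<Longrightarrow> finite_complex {T. T \<subseteq> S \<and> T \<noteq> {}}"
  by (auto simp: finite_complex_def intro: finite_subset)

lemma finite_complex_boundary: "finite S \<Longrightarrow> finite_complex {T. T \<subset> S \<and> T \<noteq> {}}"
  by (auto simp: finite_complex_def intro: finite_subset)

text \<open>The simplex is the cone over its boundary with apex the barycentre, and a contraction of
  the target extends a map along the lines of this cone.\<close>

lemma extend_over_simplex:
  assumes S: "finite S" "S \<noteq> {}"
    and Z: "contractible_space Z" "topspace Z \<noteq> {}"
    and f: "continuous_map (geometric_realization {T. T \<subset> S \<and> T \<noteq> {}}) Z f"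
  obtains F where "continuous_map (geometric_realization {T. T \<subseteq> S \<and> T \<noteq> {}}) Z F"
    "\<And>x. x \<in> rpoints {T. T \<subset> S \<and> T \<noteq> {}} \<Longrightarrow> F x = f x"
proof (cases "card S = 1")
  case True
  \<comment> \<open>A single vertex has empty boundary, so any constant map will do.\<close>
  then have "{T. T \<subset> S \<and> T \<noteq> {}} = {}" by (auto simp: card_1_singleton_iff)
  moreover obtain z where "z \<in> topspace Z" using Z by blast
  ultimately show ?thesis
    by (intro that[of "\<lambda>_. z"]) (auto simp: rpoints_def)
next
  case False
  define n where "n = card S"
  have n: "n \<ge> 2" using False S by (metis One_nat_def Suc_leI card_gt_0_iff le_neq_implies_less n_def numeral_2_eq_2)
  define B where "B = {T. T \<subset> S \<and> T \<noteq> {}}"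
  define D where "D = {T. T \<subseteq> S \<and> T \<noteq> {}}"
  define c where "c = (\<lambda>v. if v \<in> S then 1 / real n else 0)"
  define X where "X = prod_topology (top_of_set {0..1::real}) (geometric_realization B)"
  define q where "q = (\<lambda>(t::real, b::'a \<Rightarrow> real). (\<lambda>v. (1 - t) * b v + t * c v))"
  have fB: "finite_complex B" unfolding B_def using S by (simp add: finite_complex_boundary)
  have Bsum: "(\<Sum>v\<in>S. b v) = 1" if "b \<in> rpoints B" for b
    using rpoints_sum[OF that] that S by (auto simp: B_def rpoints_def)
  have Bzero: "\<exists>v\<in>S. b v = 0" if "b \<in> rpoints B" for b
    using that by (auto simp: B_def rpoints_def)
  have Bout: "b v = 0" if "b \<in> rpoints B" "v \<notin> S" for b v
    using that by (auto simp: B_def rpoints_def)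
  have Bnn: "b v \<ge> 0" if "b \<in> rpoints B" for b v
    using that by (auto simp: rpoints_def)
  have BI: "b \<in> rpoints B" if "\<And>v. b v \<ge> 0" "\<And>v. v \<notin> S \<Longrightarrow> b v = 0" "(\<Sum>v\<in>S. b v) = 1" "v0 \<in> S" "b v0 = 0"
    for b v0
  proof (rule rpointsI[of b B S])
    have "{v. b v \<noteq> 0} \<noteq> {}"
    proof
      assume "{v. b v \<noteq> 0} = {}"
      then have "(\<Sum>v\<in>S. b v) = 0" by (intro sum.neutral) auto
      with that show False by simp
    qed
    then show "{v. b v \<noteq> 0} \<in> B" using that by (auto simp: B_def)
  qed (use that S in auto)
  have PD: "rpoints D = {x. (\<forall>v. 0 \<le> x v) \<and> {v. x v \<noteq> 0} \<subseteq> S \<and> (\<Sum>v\<in>S. x v) = 1}"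
    unfolding D_def by (rule rpoints_simplex[OF S(1)])
  have csum: "(\<Sum>v\<in>S. c v) = 1" using n S by (simp add: c_def n_def)
  have tX: "topspace X = {0..1} \<times> rpoints B" by (simp add: X_def)
  have qv: "q (t, b) v = (1 - t) * b v + t * c v" for t b v by (simp add: q_def)
  have contq: "continuous_map X (geometric_realization D) q"
    unfolding continuous_map_geometric_realization
  proof (intro conjI allI)
    fix v
    have "continuous_map X euclideanreal (\<lambda>x. (1 - fst x) * snd x v + fst x * c v)"
    proof -
      have 1: "continuous_map X euclideanreal fst"
        unfolding X_def by (metis continuous_map_fst continuous_map_in_subtopology)
      have 2: "continuous_map X euclideanreal (\<lambda>x. snd x v)"
        unfolding X_def
        by (rule continuous_map_compose[OF continuous_map_snd continuous_map_coordinate, unfolded o_def])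
      show ?thesis
        by (intro continuous_map_add continuous_map_real_mult continuous_map_diff 1 2) auto
    qed
    then show "continuous_map X euclideanreal (\<lambda>x. q x v)"
      by (simp add: q_def case_prod_unfold)
  next
    show "q ` topspace X \<subseteq> rpoints D"
      unfolding PD tX
    proof safe
      fix t :: real and b v assume t: "t \<in> {0..1}" and b: "b \<in> rpoints B"
      show "0 \<le> q (t, b) v" using t Bnn[OF b] by (simp add: qv c_def)
      show "(\<Sum>v\<in>S. q (t, b) v) = 1"
        by (simp add: qv sum.distrib Bsum[OF b] csum flip: sum_distrib_left)
      show "v \<in> S" if "q (t, b) v \<noteq> 0"
        using that Bout[OF b, of v] by (cases "v \<in> S") (auto simp: qv c_def)
    qed
  qed
  have "rpoints B \<noteq> {}"
  proof -
    obtain a where a: "a \<in> S" using S by blast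
    have "S \<noteq> {a}" using False by auto
    then obtain a' where a': "a' \<in> S" "a' \<noteq> a" using a by blast
    have "(\<lambda>v. if v = a then 1 else 0) \<in> rpoints B"
      by (rule BI[of _ a']) (use a a' S in auto)
    then show ?thesis by blast
  qed
  then obtain b0 where b0: "b0 \<in> rpoints B" by blast
  have surj: "q ` topspace X = rpoints D"
  proof
    show "q ` topspace X \<subseteq> rpoints D" using contq by (auto simp: continuous_map_def)
    show "rpoints D \<subseteq> q ` topspace X"
    proof
      fix x assume x: "x \<in> rpoints D"
      \<comment> \<open>A boundary point has a zero coordinate in \<open>S\<close>, so the least
        coordinate of \<open>q (t, b)\<close> on \<open>S\<close> is \<open>t / n\<close>. Hence
        \<open>t = n * m\<close>, and \<open>b\<close> is found by solving for it.\<close>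
      define m where "m = Min (x ` S)"
      have m: "m \<le> x v" if "v \<in> S" for v using S that by (simp add: m_def)
      obtain v0 where v0: "v0 \<in> S" "x v0 = m"
        using Min_in[of "x ` S"] S unfolding m_def by fastforce
      have m0: "m \<ge> 0" using x v0 by (auto simp: PD)
      have xs: "(\<Sum>v\<in>S. x v) = 1" using x by (auto simp: PD)
      have xo: "x v = 0" if "v \<notin> S" for v using x that by (auto simp: PD)
      have ds: "(\<Sum>v\<in>S. x v - m) = 1 - n * m" by (simp add: sum_subtractf xs n_def)
      have nm: "n * m \<le> 1"
      proof -
        have "(\<Sum>v\<in>S. x v - m) \<ge> 0" using m by (intro sum_nonneg) auto
        then show ?thesis using ds by simp
      qed
      show "x \<in> q ` topspace X"
      proof (cases "n * m = 1")
        case True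
        then have "\<forall>v\<in>S. x v - m = 0"
          using ds sum_nonneg_eq_0_iff[of S "\<lambda>v. x v - m"] m S by auto
        then have "x = q (1, b0)" using True n xo by (auto simp: fun_eq_iff qv c_def field_simps)
        then show ?thesis using b0 tX by auto
      next
        case False
        then have nm1: "1 - n * m > 0" using nm by simp
        define b where "b = (\<lambda>v. if v \<in> S then (x v - m) / (1 - n * m) else 0)"
        have "(\<Sum>v\<in>S. b v) = (\<Sum>v\<in>S. x v - m) / (1 - n * m)"
          by (simp add: b_def sum_divide_distrib)
        then have "(\<Sum>v\<in>S. b v) = 1" using ds nm1 by simp
        then have "b \<in> rpoints B"
          using nm1 m v0 by (intro BI[of b v0]) (auto simp: b_def)
        moreover have "x = q (n * m, b)"
          using nm1 n xo by (auto simp: fun_eq_iff qv c_def b_def)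
        ultimately show ?thesis using m0 nm tX by auto
      qed
    qed
  qed
  have "compact_space X"
    unfolding X_def
    by (simp add: compact_space_prod_topology compact_space_geometric_realization[OF fB]
        compact_space_subtopology compactin_euclidean_iff)
  \<comment> \<open>A continuous surjection from a compact space onto a Hausdorff space is a
    quotient map, so it is enough to define \<open>F\<close> on \<open>X\<close> consistently with
    \<open>q\<close>.\<close>
  then have quot: "quotient_map X (geometric_realization D) q"
    using contq surj by (intro continuous_imp_quotient_map) (auto simp: Hausdorff_geometric_realization)
  obtain a h where h: "continuous_map (prod_topology (top_of_set {0..1::real}) Z) Z h"
    "\<And>z. h (0, z) = z" "\<And>z. h (1, z) = a"
    using Z(1) unfolding contractible_space_def homotopic_with_def by auto
  have conth: "continuous_map X Z (\<lambda>p. h (fst p, f (snd p)))"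
  proof -
    have "continuous_map X (prod_topology (top_of_set {0..1::real}) Z) (\<lambda>p. (fst p, f (snd p)))"
      unfolding continuous_map_paired X_def B_def
      by (intro conjI continuous_map_fst continuous_map_compose[OF continuous_map_snd f, unfolded o_def])
    then show ?thesis using continuous_map_compose[OF _ h(1)] by (simp add: o_def)
  qed
  \<comment> \<open>The least coordinate recovers \<open>t\<close>, and then \<open>b\<close> is
    recovered unless \<open>t = 1\<close>; at \<open>t = 1\<close> the contraction is already
    constant.\<close>
  have wd: "h (fst x, f (snd x)) = h (fst y, f (snd y))"
    if "x \<in> topspace X" "y \<in> topspace X" "q x = q y" for x y
  proof -
    obtain t b t' b' where xy: "x = (t, b)" "y = (t', b')" by (cases x, cases y)
    have tb: "t \<in> {0..1}" "t' \<in> {0..1}" "b \<in> rpoints B" "b' \<in> rpoints B"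
      using that xy tX by auto
    have le: "t' \<le> t" if "t \<in> {0..1}" "t' \<in> {0..1}" "b \<in> rpoints B" "b' \<in> rpoints B"
      "q (t, b) = q (t', b')" for t t' b b'
    proof -
      obtain v where v: "v \<in> S" "b v = 0" using Bzero \<open>b \<in> rpoints B\<close> by blast
      have "q (t, b) v = q (t', b') v" using that by simp
      then have "t / n = (1 - t') * b' v + t' / n" using v by (simp add: qv c_def)
      moreover have "(1 - t') * b' v \<ge> 0" using that Bnn by auto
      ultimately have "t' / n \<le> t / n" by simp
      then show ?thesis using n by (simp add: divide_le_cancel)
    qed
    have "t = t'" using le[of t t' b b'] le[of t' t b' b] tb that(3) xy by force
    moreover have "b = b'" if "t \<noteq> 1"
    proof
      fix v
      have "q (t, b) v = q (t, b') v" using \<open>q x = q y\<close> xy \<open>t = t'\<close> by simp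
      then show "b v = b' v" using that by (simp add: qv)
    qed
    ultimately show ?thesis using h xy by (cases "t = 1") auto
  qed
  obtain F where F: "continuous_map (geometric_realization D) Z F"
    "\<And>x. x \<in> topspace X \<Longrightarrow> F (q x) = h (fst x, f (snd x))"
  proof (rule quotient_map_lift_exists[OF quot conth])
    fix x y assume "x \<in> topspace X" "y \<in> topspace X" "q x = q y"
    then show "h (fst x, f (snd x)) = h (fst y, f (snd y))" by (rule wd)
  qed blast
  have "F x = f x" if "x \<in> rpoints B" for x
  proof -
    have "q (0, x) = x" by (simp add: q_def)
    then show ?thesis using F(2)[of "(0, x)"] that h tX by simp
  qed
  then show ?thesis using that F(1) unfolding B_def D_def by blast
qed

text \<open>The acyclic carriers of homology theory, with contractible subspaces in place of acyclic
  subcomplexes.\<close>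

definition contractible_carrier :: "'v set set \<Rightarrow> 'a topology \<Rightarrow> ('v set \<Rightarrow> 'a set) \<Rightarrow> bool" where
  "contractible_carrier K Y C \<longleftrightarrow>
    (\<forall>S\<in>K. C S \<noteq> {} \<and> C S \<subseteq> topspace Y \<and> contractible_space (subtopology Y (C S))) \<and>
    (\<forall>S\<in>K. \<forall>T\<in>K. T \<subseteq> S \<longrightarrow> C T \<subseteq> C S)"

text \<open>Missing simplices are added in order of size. A smallest missing \<open>S\<close> has
  all its proper faces in \<open>K0\<close>; by monotonicity of \<open>C\<close> they are mapped
  into \<open>C S\<close>, whose contractibility fills the simplex. \<open>K0 = {}\<close> gives
  existence of carried maps, the two ends of a prism give uniqueness up to homotopy.\<close>

lemma carrier_extension:
  assumes K: "finite_complex K" and K0: "finite_complex K0" "K0 \<subseteq> K"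
    and C: "contractible_carrier K Y C"
    and f0: "continuous_map (geometric_realization K0) Y f0"
      "\<And>x. x \<in> rpoints K0 \<Longrightarrow> f0 x \<in> C {v. x v \<noteq> 0}"
  shows "\<exists>f. continuous_map (geometric_realization K) Y f \<and> (\<forall>x\<in>rpoints K0. f x = f0 x) \<and>
    (\<forall>x\<in>rpoints K. f x \<in> C {v. x v \<noteq> 0})"
  using K0 f0
proof (induction "card (K - K0)" arbitrary: K0 f0 rule: less_induct)
  case less
  have finK: "finite K" using K by (simp add: finite_complex_def)
  show ?case
  proof (cases "K0 = K")
    case True
    then show ?thesis using less.prems by blast
  next
    case False
    then have "K - K0 \<noteq> {}" using less.prems by blast
    then obtain S where S: "S \<in> K" "S \<notin> K0" and min: "\<And>T. T \<in> K - K0 \<Longrightarrow> card S \<le> card T"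
      using ex_min_if_finite[of "card ` (K - K0)"] finK
      by (metis (no_types, lifting) DiffD1 DiffD2 arg_min_if_finite(1) arg_min_least finite_Diff)
    have fS: "finite S" "S \<noteq> {}" using K S by (auto simp: finite_complex_def)
    have bd: "{T. T \<subset> S \<and> T \<noteq> {}} \<subseteq> K0"
    proof
      fix T assume T: "T \<in> {T. T \<subset> S \<and> T \<noteq> {}}"
      then have "card T < card S" using fS by (simp add: psubset_card_mono)
      moreover have "T \<in> K" using T K S unfolding finite_complex_def by blast
      ultimately show "T \<in> K0" using min[of T] by force
    qed
    define K1 where "K1 = insert S K0"
    have "\<forall>T. T \<subseteq> S \<and> T \<noteq> {} \<longrightarrow> T \<in> K1" using bd unfolding K1_def by blast
    then have K1: "finite_complex K1" "K1 \<subseteq> K"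
      using S less.prems(1,2) fS unfolding K1_def finite_complex_def by blast+
    have sub: "{T. T \<subseteq> S \<and> T \<noteq> {}} \<subseteq> K1" using bd K1_def by blast
    have sK: "{T. T \<subseteq> S \<and> T \<noteq> {}} \<subseteq> K" using sub K1(2) by blast
    let ?Z = "subtopology Y (C S)"
    have Z: "contractible_space ?Z" "topspace ?Z \<noteq> {}" and CS: "C S \<subseteq> topspace Y"
      using C S by (auto simp: contractible_carrier_def inf.absorb2)
    have f0S: "continuous_map (geometric_realization {T. T \<subset> S \<and> T \<noteq> {}}) ?Z f0"
    proof (rule continuous_map_into_subtopology)
      show "continuous_map (geometric_realization {T. T \<subset> S \<and> T \<noteq> {}}) Y f0"
        unfolding geometric_realization_subcomplex[OF bd]
        using less.prems(3) by (rule continuous_map_from_subtopology)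
      show "f0 \<in> topspace (geometric_realization {T. T \<subset> S \<and> T \<noteq> {}}) \<rightarrow> C S"
      proof
        fix x assume "x \<in> topspace (geometric_realization {T. T \<subset> S \<and> T \<noteq> {}})"
        then have x: "x \<in> rpoints {T. T \<subset> S \<and> T \<noteq> {}}" by simp
        then have "{v. x v \<noteq> 0} \<subset> S" "{v. x v \<noteq> 0} \<in> K" 
          using bd less.prems(2) by (auto simp: rpoints_def)
        then have "C {v. x v \<noteq> 0} \<subseteq> C S" using C S by (auto simp: contractible_carrier_def)
        moreover have "x \<in> rpoints K0" using x bd rpoints_mono by blast
        ultimately show "f0 x \<in> C S" using less.prems(4) by blast
      qed
    qed
    obtain F where F: "continuous_map (geometric_realization {T. T \<subseteq> S \<and> T \<noteq> {}}) ?Z F"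
      and Ff: "\<And>x. x \<in> rpoints {T. T \<subset> S \<and> T \<noteq> {}} \<Longrightarrow> F x = f0 x"
      by (rule extend_over_simplex[OF fS Z f0S]) blast
    define g where "g = (\<lambda>x. if x \<in> rpoints K0 then f0 x else F x)"
    have cases: "x \<in> rpoints K0 \<or> x \<in> rpoints {T. T \<subseteq> S \<and> T \<noteq> {}} \<and> {v. x v \<noteq> 0} = S"
      if "x \<in> rpoints K1" for x
      using that fS by (auto simp: K1_def rpoints_def)
    have agree: "F x = f0 x" if "x \<in> rpoints K0" "x \<in> rpoints {T. T \<subseteq> S \<and> T \<noteq> {}}" for x
    proof (rule Ff)
      show "x \<in> rpoints {T. T \<subset> S \<and> T \<noteq> {}}"
        using that S(2) by (auto simp: rpoints_def)
    qed
    have contg: "continuous_map (geometric_realization K1) Y g"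
    proof (rule pasting_lemma_closed[where I = "UNIV :: bool set"
          and T = "\<lambda>b. if b then rpoints K0 else rpoints {T. T \<subseteq> S \<and> T \<noteq> {}}"
          and f = "\<lambda>b. if b then f0 else F"])
      fix b :: bool
      show "closedin (geometric_realization K1) (if b then rpoints K0 else rpoints {T. T \<subseteq> S \<and> T \<noteq> {}})"
        using sub less.prems(1) fS(1) K1_def
        by (auto intro!: closedin_rpoints finite_complex_simplex)
      have "K0 \<subseteq> K1" by (auto simp: K1_def)
      then show "continuous_map (subtopology (geometric_realization K1)
          (if b then rpoints K0 else rpoints {T. T \<subseteq> S \<and> T \<noteq> {}})) Y (if b then f0 else F)"
        using less.prems(3) F sub
        by (auto simp: continuous_map_in_subtopology simp flip: geometric_realization_subcomplex)
    next
      fix i j :: bool and x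
      assume "x \<in> topspace (geometric_realization K1) \<inter>
          (if i then rpoints K0 else rpoints {T. T \<subseteq> S \<and> T \<noteq> {}}) \<inter>
          (if j then rpoints K0 else rpoints {T. T \<subseteq> S \<and> T \<noteq> {}})"
      then show "(if i then f0 else F) x = (if j then f0 else F) x"
        using agree[of x] by (auto split: if_splits)
    next
      fix x assume "x \<in> topspace (geometric_realization K1)"
      then show "\<exists>j. j \<in> UNIV \<and> x \<in> (if j then rpoints K0 else rpoints {T. T \<subseteq> S \<and> T \<noteq> {}}) \<and>
          g x = (if j then f0 else F) x"
        using cases[of x] agree[of x] unfolding g_def by (auto simp: Bex_def split: if_splits)
    qed simp
    have carr: "g x \<in> C {v. x v \<noteq> 0}" if "x \<in> rpoints K1" for x
    proof (cases "x \<in> rpoints K0")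
      case True
      then show ?thesis using less.prems(4) by (simp add: g_def)
    next
      case False
      then have "x \<in> rpoints {T. T \<subseteq> S \<and> T \<noteq> {}}" "{v. x v \<noteq> 0} = S" using cases[OF that] by auto
      moreover from this have "F x \<in> C S" using F by (auto simp: continuous_map_in_subtopology)
      ultimately show ?thesis using False by (simp add: g_def)
    qed
    have "card (K - K1) < card (K - K0)"
      using S finK by (intro psubset_card_mono) (auto simp: K1_def)
    then obtain f where f: "continuous_map (geometric_realization K) Y f" "\<forall>x\<in>rpoints K1. f x = g x"
      "\<forall>x\<in>rpoints K. f x \<in> C {v. x v \<noteq> 0}"
      using less.hyps[OF _ K1 contg carr] by blast
    have "f x = f0 x" if "x \<in> rpoints K0" for x
      using that f(2) rpoints_mono[of K0 K1] unfolding K1_def g_def by (metis subsetD subset_insertI)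
    then show ?thesis using f by blast
  qed
qed

abbreviation homotopic :: "'a topology \<Rightarrow> 'b topology \<Rightarrow> ('a \<Rightarrow> 'b) \<Rightarrow> ('a \<Rightarrow> 'b) \<Rightarrow> bool" where
  "homotopic \<equiv> homotopic_with (\<lambda>_. True)"

lemma finite_Union_complex: "finite_complex K \<Longrightarrow> finite (\<Union>K)"
  by (auto simp: finite_complex_def)

text \<open>The prism is triangulated by all sets of vertices that project to a simplex, so that the
  vertical segments are straight.\<close>

lemma carrier_homotopic:
  assumes K: "finite_complex K" and C: "contractible_carrier K Y C"
    and f: "continuous_map (geometric_realization K) Y f" "\<And>x. x \<in> rpoints K \<Longrightarrow> f x \<in> C {v. x v \<noteq> 0}"
    and g: "continuous_map (geometric_realization K) Y g" "\<And>x. x \<in> rpoints K \<Longrightarrow> g x \<in> C {v. x v \<noteq> 0}"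
  shows "homotopic (geometric_realization K) Y f g"
proof -
  define V where "V = \<Union>K"
  have V: "finite V" using K finite_Union_complex V_def by auto
  define K2 where "K2 = {S :: ('a \<times> bool) set. fst ` S \<in> K}"
  define K0 where "K0 = {S \<in> K2. \<exists>b. S \<subseteq> UNIV \<times> {b}}"
  have K2V: "S \<subseteq> V \<times> UNIV" if "S \<in> K2" for S
  proof
    fix p assume "p \<in> S"
    then have "fst p \<in> V" using that unfolding K2_def V_def by blast
    then show "p \<in> V \<times> UNIV" by (simp add: mem_Times_iff)
  qed
  have sub: "T \<in> K2" if "S \<in> K2" "T \<subseteq> S" "T \<noteq> {}" for S T
  proof -
    have "fst ` T \<subseteq> fst ` S" "fst ` T \<noteq> {}" "fst ` S \<in> K" using that by (auto simp: K2_def)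
    then have "fst ` T \<in> K" using K unfolding finite_complex_def by blast
    then show ?thesis by (simp add: K2_def)
  qed
  have "finite K2"
    by (rule finite_subset[of K2 "Pow (V \<times> UNIV)"]) (use K2V V in blast, use V in simp)
  moreover have "S \<noteq> {}" if "S \<in> K2" for S
 using that K unfolding K2_def finite_complex_def by blast
  moreover have "finite S" if "S \<in> K2" for S
    using finite_subset[OF K2V[OF that]] V by simp
  ultimately have fK2: "finite_complex K2"
    using sub unfolding finite_complex_def by blast
  have "K0 \<subseteq> K2" by (auto simp: K0_def)
  moreover have "T \<in> K0" if "S \<in> K0" "T \<subseteq> S" "T \<noteq> {}" for S T
    using that sub[of S T] unfolding K0_def by blast
  ultimately have fK0: "finite_complex K0" "K0 \<subseteq> K2"
    using fK2 finite_subset[of K0 K2] unfolding finite_complex_def by (blast, blast)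
  have slice: "(\<lambda>v. y (v, b)) \<in> rpoints K" "{v. y (v, b) \<noteq> 0} = fst ` {p. y p \<noteq> 0}"
    if y: "y \<in> rpoints K0" and b: "{p. y p \<noteq> 0} \<subseteq> UNIV \<times> {b}" for y b
  proof -
    show eq: "{v. y (v, b) \<noteq> 0} = fst ` {p. y p \<noteq> 0}"
      using b by (force simp: image_iff)
    have K: "fst ` {p. y p \<noteq> 0} \<in> K" using y by (auto simp: rpoints_def K0_def K2_def)
    have fin: "finite {p. y p \<noteq> 0}" using y fK0(1) by (auto simp: rpoints_def finite_complex_def)
    have "(\<Sum>v | y (v, b) \<noteq> 0. y (v, b)) = (\<Sum>p | y p \<noteq> 0. y p)"
    proof (rule sum.reindex_bij_witness[of _ fst "\<lambda>v. (v, b)"])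
      fix p assume "p \<in> {p. y p \<noteq> 0}"
      then have "p = (fst p, b)" "y p \<noteq> 0" using b by auto
      then show "(fst p, b) = p" "fst p \<in> {v. y (v, b) \<noteq> 0}" by auto
    qed auto
    then show "(\<lambda>v. y (v, b)) \<in> rpoints K"
      using y K eq by (auto simp: rpoints_def)
  qed
  \<comment> \<open>On the two ends of the prism \<open>s\<close> is constantly 0 and 1. Comparing
    this continuous function with 1/2 tells the ends apart, which makes \<open>f0\<close> continuous
    as a map defined by cases.\<close>
  define s where "s = (\<lambda>y :: 'a \<times> bool \<Rightarrow> real. \<Sum>v\<in>V. y (v, True))"
  have s: "s y = (if b then 1 else 0)" if y: "y \<in> rpoints K0" and b: "{p. y p \<noteq> 0} \<subseteq> UNIV \<times> {b}" for y b
  proof (cases b)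
    case True
    then have "s y = (\<Sum>v\<in>V. (\<lambda>v. y (v, b)) v)" by (simp add: s_def)
    also have "\<dots> = 1"
    proof (rule rpoints_sum[OF slice(1)[OF y b] V])
      show "{v. y (v, b) \<noteq> 0} \<subseteq> V" using slice(1)[OF y b] by (auto simp: rpoints_def V_def)
    qed
    finally show ?thesis using True by simp
  next
    case False
    then have "y (v, True) = 0" for v using b by auto
    then show ?thesis using False by (simp add: s_def)
  qed
  have side: "\<exists>b. {p. y p \<noteq> 0} \<subseteq> UNIV \<times> {b}" if "y \<in> rpoints K0" for y
    using that by (auto simp: rpoints_def K0_def)
  have sideF: "{p. y p \<noteq> 0} \<subseteq> UNIV \<times> {False}" if y: "y \<in> rpoints K0" and le: "s y \<le> 1/2" for y
  proof -
    obtain b where b: "{p. y p \<noteq> 0} \<subseteq> UNIV \<times> {b}" using side[OF y] by blast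
    moreover have "b = False" using s[OF y b] le by (cases b) simp_all
    ultimately show ?thesis by simp
  qed
  have sideT: "{p. y p \<noteq> 0} \<subseteq> UNIV \<times> {True}" if y: "y \<in> rpoints K0" and le: "s y \<ge> 1/2" for y
  proof -
    obtain b where b: "{p. y p \<noteq> 0} \<subseteq> UNIV \<times> {b}" using side[OF y] by blast
    moreover have "b = True" using s[OF y b] le by (cases b) simp_all
    ultimately show ?thesis by simp
  qed
  define f0 where "f0 = (\<lambda>y. if s y \<le> 1/2 then f (\<lambda>v. y (v, False)) else g (\<lambda>v. y (v, True)))"
  have contslice: "continuous_map (subtopology (geometric_realization K0) A) Y (\<lambda>y. k (\<lambda>v. y (v, b)))"
    if "continuous_map (geometric_realization K) Y k"
      "\<And>y. y \<in> rpoints K0 \<inter> A \<Longrightarrow> {p. y p \<noteq> 0} \<subseteq> UNIV \<times> {b}" for k A b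
  proof -
    have "continuous_map (subtopology (geometric_realization K0) A) (geometric_realization K) (\<lambda>y v. y (v, b))"
      unfolding continuous_map_geometric_realization
      using slice(1) that(2)
      by (auto intro!: continuous_map_from_subtopology continuous_map_coordinate)
    then show ?thesis using continuous_map_compose[OF _ that(1)] by (auto simp: o_def)
  qed
  have cont0: "continuous_map (geometric_realization K0) Y f0"
    unfolding f0_def
  proof (rule continuous_map_cases_le)
    show "continuous_map (geometric_realization K0) euclideanreal s"
      unfolding s_def using V by (intro continuous_map_sum continuous_map_coordinate) auto
    show "continuous_map (subtopology (geometric_realization K0)
        {y \<in> topspace (geometric_realization K0). s y \<le> 1/2}) Y (\<lambda>y. f (\<lambda>v. y (v, False)))"
      by (rule contslice[OF f(1)]) (use sideF in auto)
    show "continuous_map (subtopology (geometric_realization K0)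
        {y \<in> topspace (geometric_realization K0). 1/2 \<le> s y}) Y (\<lambda>y. g (\<lambda>v. y (v, True)))"
      by (rule contslice[OF g(1)]) (use sideT in auto)
  next
    fix y assume "y \<in> topspace (geometric_realization K0)" "s y = 1/2"
    then show "f (\<lambda>v. y (v, False)) = g (\<lambda>v. y (v, True))"
      using side[of y] s[of y] by (force split: if_splits)
  qed simp
  have carr0: "f0 y \<in> C (fst ` {p. y p \<noteq> 0})" if "y \<in> rpoints K0" for y
  proof (cases "s y \<le> 1/2")
    case True
    note b = sideF[OF that True]
    show ?thesis using f(2)[OF slice(1)[OF that b]] slice(2)[OF that b] True by (simp add: f0_def)
  next
    case False
    then have b: "{p. y p \<noteq> 0} \<subseteq> UNIV \<times> {True}" using sideT[OF that] by simp
    show ?thesis using g(2)[OF slice(1)[OF that b]] slice(2)[OF that b] False by (simp add: f0_def)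
  qed
  have C2: "contractible_carrier K2 Y (\<lambda>S. C (fst ` S))"
    using C unfolding contractible_carrier_def K2_def by (auto simp: image_mono)
  obtain F where F: "continuous_map (geometric_realization K2) Y F" "\<forall>x\<in>rpoints K0. F x = f0 x"
    using carrier_extension[OF fK2 fK0 C2 cont0 carr0] by blast
  \<comment> \<open>Each coordinate \<open>x v\<close> is split in the ratio
    \<open>1 - t : t\<close> between the lower and the upper copy of \<open>v\<close>. The support
    still projects onto that of \<open>x\<close>, so \<open>j\<close> stays in
    \<open>K2\<close>.\<close>
  define j where "j = (\<lambda>(t::real, x::'a \<Rightarrow> real). \<lambda>(v, b). if b then t * x v else (1 - t) * x v)"
  let ?X = "prod_topology (top_of_set {0..1::real}) (geometric_realization K)"
  have jK2: "j (t, x) \<in> rpoints K2" if t: "t \<in> {0..1}" and x: "x \<in> rpoints K" for t x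
  proof (rule rpointsI[of _ _ "V \<times> UNIV"])
    show "0 \<le> j (t, x) p" for p
      using t x by (auto simp: j_def rpoints_def split: prod.splits)
    have "fst ` {p. j (t, x) p \<noteq> 0} = {v. x v \<noteq> 0}" (is "?A = ?B")
    proof
      show "?A \<subseteq> ?B" by (auto simp: j_def split: if_splits)
      show "?B \<subseteq> ?A"
      proof
        fix v assume "v \<in> ?B"
        then have "j (t, x) (v, t \<noteq> 0) \<noteq> 0" by (auto simp: j_def)
        then show "v \<in> ?A" by (metis (mono_tags, lifting) fst_conv image_eqI mem_Collect_eq)
      qed
    qed
    then show K2: "{p. j (t, x) p \<noteq> 0} \<in> K2" using x by (simp add: K2_def rpoints_def)
    show "{p. j (t, x) p \<noteq> 0} \<subseteq> V \<times> UNIV" using K2V[OF K2] .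
    have "{v. x v \<noteq> 0} \<subseteq> V" using x by (auto simp: rpoints_def V_def)
    then have "(\<Sum>v\<in>V. x v) = 1" using rpoints_sum[OF x V] by simp
    moreover have "(\<Sum>p\<in>V \<times> UNIV. j (t, x) p) = (\<Sum>v\<in>V. \<Sum>b\<in>UNIV. j (t, x) (v, b))"
      by (simp add: sum.cartesian_product)
    moreover have "(\<Sum>b\<in>UNIV. j (t, x) (v, b)) = x v" for v
      by (simp add: j_def UNIV_bool algebra_simps)
    ultimately show "(\<Sum>p\<in>V \<times> UNIV. j (t, x) p) = 1" by simp
  qed (use V in simp)
  have "continuous_map ?X (geometric_realization K2) j"
    unfolding continuous_map_geometric_realization
  proof (intro conjI allI)
    fix p :: "'a \<times> bool"
    obtain v b where p: "p = (v, b)" by (cases p)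
    have 1: "continuous_map ?X euclideanreal fst"
      by (metis continuous_map_fst continuous_map_in_subtopology)
    have 2: "continuous_map ?X euclideanreal (\<lambda>x. snd x v)"
      by (rule continuous_map_compose[OF continuous_map_snd continuous_map_coordinate, unfolded o_def])
    have "continuous_map ?X euclideanreal (\<lambda>x. if b then fst x * snd x v else (1 - fst x) * snd x v)"
      by (cases b) (auto intro!: continuous_map_real_mult continuous_map_diff 1 2)
    then show "continuous_map ?X euclideanreal (\<lambda>x. j x p)"
      by (cases b) (simp_all add: j_def p case_prod_unfold)
  qed (use jK2 in auto)
  then have cont: "continuous_map ?X Y (F \<circ> j)"
    using F(1) by (rule continuous_map_compose)
  have j01: "F (j (0, x)) = f x" "F (j (1, x)) = g x" if x: "x \<in> rpoints K" for x
  proof -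
    have "{p. j (0, x) p \<noteq> 0} \<subseteq> UNIV \<times> {False}" "{p. j (1, x) p \<noteq> 0} \<subseteq> UNIV \<times> {True}"
      by (auto simp: j_def split: if_splits)
    moreover from this have K0: "j (0, x) \<in> rpoints K0" "j (1, x) \<in> rpoints K0"
      using jK2[OF _ x, of 0] jK2[OF _ x, of 1] unfolding rpoints_def K0_def by auto
    ultimately have "s (j (0, x)) = 0" "s (j (1, x)) = 1" using s by auto
    then have "f0 (j (0, x)) = f x" "f0 (j (1, x)) = g x" by (simp_all add: f0_def j_def)
    then show "F (j (0, x)) = f x" "F (j (1, x)) = g x" using F(2) K0 by auto
  qed
  show ?thesis
    by (subst homotopic_with) (use cont j01 in \<open>auto intro!: exI[of _ "F \<circ> j"]\<close>)
qed

section \<open>Order complexes and Quillen's theorem\<close>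

lemma homotopy_equivalence_map_cong:
  assumes "homotopy_equivalence_map X Y f" and fg: "\<And>x. x \<in> topspace X \<Longrightarrow> f x = g x"
  shows "homotopy_equivalence_map X Y g"
proof -
  obtain h where f: "continuous_map X Y f" and h: "continuous_map Y X h"
    and hf: "homotopic X X (h \<circ> f) id" and fh: "homotopic Y Y (f \<circ> h) id"
    using assms unfolding homotopy_equivalence_map_def by blast
  have g: "continuous_map X Y g" by (rule continuous_map_eq[OF f fg])
  have hg: "homotopic X X (h \<circ> g) (h \<circ> f)"
    by (rule homotopic_with_equal) (use fg continuous_map_compose[OF g h] in auto)
  have gh: "homotopic Y Y (g \<circ> h) (f \<circ> h)"
  proof (rule homotopic_with_equal)
    fix y assume "y \<in> topspace Y"
    then have "h y \<in> topspace X" using h by (auto simp: continuous_map_def)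
    then show "(g \<circ> h) y = (f \<circ> h) y" using fg by simp
  qed (use continuous_map_compose[OF h g] in auto)
  show ?thesis
    unfolding homotopy_equivalence_map_def
    using g h homotopic_with_trans[OF hg hf] homotopic_with_trans[OF gh fh] by blast
qed

lemma homotopy_equivalence_map_of_inverse:
  assumes "continuous_map X Y f" "continuous_map Y X g"
    and "\<And>x. x \<in> topspace X \<Longrightarrow> g (f x) = x" "\<And>y. y \<in> topspace Y \<Longrightarrow> f (g y) = y"
  shows "homotopy_equivalence_map X Y f"
  unfolding homotopy_equivalence_map_def using assms homotopic_with_id2 by metis

lemma homotopy_equivalence_map_compose:
  assumes "homotopy_equivalence_map X Y f" "homotopy_equivalence_map Y Z g"
  shows "homotopy_equivalence_map X Z (g \<circ> f)"
proof -
  obtain f' g' where f: "continuous_map X Y f" "continuous_map Y X f'"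
      "homotopic X X (f' \<circ> f) id" "homotopic Y Y (f \<circ> f') id"
    and g: "continuous_map Y Z g" "continuous_map Z Y g'"
      "homotopic Y Y (g' \<circ> g) id" "homotopic Z Z (g \<circ> g') id"
    using assms unfolding homotopy_equivalence_map_def by blast
  have 1: "homotopic X X (f' \<circ> ((g' \<circ> g) \<circ> f)) (f' \<circ> (id \<circ> f))"
    by (intro homotopic_with_compose_continuous_map_left[OF _ f(2)]
        homotopic_with_compose_continuous_map_right[OF g(3) f(1)]) auto
  have "homotopic X X ((f' \<circ> g') \<circ> (g \<circ> f)) id"
    using homotopic_with_trans[OF 1[unfolded id_o] f(3)] by (simp add: o_assoc)
  moreover have 2: "homotopic Z Z (g \<circ> ((f \<circ> f') \<circ> g')) (g \<circ> (id \<circ> g'))"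
    by (intro homotopic_with_compose_continuous_map_left[OF _ g(1)]
        homotopic_with_compose_continuous_map_right[OF f(4) g(2)]) auto
  have "homotopic Z Z ((g \<circ> f) \<circ> (f' \<circ> g')) id"
    using homotopic_with_trans[OF 2[unfolded id_o] g(4)] by (simp add: o_assoc)
  ultimately show ?thesis
    unfolding homotopy_equivalence_map_def
    using continuous_map_compose[OF f(1) g(1)] continuous_map_compose[OF g(2) f(2)] by blast
qed

text \<open>If \<open>k\<close> inverts \<open>g \<circ> f\<close>, then \<open>k \<circ> g\<close>
  inverts \<open>f\<close>: up to homotopy \<open>f \<circ> k \<circ> g\<close> is
  \<open>g' \<circ> g \<circ> f \<circ> k \<circ> g\<close>, hence \<open>g' \<circ> g\<close>,
  hence the identity.\<close>

lemma homotopy_equivalence_map_cancel_left: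
  assumes "homotopy_equivalence_map Y Z g" "homotopy_equivalence_map X Z (g \<circ> f)"
    and f: "continuous_map X Y f"
  shows "homotopy_equivalence_map X Y f"
proof -
  obtain g' k where g: "continuous_map Y Z g" "continuous_map Z Y g'"
      "homotopic Y Y (g' \<circ> g) id" "homotopic Z Z (g \<circ> g') id"
    and k: "continuous_map Z X k"
      "homotopic X X (k \<circ> (g \<circ> f)) id" "homotopic Z Z ((g \<circ> f) \<circ> k) id"
    using assms unfolding homotopy_equivalence_map_def by blast
  have 1: "continuous_map Y X (k \<circ> g)" using g k by (auto intro: continuous_map_compose)
  have fkg: "continuous_map Y Y (f \<circ> (k \<circ> g))" using 1 f by (rule continuous_map_compose)
  have 2: "homotopic Y Y ((g' \<circ> g) \<circ> (f \<circ> (k \<circ> g))) (id \<circ> (f \<circ> (k \<circ> g)))"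
    by (rule homotopic_with_compose_continuous_map_right[OF g(3) fkg]) auto
  have 3: "homotopic Y Y (g' \<circ> (((g \<circ> f) \<circ> k) \<circ> g)) (g' \<circ> (id \<circ> g))"
    by (intro homotopic_with_compose_continuous_map_left[OF _ g(2)]
        homotopic_with_compose_continuous_map_right[OF k(3) g(1)]) auto
  have "homotopic Y Y (f \<circ> (k \<circ> g)) (g' \<circ> g)"
    using homotopic_with_trans[OF homotopic_with_symD[OF 2[unfolded id_o]], of "g' \<circ> g"] 3
    by (simp add: o_assoc)
  from homotopic_with_trans[OF this g(3)]
  have "homotopic Y Y (f \<circ> (k \<circ> g)) id" .
  then show ?thesis
    unfolding homotopy_equivalence_map_def using f 1 k(2) by (auto simp: o_assoc)
qed

text \<open>If \<open>k\<close> inverts \<open>g \<circ> f\<close>, then \<open>f \<circ> k\<close>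
  inverts \<open>g\<close>: up to homotopy \<open>f \<circ> k \<circ> g\<close> is
  \<open>f \<circ> k \<circ> g \<circ> f \<circ> f'\<close>, hence \<open>f \<circ> f'\<close>,
  hence the identity.\<close>

lemma homotopy_equivalence_map_cancel_right:
  assumes "homotopy_equivalence_map X Y f" "homotopy_equivalence_map X Z (g \<circ> f)"
    and g: "continuous_map Y Z g"
  shows "homotopy_equivalence_map Y Z g"
proof -
  obtain f' k where f: "continuous_map X Y f" "continuous_map Y X f'"
      "homotopic X X (f' \<circ> f) id" "homotopic Y Y (f \<circ> f') id"
    and k: "continuous_map Z X k"
      "homotopic X X (k \<circ> (g \<circ> f)) id" "homotopic Z Z ((g \<circ> f) \<circ> k) id"
    using assms unfolding homotopy_equivalence_map_def by blast
  have 1: "continuous_map Z Y (f \<circ> k)" using f k by (auto intro: continuous_map_compose)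
  have fkg: "continuous_map Y Y ((f \<circ> k) \<circ> g)" using g 1 by (rule continuous_map_compose)
  have 2: "homotopic Y Y (((f \<circ> k) \<circ> g) \<circ> (f \<circ> f')) (((f \<circ> k) \<circ> g) \<circ> id)"
    by (rule homotopic_with_compose_continuous_map_left[OF f(4) fkg]) auto
  have 3: "homotopic Y Y (f \<circ> ((k \<circ> (g \<circ> f)) \<circ> f')) (f \<circ> (id \<circ> f'))"
    by (intro homotopic_with_compose_continuous_map_left[OF _ f(1)]
        homotopic_with_compose_continuous_map_right[OF k(2) f(2)]) auto
  have "homotopic Y Y ((f \<circ> k) \<circ> g) (f \<circ> f')"
    using homotopic_with_trans[OF homotopic_with_symD[OF 2[unfolded o_id]], of "f \<circ> f'"] 3
    by (simp add: o_assoc)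
  from homotopic_with_trans[OF this f(4)]
  have "homotopic Y Y ((f \<circ> k) \<circ> g) id" .
  then show ?thesis
    unfolding homotopy_equivalence_map_def using g 1 k(3) by (auto simp: o_assoc)
qed

lemma homotopy_equivalence_map_imp_space:
  "homotopy_equivalence_map X Y f \<Longrightarrow> X homotopy_equivalent_space Y"
  unfolding homotopy_equivalence_map_def homotopy_equivalent_space_def by blast

section \<open>Order complexes of finite posets\<close>

lemma finite_complex_order_complex: "finite P \<Longrightarrow> finite_complex (order_complex P le)"
  unfolding finite_complex_def order_complex_def pred_on.chain_def
  by (auto intro: finite_subset[of _ "Pow P"] dest: finite_subset)

lemma order_complex_mono: "Q \<subseteq> P \<Longrightarrow> order_complex Q le \<subseteq> order_complex P le"
  by (auto simp: order_complex_def pred_on.chain_def)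

lemma poset_space_subset:
  "Q \<subseteq> P \<Longrightarrow> poset_space Q le = subtopology (poset_space P le) (rpoints (order_complex Q le))"
  unfolding poset_space_def by (intro geometric_realization_subcomplex order_complex_mono)

lemma topspace_poset_space [simp]: "topspace (poset_space P le) = rpoints (order_complex P le)"
  by (simp add: poset_space_def)

lemma continuous_map_poset_inclusion:
  "Q \<subseteq> P \<Longrightarrow> continuous_map (poset_space Q le) (poset_space P le) id"
  by (simp add: poset_space_subset continuous_map_from_subtopology)

lemma rpoints_order_complex_nonempty:
  assumes "P \<noteq> {}"
  shows "rpoints (order_complex P le) \<noteq> {}"
proof -
  obtain a where "a \<in> P" using assms by blast
  then have "(\<lambda>v. if v = a then 1 else 0) \<in> rpoints (order_complex P le)"
    by (intro rpointsI[of _ _ "{a}"]) (auto simp: order_complex_def pred_on.chain_def)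
  then show ?thesis by blast
qed

definition contractible_poset :: "'a set \<Rightarrow> ('a \<Rightarrow> 'a \<Rightarrow> bool) \<Rightarrow> bool" where
  "contractible_poset P le \<longleftrightarrow> P \<noteq> {} \<and> contractible_space (poset_space P le)"

text \<open>Adding \<open>a\<close> to a chain gives a chain, so the straight homotopy to the vertex
  \<open>a\<close> stays inside the complex.\<close>

lemma contractible_poset_cone:
  assumes P: "finite P" and a: "a \<in> P" "\<And>p. p \<in> P \<Longrightarrow> le a p \<or> le p a"
  shows "contractible_poset P le"
proof -
  define d where "d = (\<lambda>v. if v = a then 1 else 0 :: real)"
  define h where "h = (\<lambda>(t::real, x::'a \<Rightarrow> real). \<lambda>v. (1 - t) * x v + t * d v)"
  let ?K = "order_complex P le"
  let ?X = "prod_topology (top_of_set {0..1::real}) (geometric_realization ?K)"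
  have "h (t, x) \<in> rpoints ?K" if t: "t \<in> {0..1}" and x: "x \<in> rpoints ?K" for t x
  proof (rule rpointsI[of _ _ P])
    have S: "{v. x v \<noteq> 0} \<in> ?K" using x by (simp add: rpoints_def)
    have SP: "{v. x v \<noteq> 0} \<subseteq> P" using S by (simp add: order_complex_def pred_on.chain_def)
    show "0 \<le> h (t, x) v" for v using t x by (auto simp: h_def d_def rpoints_def)
    have sub: "{v. h (t, x) v \<noteq> 0} \<subseteq> insert a {v. x v \<noteq> 0}" by (auto simp: h_def d_def)
    then show "{v. h (t, x) v \<noteq> 0} \<subseteq> P" using SP a by blast
    have s: "(\<Sum>v\<in>P. x v) = 1" using rpoints_sum[OF x P SP] .
    have "(\<Sum>v\<in>P. d v) = 1" using P a by (simp add: d_def)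
    then show s1: "(\<Sum>v\<in>P. h (t, x) v) = 1"
      using s by (simp add: h_def sum.distrib flip: sum_distrib_left)
    have "{v. h (t, x) v \<noteq> 0} \<noteq> {}"
    proof
      assume "{v. h (t, x) v \<noteq> 0} = {}"
      then have "(\<Sum>v\<in>P. h (t, x) v) = 0" by (intro sum.neutral) auto
      with s1 show False by simp
    qed
    moreover have "insert a {v. x v \<noteq> 0} \<in> ?K"
      using S SP a P unfolding order_complex_def pred_on.chain_def by auto
    ultimately show "{v. h (t, x) v \<noteq> 0} \<in> ?K"
      using finite_complex_order_complex[OF P] sub unfolding finite_complex_def by blast
  qed (rule P)
  moreover have "continuous_map ?X euclideanreal (\<lambda>x. h x v)" for v
  proof -
    have 1: "continuous_map ?X euclideanreal fst"
      by (metis continuous_map_fst continuous_map_in_subtopology)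
    have 2: "continuous_map ?X euclideanreal (\<lambda>x. snd x v)"
      by (rule continuous_map_compose[OF continuous_map_snd continuous_map_coordinate, unfolded o_def])
    have "continuous_map ?X euclideanreal (\<lambda>x. (1 - fst x) * snd x v + fst x * d v)"
      by (intro continuous_map_add continuous_map_real_mult continuous_map_diff 1 2) auto
    then show ?thesis by (simp add: h_def case_prod_unfold)
  qed
  ultimately have "continuous_map ?X (geometric_realization ?K) h"
    unfolding continuous_map_geometric_realization by auto
  moreover have "h (0, x) = x" "h (1, x) = d" for x by (auto simp: h_def)
  ultimately have "homotopic (geometric_realization ?K) (geometric_realization ?K) id (\<lambda>_. d)"
    unfolding homotopic_with_def by (intro exI[of _ h]) auto
  then show ?thesis
    using a unfolding contractible_poset_def contractible_space_def poset_space_def by blast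
qed

text \<open>Chains do not see the direction of the order, so Quillen's criterion for lower fibres
  also yields the one for upper fibres.\<close>

lemma poset_space_dual: "poset_space P (\<lambda>x y. le y x) = poset_space P le"
proof -
  have "order_complex P (\<lambda>x y. le y x) = order_complex P le"
    unfolding order_complex_def pred_on.chain_def by auto
  then show ?thesis by (simp add: poset_space_def)
qed

lemma contractible_poset_dual: "contractible_poset P (\<lambda>x y. le y x) = contractible_poset P le"
  using poset_space_dual[of P le] by (simp only: contractible_poset_def)

definition poset_on :: "'a set \<Rightarrow> ('a \<Rightarrow> 'a \<Rightarrow> bool) \<Rightarrow> bool" where
  "poset_on P le \<longleftrightarrow> (\<forall>x\<in>P. le x x) \<and> (\<forall>x\<in>P. \<forall>y\<in>P. le x y \<longrightarrow> le y x \<longrightarrow> x = y) \<and>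
    (\<forall>x\<in>P. \<forall>y\<in>P. \<forall>z\<in>P. le x y \<longrightarrow> le y z \<longrightarrow> le x z)"

lemma poset_on_dual: "poset_on P (\<lambda>x y. le y x) \<longleftrightarrow> poset_on P le"
  unfolding poset_on_def by blast

lemma poset_on_subset: "poset_on P le \<Longrightarrow> Q \<subseteq> P \<Longrightarrow> poset_on Q le"
  unfolding poset_on_def by blast

lemma chain_has_max:
  assumes "poset_on P le" "S \<in> order_complex P le"
  shows "\<exists>m\<in>S. \<forall>s\<in>S. le s m"
proof -
  have S: "finite S" "S \<noteq> {}" "S \<subseteq> P" and ch: "\<And>x y. x \<in> S \<Longrightarrow> y \<in> S \<Longrightarrow> x = y \<or> le x y \<or> le y x"
    using assms(2) by (auto simp: order_complex_def pred_on.chain_def)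
  have "\<exists>m\<in>T. \<forall>s\<in>T. le s m" if "finite T" "T \<noteq> {}" "T \<subseteq> S" for T
    using that
  proof (induction rule: finite_ne_induct)
    case (singleton x)
    then show ?case using assms(1) S by (auto simp: poset_on_def)
  next
    case (insert x F)
    then obtain m where m: "m \<in> F" "\<forall>s\<in>F. le s m" by auto
    have xm: "x \<in> P" "m \<in> P" "F \<subseteq> P" using insert m S by auto
    have "x \<in> S" "m \<in> S" using insert.prems m by auto
    from ch[OF this] have "x = m \<or> le x m \<or> le m x" .
    then show ?case
    proof (elim disjE)
      assume "le m x"
      then have "\<forall>s\<in>insert x F. le s x"
        using m xm assms(1) unfolding poset_on_def by blast
      then show ?thesis by blast
    qed (use m in auto)
  qed
  then show ?thesis using S by blast
qed

lemma contractible_carrier_subset: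
  "contractible_carrier K' Y C \<Longrightarrow> K \<subseteq> K' \<Longrightarrow> contractible_carrier K Y C"
  unfolding contractible_carrier_def by (meson subsetD)

text \<open>A chain is carried to the part of \<open>Q\<close>, or of \<open>P\<close>, below its
  maximum. Existence for the first carrier yields a map \<open>g\<close> back to \<open>Q\<close>.
  Uniqueness makes both composites of \<open>g\<close> with the inclusion homotopic to the identity,
  because they share a carrier with it.\<close>

theorem quillen_inclusion:
  assumes P: "finite P" "poset_on P le" and Q: "Q \<subseteq> P"
    and fib: "\<And>p. p \<in> P \<Longrightarrow> contractible_poset {q \<in> Q. le q p} le"
  shows "homotopy_equivalence_map (poset_space Q le) (poset_space P le) id"
proof -
  let ?D = "\<lambda>Q S. {q \<in> Q. \<exists>s\<in>S. le q s}"
  let ?C = "\<lambda>Q S. rpoints (order_complex (?D Q S) le)"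
  have D: "\<exists>m\<in>S. m \<in> P \<and> ?D R S = {q \<in> R. le q m}" if S: "S \<in> order_complex P le" and R: "R \<subseteq> P" for S R
  proof -
    obtain m where m: "m \<in> S" "\<forall>s\<in>S. le s m" using chain_has_max[OF P(2) S] by blast
    have SP: "S \<subseteq> P" using S by (simp add: order_complex_def pred_on.chain_def)
    then have "m \<in> P" using m by blast
    moreover have "?D R S = {q \<in> R. le q m}"
    proof (intro equalityI subsetI)
      fix q assume "q \<in> ?D R S"
      then obtain s where "q \<in> R" "s \<in> S" "le q s" by blast
      then show "q \<in> {q \<in> R. le q m}"
        using m(2) SP R P(2) \<open>m \<in> P\<close> unfolding poset_on_def by blast
    qed (use m in blast)
    ultimately
    show ?thesis using m by blast
  qed
  have carrier: "contractible_carrier (order_complex P le) (poset_space R le) (?C R)"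
    if R: "R \<subseteq> P" and c: "\<And>p. p \<in> P \<Longrightarrow> contractible_poset {q \<in> R. le q p} le" for R
    unfolding contractible_carrier_def
  proof (intro conjI ballI impI)
    fix S assume S: "S \<in> order_complex P le"
    then have c: "contractible_poset (?D R S) le" using D[OF S R] c by fastforce
    have sub: "?D R S \<subseteq> R" by blast
    show "?C R S \<noteq> {}" using c by (simp add: contractible_poset_def rpoints_order_complex_nonempty)
    show "?C R S \<subseteq> topspace (poset_space R le)"
      by (simp add: rpoints_mono order_complex_mono)
    show "contractible_space (subtopology (poset_space R le) (?C R S))"
      using c unfolding poset_space_subset[OF sub, symmetric] contractible_poset_def by blast
  next
    fix S T :: "'a set" assume "T \<subseteq> S"
    then show "?C R T \<subseteq> ?C R S" by (intro rpoints_mono order_complex_mono) blast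
  qed
  have cone: "contractible_poset {q \<in> P. le q p} le" if "p \<in> P" for p
    using that P by (intro contractible_poset_cone[of _ p]) (auto simp: poset_on_def)
  note cQ = carrier[OF Q fib] and cP = carrier[OF order_refl cone]
  have Pcx: "finite_complex (order_complex P le)" and Qcx: "finite_complex (order_complex Q le)"
    using P Q finite_subset finite_complex_order_complex by blast+
  have cQQ: "contractible_carrier (order_complex Q le) (poset_space Q le) (?C Q)"
    by (rule contractible_carrier_subset[OF cQ order_complex_mono[OF Q]])
  have self: "x \<in> ?C R {v. x v \<noteq> 0}" if "x \<in> rpoints (order_complex R le)" "R \<subseteq> P" for x R
  proof -
    have "{v. x v \<noteq> 0} \<subseteq> R" using that by (auto simp: rpoints_def order_complex_def pred_on.chain_def)
    then have "{v. x v \<noteq> 0} \<subseteq> ?D R {v. x v \<noteq> 0}"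
      using that(2) P(2) unfolding poset_on_def by blast
    moreover have "finite {v. x v \<noteq> 0}" "{v. x v \<noteq> 0} \<noteq> {}"
      "\<forall>a\<in>{v. x v \<noteq> 0}. \<forall>b\<in>{v. x v \<noteq> 0}. le\<^sup>=\<^sup>= a b \<or> le\<^sup>=\<^sup>= b a"
      using that(1) unfolding rpoints_def order_complex_def pred_on.chain_def by blast+
    ultimately have "{v. x v \<noteq> 0} \<in> order_complex (?D R {v. x v \<noteq> 0}) le"
      unfolding order_complex_def pred_on.chain_def by blast
    then show ?thesis using that(1) by (simp add: rpoints_def)
  qed
  have empty: "rpoints {} = ({} :: ('a \<Rightarrow> real) set)" by (simp add: rpoints_def)
  \<comment> \<open>The extension starts from the empty complex, which has no points, so the value
    is arbitrary.\<close>
  have g0: "continuous_map (geometric_realization ({} :: 'a set set)) (poset_space Q le) (\<lambda>_. undefined)"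
    by (simp add: geometric_realization_eq empty)
  obtain g where g: "continuous_map (poset_space P le) (poset_space Q le) g"
    and gC: "\<And>x. x \<in> rpoints (order_complex P le) \<Longrightarrow> g x \<in> ?C Q {v. x v \<noteq> 0}"
    using carrier_extension[OF Pcx _ _ cQ g0] by (auto simp: finite_complex_def empty poset_space_def)
  have QP: "rpoints (order_complex Q le) \<subseteq> rpoints (order_complex P le)"
    using Q by (intro rpoints_mono order_complex_mono)
  have "homotopic (geometric_realization (order_complex Q le)) (poset_space Q le) (g \<circ> id) id"
  proof (rule carrier_homotopic[OF Qcx cQQ])
    show "continuous_map (geometric_realization (order_complex Q le)) (poset_space Q le) (g \<circ> id)"
      using continuous_map_compose[OF continuous_map_poset_inclusion[OF Q] g] by (simp add: poset_space_def)
  qed (use gC QP self[OF _ Q] in \<open>auto simp: poset_space_def\<close>)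
  moreover have "homotopic (geometric_realization (order_complex P le)) (poset_space P le) (id \<circ> g) id"
  proof (rule carrier_homotopic[OF Pcx cP])
    show "continuous_map (geometric_realization (order_complex P le)) (poset_space P le) (id \<circ> g)"
      using continuous_map_compose[OF g continuous_map_poset_inclusion[OF Q]] by (simp add: poset_space_def)
    fix x assume "x \<in> rpoints (order_complex P le)"
    then have "g x \<in> ?C Q {v. x v \<noteq> 0}" by (rule gC)
    moreover have "?C Q {v. x v \<noteq> 0} \<subseteq> ?C P {v. x v \<noteq> 0}"
      using Q by (intro rpoints_mono order_complex_mono) blast
    ultimately show "(id \<circ> g) x \<in> ?C P {v. x v \<noteq> 0}" by auto
  qed (use self in \<open>auto simp: poset_space_def\<close>)
  ultimately show ?thesis
    unfolding homotopy_equivalence_map_def poset_space_def[symmetric]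
    using continuous_map_poset_inclusion[OF Q] g by blast
qed

section \<open>Transport of barycentric coordinates along isomorphisms of posets\<close>

lemma poset_iso_point:
  assumes P: "finite P" and f: "\<And>p. p \<in> P \<Longrightarrow> f p \<in> Q" "\<And>p. p \<in> P \<Longrightarrow> g (f p) = p"
    and g: "\<And>q. q \<in> Q \<Longrightarrow> g q \<in> P" "\<And>q. q \<in> Q \<Longrightarrow> f (g q) = q"
    and iso: "\<And>x y. x \<in> P \<Longrightarrow> y \<in> P \<Longrightarrow> le' (f x) (f y) \<longleftrightarrow> le x y"
    and x: "x \<in> rpoints (order_complex P le)"
  shows "(\<lambda>q. if q \<in> Q then x (g q) else 0) \<in> rpoints (order_complex Q le')" (is "?y \<in> _")
proof (rule rpointsI[of _ _ "f ` P"])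
  have S: "finite {v. x v \<noteq> 0}" "{v. x v \<noteq> 0} \<noteq> {}" "{v. x v \<noteq> 0} \<subseteq> P"
      "\<And>a b. x a \<noteq> 0 \<Longrightarrow> x b \<noteq> 0 \<Longrightarrow> a = b \<or> le a b \<or> le b a"
    using x unfolding rpoints_def order_complex_def pred_on.chain_def by auto
  have fQ: "?y (f p) = x p" if "p \<in> P" for p using f that by simp
  have sup: "{q. ?y q \<noteq> 0} = f ` {v. x v \<noteq> 0}"
  proof (intro equalityI subsetI)
    fix q assume "q \<in> {q. ?y q \<noteq> 0}"
    then have "q = f (g q)" "x (g q) \<noteq> 0" using g(2) by (auto split: if_splits)
    then show "q \<in> f ` {v. x v \<noteq> 0}" by blast
  next
    fix q assume "q \<in> f ` {v. x v \<noteq> 0}"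
    then obtain p where "q = f p" "x p \<noteq> 0" "p \<in> P" using S(3) by blast
    then show "q \<in> {q. ?y q \<noteq> 0}" using f by simp
  qed
  have "le'\<^sup>=\<^sup>= (f a) (f b) \<or> le'\<^sup>=\<^sup>= (f b) (f a)" if "x a \<noteq> 0" "x b \<noteq> 0" for a b
    using S(3) S(4)[OF that] iso[of a b] iso[of b a] that by blast
  moreover have "f ` {v. x v \<noteq> 0} \<subseteq> Q" using S(3) f(1) by blast
  ultimately show "{q. ?y q \<noteq> 0} \<in> order_complex Q le'"
    unfolding sup using S(1,2) by (auto simp: order_complex_def pred_on.chain_def)
  show "{q. ?y q \<noteq> 0} \<subseteq> f ` P" unfolding sup using S(3) by blast
  have "inj_on f P" using f(2) by (rule inj_on_inverseI)
  then have "(\<Sum>q\<in>f ` P. ?y q) = (\<Sum>p\<in>P. x p)" using fQ by (subst sum.reindex) auto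
  also have "\<dots> = 1" by (rule rpoints_sum[OF x P S(3)])
  finally show "(\<Sum>q\<in>f ` P. ?y q) = 1" .
qed (use x P in \<open>auto simp: rpoints_def\<close>)

lemma poset_iso_homotopy_equivalence:
  assumes P: "finite P" and f: "inj_on f P"
    and iso: "\<And>x y. x \<in> P \<Longrightarrow> y \<in> P \<Longrightarrow> le' (f x) (f y) \<longleftrightarrow> le x y"
  defines "h \<equiv> \<lambda>x q. if q \<in> f ` P then x (inv_into P f q) else 0"
    and "h' \<equiv> \<lambda>y p. if p \<in> P then y (f p) else 0"
  shows "homotopy_equivalence_map (poset_space P le) (poset_space (f ` P) le') h"
    and "homotopy_equivalence_map (poset_space (f ` P) le') (poset_space P le) h'"
proof -
  have h: "continuous_map (poset_space P le) (poset_space (f ` P) le') h"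
    unfolding poset_space_def continuous_map_geometric_realization
  proof (intro conjI allI)
    fix q
    show "continuous_map (geometric_realization (order_complex P le)) euclideanreal (\<lambda>x. h x q)"
      by (cases "q \<in> f ` P") (auto simp: h_def intro: continuous_map_coordinate)
    show "h ` topspace (geometric_realization (order_complex P le)) \<subseteq> rpoints (order_complex (f ` P) le')"
    proof
      fix y assume "y \<in> h ` topspace (geometric_realization (order_complex P le))"
      then obtain x where "y = h x" "x \<in> rpoints (order_complex P le)" by auto
      then show "y \<in> rpoints (order_complex (f ` P) le')"
        using poset_iso_point[where P = P and f = f and Q = "f ` P" and g = "inv_into P f" and le = le and le' = le']
          P f iso unfolding h_def by (simp add: f_inv_into_f inv_into_into)
    qed
  qed
  have iso': "le (inv_into P f a) (inv_into P f b) \<longleftrightarrow> le' a b" if "a \<in> f ` P" "b \<in> f ` P" for a b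
    using that f iso by auto
  have h': "continuous_map (poset_space (f ` P) le') (poset_space P le) h'"
    unfolding poset_space_def continuous_map_geometric_realization
  proof (intro conjI allI)
    fix p
    show "continuous_map (geometric_realization (order_complex (f ` P) le')) euclideanreal (\<lambda>x. h' x p)"
      by (cases "p \<in> P") (auto simp: h'_def intro: continuous_map_coordinate)
    show "h' ` topspace (geometric_realization (order_complex (f ` P) le')) \<subseteq> rpoints (order_complex P le)"
    proof
      fix x assume "x \<in> h' ` topspace (geometric_realization (order_complex (f ` P) le'))"
      then obtain y where "x = h' y" "y \<in> rpoints (order_complex (f ` P) le')" by auto
      then show "x \<in> rpoints (order_complex P le)"
        using poset_iso_point[where P = "f ` P" and f = "inv_into P f" and Q = P and g = f and le = le' and le' = le]
          P f iso' unfolding h'_def by (simp add: f_inv_into_f inv_into_into)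
    qed
  qed
  have 1: "h' (h x) = x" if "x \<in> topspace (poset_space P le)" for x
  proof
    fix p
    have "x p = 0" if "p \<notin> P"
      using that \<open>x \<in> _\<close> by (auto simp: rpoints_def order_complex_def pred_on.chain_def)
    then show "h' (h x) p = x p" using f by (auto simp: h_def h'_def)
  qed
  have 2: "h (h' y) = y" if "y \<in> topspace (poset_space (f ` P) le')" for y
  proof
    fix q
    have "y q = 0" if "q \<notin> f ` P"
      using that \<open>y \<in> _\<close> by (auto simp: rpoints_def order_complex_def pred_on.chain_def)
    then show "h (h' y) q = y q" using f by (auto simp: h_def h'_def)
  qed
  show "homotopy_equivalence_map (poset_space P le) (poset_space (f ` P) le') h"
    and "homotopy_equivalence_map (poset_space (f ` P) le') (poset_space P le) h'"
    by (rule homotopy_equivalence_map_of_inverse[OF h h'], erule 1, erule 2)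
       (rule homotopy_equivalence_map_of_inverse[OF h' h], erule 2, erule 1)
qed

lemma poset_iso_homotopy_equivalent:
  assumes "finite P" "bij_betw f P Q"
    and "\<And>x y. x \<in> P \<Longrightarrow> y \<in> P \<Longrightarrow> le' (f x) (f y) \<longleftrightarrow> le x y"
  shows "poset_space P le homotopy_equivalent_space poset_space Q le'"
  using poset_iso_homotopy_equivalence(1)[where le = le and le' = le',
      OF assms(1) bij_betw_imp_inj_on[OF assms(2)] assms(3)]
    homotopy_equivalence_map_imp_space assms(2)
  by (auto simp: bij_betw_def)

lemma contractible_poset_equiv:
  assumes "poset_space P le homotopy_equivalent_space poset_space Q le'" "Q \<noteq> {}"
    and "contractible_poset P le"
  shows "contractible_poset Q le'"
  using assms homotopy_equivalent_space_contractibility unfolding contractible_poset_def by blast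

lemma contractible_poset_iso:
  assumes "contractible_poset P le" "finite P" "bij_betw f P Q"
    and "\<And>x y. x \<in> P \<Longrightarrow> y \<in> P \<Longrightarrow> le' (f x) (f y) \<longleftrightarrow> le x y"
  shows "contractible_poset Q le'"
proof (rule contractible_poset_equiv)
  show "poset_space P le homotopy_equivalent_space poset_space Q le'"
    by (rule poset_iso_homotopy_equivalent) (use assms in auto)
  show "Q \<noteq> {}" using assms by (auto simp: contractible_poset_def bij_betw_def)
qed (rule assms(1))

text \<open>Quillen's argument for a relation that is closed downwards in both arguments: both posets include
  into the disjoint union of the first with the dual of the second.\<close>

fun rel_le :: "('a \<Rightarrow> 'a \<Rightarrow> bool) \<Rightarrow> ('b \<Rightarrow> 'b \<Rightarrow> bool) \<Rightarrow> ('a \<Rightarrow> 'b \<Rightarrow> bool) \<Rightarrow> 'a + 'b \<Rightarrow> 'a + 'b \<Rightarrow> bool" where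
  "rel_le le le' Z (Inl p) (Inl p') \<longleftrightarrow> le p p'"
| "rel_le le le' Z (Inl p) (Inr k) \<longleftrightarrow> Z p k"
| "rel_le le le' Z (Inr k) (Inl p) \<longleftrightarrow> False"
| "rel_le le le' Z (Inr k) (Inr k') \<longleftrightarrow> le' k' k"

locale poset_relation =
  fixes P :: "'a set" and le and K :: "'b set" and le' and Z
  assumes finP: "finite P" and finK: "finite K" and posP: "poset_on P le" and posK: "poset_on K le'"
    and closed: "\<And>p p' k k'. p \<in> P \<Longrightarrow> p' \<in> P \<Longrightarrow> k \<in> K \<Longrightarrow> k' \<in> K \<Longrightarrow>
      le p' p \<Longrightarrow> le' k' k \<Longrightarrow> Z p k \<Longrightarrow> Z p' k'"
    and fibK: "\<And>p. p \<in> P \<Longrightarrow> contractible_poset {k \<in> K. Z p k} le'"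
    and fibP: "\<And>k. k \<in> K \<Longrightarrow> contractible_poset {p \<in> P. Z p k} le"
begin

abbreviation "M \<equiv> P <+> K"
abbreviation "leM \<equiv> rel_le le le' Z"

lemma finM: "finite M"
  using finP finK by (rule finite_Plus)

lemma leP_refl: "p \<in> P \<Longrightarrow> le p p"
  using posP unfolding poset_on_def by blast

lemma leK_refl: "k \<in> K \<Longrightarrow> le' k k"
  using posK unfolding poset_on_def by blast

lemma leP_antisym: "p \<in> P \<Longrightarrow> q \<in> P \<Longrightarrow> le p q \<Longrightarrow> le q p \<Longrightarrow> p = q"
  using posP unfolding poset_on_def by blast

lemma leK_antisym: "k \<in> K \<Longrightarrow> l \<in> K \<Longrightarrow> le' k l \<Longrightarrow> le' l k \<Longrightarrow> k = l"
  using posK unfolding poset_on_def by blast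

text \<open>Transitivity across the two summands is the closedness of \<open>Z\<close>; since the
  order on \<open>K\<close> is reversed, going up in \<open>K\<close> inside \<open>M\<close> means
  going down in \<open>le'\<close>.\<close>

lemma posM: "poset_on M leM"
  unfolding poset_on_def
proof (intro conjI ballI impI)
  fix x assume "x \<in> M"
  then show "leM x x" by (elim PlusE) (simp_all add: leP_refl leK_refl)
next
  fix x y assume "x \<in> M" "y \<in> M" "leM x y" "leM y x"
  then show "x = y"
    by (elim PlusE) (auto intro: leP_antisym leK_antisym)
next
  fix x y z assume xyz: "x \<in> M" "y \<in> M" "z \<in> M" and le: "leM x y" "leM y z"
  from xyz(1) show "leM x z"
  proof (elim PlusE)
    fix p assume p: "x = Inl p" "p \<in> P"
    from xyz(2) show ?thesis
    proof (elim PlusE)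
      fix q assume q: "y = Inl q" "q \<in> P"
      then have pq: "le p q" using le p by simp
      from xyz(3) show ?thesis
      proof (elim PlusE)
        fix r assume r: "z = Inl r" "r \<in> P"
        then have "le q r" using le q by simp
        then have "le p r" using pq p q r posP unfolding poset_on_def by blast
        then show ?thesis using p r by simp
      next
        fix k assume k: "z = Inr k" "k \<in> K"
        then have "Z q k" using le q by simp
        then have "Z p k" using closed[OF q(2) p(2) k(2) k(2) pq leK_refl] k by simp
        then show ?thesis using p k by simp
      qed
    next
      fix k assume k: "y = Inr k" "k \<in> K"
      then obtain k' where k': "z = Inr k'" "k' \<in> K" "le' k' k" using le xyz(3) by (cases z) auto
      have "Z p k" using le p k by simp
      then have "Z p k'" using closed[OF p(2) p(2) k(2) k'(2) leP_refl k'(3)] p by simp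
      then show ?thesis using p k' by simp
    qed
  next
    fix k assume k: "x = Inr k" "k \<in> K"
    then obtain k' where k': "y = Inr k'" "k' \<in> K" "le' k' k" using le xyz(2) by (cases y) auto
    then obtain k'' where k'': "z = Inr k''" "k'' \<in> K" "le' k'' k'" using le xyz(3) by (cases z) auto
    have "le' k'' k" using k k' k'' posK unfolding poset_on_def by blast
    then show ?thesis using k k'' by simp
  qed
qed

lemma Inl_iso: "contractible_poset Q le \<Longrightarrow> Q \<subseteq> P \<Longrightarrow> contractible_poset (Inl ` Q) leM"
  by (rule contractible_poset_iso[of Q le Inl])
     (use finite_subset[OF _ finP] in \<open>auto simp: bij_betw_def\<close>)

lemma Inr_iso: "contractible_poset Q le' \<Longrightarrow> Q \<subseteq> K \<Longrightarrow> contractible_poset (Inr ` Q) (\<lambda>x y. leM y x)"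
  by (rule contractible_poset_iso[of Q le' Inr])
     (use finite_subset[OF _ finK] in \<open>auto simp: bij_betw_def\<close>)

lemma P_inclusion: "homotopy_equivalence_map (poset_space (Inl ` P) leM) (poset_space M leM) id"
proof (rule quillen_inclusion[OF finM posM])
  show "Inl ` P \<subseteq> M" by auto
  fix x assume "x \<in> M"
  then show "contractible_poset {q \<in> Inl ` P. leM q x} leM"
  proof (elim PlusE)
    fix p assume p: "p \<in> P" "x = Inl p"
    show ?thesis
      by (rule contractible_poset_cone[of _ x])
         (use p finP leP_refl in auto)
  next
    fix k assume k: "k \<in> K" "x = Inr k"
    then have "{q \<in> Inl ` P. leM q x} = Inl ` {p \<in> P. Z p k}" by auto
    then show ?thesis using fibP[OF k(1)] Inl_iso[of "{p \<in> P. Z p k}"] by auto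
  qed
qed

text \<open>Here the upper fibres are the known ones, so Quillen's criterion is applied to the
  opposite order, which has the same order complex.\<close>

lemma K_inclusion: "homotopy_equivalence_map (poset_space (Inr ` K) leM) (poset_space M leM) id"
proof -
  have "homotopy_equivalence_map (poset_space (Inr ` K) (\<lambda>x y. leM y x)) (poset_space M (\<lambda>x y. leM y x)) id"
  proof (rule quillen_inclusion[OF finM])
    show "poset_on M (\<lambda>x y. leM y x)" by (rule iffD2[OF poset_on_dual posM])
    show "Inr ` K \<subseteq> M" by auto
    fix x assume "x \<in> M"
    then show "contractible_poset {q \<in> Inr ` K. leM x q} (\<lambda>x y. leM y x)"
    proof (elim PlusE)
      fix p assume p: "p \<in> P" "x = Inl p"
      then have "{q \<in> Inr ` K. leM x q} = Inr ` {k \<in> K. Z p k}" by auto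
      then show ?thesis using fibK[OF p(1)] Inr_iso[of "{k \<in> K. Z p k}"] by auto
    next
      fix k assume k: "k \<in> K" "x = Inr k"
      show ?thesis
        by (rule contractible_poset_cone[of _ x])
           (use k finK leK_refl in auto)
    qed
  qed
  then show ?thesis by (simp only: poset_space_dual[of M leM] poset_space_dual[of "Inr ` K" leM])
qed

theorem relation_homotopy_equivalent:
  "poset_space P le homotopy_equivalent_space poset_space K le'"
proof -
  have "poset_space P le homotopy_equivalent_space poset_space (Inl ` P) leM"
    by (rule poset_iso_homotopy_equivalent) (use finP in \<open>auto simp: bij_betw_def\<close>)
  also have "\<dots> homotopy_equivalent_space poset_space M leM"
    using P_inclusion by (rule homotopy_equivalence_map_imp_space)
  also have "\<dots> homotopy_equivalent_space poset_space (Inr ` K) leM"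
    by (rule iffD1[OF homotopy_equivalent_space_sym homotopy_equivalence_map_imp_space[OF K_inclusion]])
  also have "\<dots> = poset_space (Inr ` K) (\<lambda>x y. leM y x)"
    by (rule poset_space_dual[of "Inr ` K" leM, symmetric])
  also have "\<dots> homotopy_equivalent_space poset_space K le'"
    by (subst homotopy_equivalent_space_sym, rule poset_iso_homotopy_equivalent[of _ Inr])
       (use finK in \<open>auto simp: bij_betw_def\<close>)
  finally show ?thesis .
qed

lemma fib_imp_contractible:
  assumes "contractible_poset K le'" "P \<noteq> {}"
  shows "contractible_poset P le"
  by (rule contractible_poset_equiv[OF _ assms(2,1)],
      rule iffD1[OF homotopy_equivalent_space_sym relation_homotopy_equivalent])

text \<open>The copy of \<open>K\<close> includes into both \<open>Q.M\<close> and \<open>M\<close>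
  by equivalences, so the inclusion of \<open>Q.M\<close> into \<open>M\<close> is one. The copies
  of \<open>Q\<close> and \<open>P\<close> include by equivalences as well, and two-out-of-three
  around the square leaves the inclusion of \<open>Q\<close> into \<open>P\<close>.\<close>

theorem subposet_homotopy_equivalence:
  assumes Q: "Q \<subseteq> P" and fibQ: "\<And>k. k \<in> K \<Longrightarrow> contractible_poset {p \<in> Q. Z p k} le"
  shows "homotopy_equivalence_map (poset_space Q le) (poset_space P le) id"
proof -
  interpret Q: poset_relation Q le K le' Z
  proof
    show "finite Q" using Q finP by (rule finite_subset)
    show "poset_on Q le" using posP Q by (rule poset_on_subset)
    show "Z p' k'" if "p \<in> Q" "p' \<in> Q" "k \<in> K" "k' \<in> K" "le p' p" "le' k' k" "Z p k" for p p' k k'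
      using closed[of p p' k k'] that Q by blast
    show "contractible_poset {k \<in> K. Z p k} le'" if "p \<in> Q" for p using fibK that Q by blast
  qed (fact finK posK fibQ)+
  have sub: "Inl ` Q \<subseteq> Inl ` P" "Q.M \<subseteq> M" using Q by auto
  have "homotopy_equivalence_map (poset_space Q.M leM) (poset_space M leM) id"
    by (rule homotopy_equivalence_map_cancel_right[OF Q.K_inclusion])
       (use K_inclusion continuous_map_poset_inclusion[OF sub(2)] in auto)
  with Q.P_inclusion have "homotopy_equivalence_map (poset_space (Inl ` Q) leM) (poset_space M leM) id"
    using homotopy_equivalence_map_compose by fastforce
  then have incl: "homotopy_equivalence_map (poset_space (Inl ` Q) leM) (poset_space (Inl ` P) leM) id"
    by (intro homotopy_equivalence_map_cancel_left[OF P_inclusion])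
       (use continuous_map_poset_inclusion[OF sub(1)] in auto)
  \<comment> \<open>\<open>h\<close> and \<open>h'\<close> move coordinates along \<open>Inl\<close>
    and back. Their composite through the inclusion of the copies is the identity on points, which
    is the map asked for.\<close>
  define h where "h = (\<lambda>(x :: 'a \<Rightarrow> real) (q :: 'a + 'b). if q \<in> Inl ` Q then x (inv_into Q Inl q) else 0)"
  define h' where "h' = (\<lambda>(y :: 'a + 'b \<Rightarrow> real) p. if p \<in> P then y (Inl p) else 0)"
  have 1: "homotopy_equivalence_map (poset_space Q le) (poset_space (Inl ` Q) leM) h"
    unfolding h_def by (rule poset_iso_homotopy_equivalence(1)) (use finite_subset[OF Q finP] in auto)
  have 2: "homotopy_equivalence_map (poset_space (Inl ` P) leM) (poset_space P le) h'"
    unfolding h'_def by (rule poset_iso_homotopy_equivalence(2)) (use finP in auto)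
  have "homotopy_equivalence_map (poset_space Q le) (poset_space P le) (h' \<circ> (id \<circ> h))"
    by (intro homotopy_equivalence_map_compose[OF _ 2] homotopy_equivalence_map_compose[OF 1 incl])
  then show ?thesis
  proof (rule homotopy_equivalence_map_cong)
    fix x assume "x \<in> topspace (poset_space Q le)"
    then have x: "x p = 0" if "p \<notin> Q" for p
      using that by (auto simp: rpoints_def order_complex_def pred_on.chain_def)
    have "h x (Inl p) = x p" for p
    proof (cases "p \<in> Q")
      case True
      then have "inv_into Q (Inl :: 'a \<Rightarrow> 'a + 'b) (Inl p) = p" by (intro inv_into_f_f) auto
      then show ?thesis using True by (simp add: h_def)
    qed (auto simp: h_def x)
    moreover have "x p = 0" if "p \<notin> P" for p using x Q that by blast
    ultimately show "(h' \<circ> (id \<circ> h)) x = id x" by (auto simp: h'_def fun_eq_iff)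
  qed
qed

end

section \<open>Sign vectors and flats\<close>

lemma sign_neg_simps [simp]:
  "- (- s) = (s :: sign)" "- s = 0 \<longleftrightarrow> s = (0 :: sign)" "- (0 :: sign) = 0"
  by (cases s; simp add: zero_sign_def)+

lemma sign_eq_neg [simp]: "s = - s \<longleftrightarrow> s = (0 :: sign)" "- s = s \<longleftrightarrow> s = (0 :: sign)"
  by (cases s; simp add: zero_sign_def)+

lemma sign_trichotomy: "c \<noteq> 0 \<Longrightarrow> s = 0 \<or> s = c \<or> s = - (c :: sign)"
  by (cases s; cases c; simp add: zero_sign_def)

lemma sv_le_iff: "\<sigma> \<le> \<tau> \<longleftrightarrow> (\<forall>e. \<sigma> e = 0 \<or> \<sigma> e = (\<tau> e :: sign))"
  by (simp add: le_fun_def less_eq_sign_def)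

lemma sv_comp_apply [simp]: "(\<sigma> \<circ>\<^sub>s \<tau>) e = (if \<sigma> e \<noteq> 0 then \<sigma> e else \<tau> e)"
  by (simp add: sv_comp_def)

lemma sv_uminus_apply [simp]: "(- \<sigma>) e = - (\<sigma> e :: sign)"
  by (simp add: fun_Compl_def)

lemma sv_comp_absorb: "\<sigma>' \<le> \<sigma> \<Longrightarrow> \<sigma> \<circ>\<^sub>s (\<sigma>' \<circ>\<^sub>s \<tau>) = \<sigma> \<circ>\<^sub>s \<tau>"
  by (auto simp: fun_eq_iff sv_le_iff)

lemma sv_comp_eq_iff: "\<sigma> \<circ>\<^sub>s \<tau> = \<tau> \<longleftrightarrow> \<sigma> \<le> \<tau>"
  by (auto simp: fun_eq_iff sv_le_iff)

lemma sv_le_comp: "\<sigma> \<le> \<sigma> \<circ>\<^sub>s \<tau>"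
  by (simp add: sv_le_iff)

lemma sv_restrict_apply [simp]: "sv_restrict A \<sigma> e = (if e \<in> A then \<sigma> e else 0)"
  by (simp add: sv_restrict_def)

lemma sv_restrict_comp: "sv_restrict A (\<sigma> \<circ>\<^sub>s \<tau>) = sv_restrict A \<sigma> \<circ>\<^sub>s sv_restrict A \<tau>"
  by (simp add: fun_eq_iff)

lemma sv_restrict_mono: "\<sigma> \<le> \<tau> \<Longrightarrow> sv_restrict A \<sigma> \<le> sv_restrict A \<tau>"
  by (simp add: sv_le_iff)

lemma salvetti_le_iff: "salvetti_le (\<sigma>, T) (\<tau>, R) \<longleftrightarrow> \<tau> \<le> \<sigma> \<and> \<sigma> \<circ>\<^sub>s R = T"
  by (simp add: salvetti_le_def)

lemma salvetti_le_comp_iff: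
  "salvetti_le (\<sigma>, \<sigma> \<circ>\<^sub>s \<omega>) (\<sigma>', \<sigma>' \<circ>\<^sub>s \<omega>) \<longleftrightarrow> \<sigma>' \<le> \<sigma>"
  by (auto simp: salvetti_le_iff sv_comp_absorb)

lemma poset_on_salvetti_le: "poset_on (salvetti L) salvetti_le"
  unfolding poset_on_def
proof (intro conjI ballI impI)
  fix x assume "x \<in> salvetti L"
  then show "salvetti_le x x"
    by (auto simp: salvetti_def salvetti_le_iff sv_comp_eq_iff)
next
  fix x y assume "x \<in> salvetti L" "y \<in> salvetti L" "salvetti_le x y" "salvetti_le y x"
  moreover obtain \<sigma> T \<tau> R where xy: "x = (\<sigma>, T)" "y = (\<tau>, R)" by (metis surj_pair)
  ultimately have "\<sigma> = \<tau>" "\<sigma> \<circ>\<^sub>s R = T" "\<tau> \<le> R" by (auto simp: salvetti_def salvetti_le_iff)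
  then show "x = y" using sv_comp_eq_iff[of \<sigma> R] xy by simp
next
  fix x y z assume xyz: "x \<in> salvetti L" "y \<in> salvetti L" "z \<in> salvetti L"
    and le: "salvetti_le x y" "salvetti_le y z"
  obtain \<sigma> T \<tau> R \<upsilon> Q where "x = (\<sigma>, T)" "y = (\<tau>, R)" "z = (\<upsilon>, Q)" by (metis surj_pair)
  then show "salvetti_le x z"
    using le sv_comp_absorb[of \<tau> \<sigma> Q] by (auto simp: salvetti_le_iff)
qed

lemma finite_sign_vectors: "finite E \<Longrightarrow> finite (sign_vectors E)"
proof -
  assume E: "finite E"
  have "finite (UNIV :: sign set)"
    by (rule finite_subset[of _ "{Neg, Zero, Pos}"]) (auto intro: sign.exhaust)
  then have "finite {f. (\<forall>e. (e \<in> E \<longrightarrow> f e \<in> (UNIV :: sign set)) \<and> (e \<notin> E \<longrightarrow> f e = 0))}"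
    by (intro finite_set_of_finite_funs E)
  then show ?thesis by (simp add: sign_vectors_def)
qed

text \<open>If \<open>T\<close> vanishes at an element where \<open>\<sigma>\<close> does not, then
  \<open>T \<circ>\<^sub>s \<sigma>\<close> is strictly larger. Stated for any set closed under
  composition, so that it serves the localization and the planar matroids as well.\<close>

lemma topes_iff:
  assumes "\<And>\<sigma> \<tau>. \<sigma> \<in> L \<Longrightarrow> \<tau> \<in> L \<Longrightarrow> \<sigma> \<circ>\<^sub>s \<tau> \<in> L"
  shows "T \<in> topes L \<longleftrightarrow> T \<in> L \<and> (\<forall>e. T e = 0 \<longrightarrow> (\<forall>\<sigma>\<in>L. \<sigma> e = 0))"
proof
  assume T: "T \<in> topes L"
  have "\<sigma> e = 0" if "T e = 0" "\<sigma> \<in> L" for e \<sigma>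
  proof -
    have "T \<circ>\<^sub>s \<sigma> = T"
      using T assms[of T \<sigma>] that sv_le_comp[of T \<sigma>] by (auto simp: topes_def)
    then have "(T \<circ>\<^sub>s \<sigma>) e = T e" by simp
    then show ?thesis using that by simp
  qed
  then show "T \<in> L \<and> (\<forall>e. T e = 0 \<longrightarrow> (\<forall>\<sigma>\<in>L. \<sigma> e = 0))"
    using T by (auto simp: topes_def)
next
  assume T: "T \<in> L \<and> (\<forall>e. T e = 0 \<longrightarrow> (\<forall>\<sigma>\<in>L. \<sigma> e = 0))"
  have "\<sigma> = T" if "\<sigma> \<in> L" "T \<le> \<sigma>" for \<sigma>
  proof
    fix e show "\<sigma> e = T e" using T that unfolding sv_le_iff by metis
  qed
  then show "T \<in> topes L" using T by (auto simp: topes_def)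
qed

text \<open>Signs read relative to a reference \<open>c\<close> become integers, which turns the
  incomparable \<open>Pos\<close> and \<open>Neg\<close> into positions before and after a crossing.
  The value -1 means \<open>- c e\<close> only where \<open>c e\<close> is nonzero.\<close>

definition rel :: "'e sign_vector \<Rightarrow> 'e sign_vector \<Rightarrow> 'e \<Rightarrow> int" where
  "rel c \<sigma> e = (if \<sigma> e = 0 then 0 else if \<sigma> e = c e then 1 else -1)"

lemma rel_range: "rel c \<sigma> e \<in> {-1, 0, 1}"
  by (simp add: rel_def)

lemma rel_eq_iff:
  assumes "c e \<noteq> 0"
  shows "rel c \<sigma> e = 1 \<longleftrightarrow> \<sigma> e = c e" "rel c \<sigma> e = 0 \<longleftrightarrow> \<sigma> e = 0" "rel c \<sigma> e = -1 \<longleftrightarrow> \<sigma> e = - c e"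
  using assms sign_trichotomy[OF assms, of "\<sigma> e"] by (auto simp: rel_def)

lemma rel_inject: "c e \<noteq> 0 \<Longrightarrow> rel c \<sigma> e = rel c \<tau> e \<Longrightarrow> \<sigma> e = \<tau> e"
  using rel_eq_iff[of c e \<sigma>] rel_eq_iff[of c e \<tau>] rel_range[of c \<sigma> e] by auto

section \<open>Ranks of finite posets\<close>

lemma poset_rank_ge:
  assumes "finite P" and C: "pred_on.chain P (<) C"
  shows "card C - 1 \<le> poset_rank P"
proof -
  let ?S = "{D. pred_on.chain P (<) D \<and> C \<subseteq> D}"
  have sub: "D \<subseteq> P" if "pred_on.chain P (<) D" for D using that by (simp add: pred_on.chain_def)
  have "finite ?S" by (rule finite_subset[of _ "Pow P"]) (use sub assms in auto)
  moreover have "?S \<noteq> {}" using C by blast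
  ultimately obtain M where M: "M \<in> ?S" "\<forall>D\<in>?S. M \<subseteq> D \<longrightarrow> M = D"
    using finite_has_maximal[of ?S] by blast
  have "pred_on.maxchain P (<) M"
    using M unfolding pred_on.maxchain_def by auto
  moreover have "finite {D. pred_on.maxchain P (<) D}"
    by (rule finite_subset[of _ "Pow P"]) (use sub assms in \<open>auto simp: pred_on.maxchain_def\<close>)
  ultimately have "card M - 1 \<le> poset_rank P" unfolding poset_rank_def by (intro Max_ge) auto
  moreover have "card C \<le> card M"
    using M sub finite_subset[OF _ assms(1)] by (intro card_mono) auto
  ultimately show ?thesis by linarith
qed

lemma poset_rank_attained:
  assumes "finite P" "P \<noteq> {}"
  obtains C where "pred_on.chain P (<) C" "C \<noteq> {}" "poset_rank P = card C - 1"
proof -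
  have sub: "D \<subseteq> P" if "pred_on.maxchain P (<) D" for D
    using that by (simp add: pred_on.maxchain_def pred_on.chain_def)
  have "finite {D. pred_on.maxchain P (<) D}"
    by (rule finite_subset[of _ "Pow P"]) (use sub assms in auto)
  moreover have "{D. pred_on.maxchain P (<) D} \<noteq> {}" using pred_on.Hausdorff[of P "(<)"] by blast
  ultimately have "poset_rank P \<in> (\<lambda>C. card C - 1) ` {C. pred_on.maxchain P (<) C}"
    unfolding poset_rank_def by (intro Max_in) auto
  then obtain C where C: "pred_on.maxchain P (<) C" "poset_rank P = card C - 1" by blast
  moreover have "C \<noteq> {}"
  proof
    assume "C = {}"
    obtain x where "x \<in> P" using assms by blast
    then have "pred_on.chain P (<) {x}" by (simp add: pred_on.chain_def)
    then show False using C(1) \<open>C = {}\<close> by (auto simp: pred_on.maxchain_def)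
  qed
  ultimately show ?thesis using that by (auto simp: pred_on.maxchain_def)
qed

context oriented_matroid
begin

lemma finite_L: "finite L"
  using finite_subset[OF covectors finite_sign_vectors[OF finite_ground]] .

lemma outside: "\<sigma> \<in> L \<Longrightarrow> e \<notin> E \<Longrightarrow> \<sigma> e = 0"
  using covectors by (auto simp: sign_vectors_def)

section \<open>Closure in the lattice of flats and modular coatoms\<close>

lemma flat_E: "E \<in> flats E L"
  using zero_mem by (force simp: flats_def zero_set_def)

lemma flat_subset: "F \<in> flats E L \<Longrightarrow> F \<subseteq> E"
  by (auto simp: flats_def zero_set_def)

lemma finite_flats: "finite (flats E L)"
  by (rule finite_subset[of _ "Pow E"]) (use flat_subset finite_ground in auto)

lemma flat_Int:
  assumes "F \<in> flats E L" "G \<in> flats E L"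
  shows "F \<inter> G \<in> flats E L"
proof -
  obtain \<sigma> \<tau> where "\<sigma> \<in> L" "\<tau> \<in> L" "F = zero_set E \<sigma>" "G = zero_set E \<tau>"
    using assms by (auto simp: flats_def)
  moreover from this have "F \<inter> G = zero_set E (\<sigma> \<circ>\<^sub>s \<tau>)" by (auto simp: zero_set_def split: if_splits)
  ultimately show ?thesis using comp_mem by (auto simp: flats_def)
qed

lemma flat_Inter:
  assumes "finite \<F>" "\<F> \<noteq> {}" "\<F> \<subseteq> flats E L"
  shows "\<Inter>\<F> \<in> flats E L"
  using assms by (induction rule: finite_ne_induct) (auto intro: flat_Int)

definition cl :: "'e set \<Rightarrow> 'e set" where
  "cl A = \<Inter>{F \<in> flats E L. A \<subseteq> F}"

lemma cl_flat: "A \<subseteq> E \<Longrightarrow> cl A \<in> flats E L"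
  unfolding cl_def using finite_flats flat_E by (intro flat_Inter) auto

lemma subset_cl: "A \<subseteq> cl A"
  by (auto simp: cl_def)

lemma cl_least: "F \<in> flats E L \<Longrightarrow> A \<subseteq> F \<Longrightarrow> cl A \<subseteq> F"
  by (auto simp: cl_def)

lemma cl_zero: "\<eta> \<in> L \<Longrightarrow> A \<subseteq> E \<Longrightarrow> h \<in> cl A \<Longrightarrow> \<forall>a\<in>A. \<eta> a = 0 \<Longrightarrow> \<eta> h = 0"
  using cl_least[of "zero_set E \<eta>" A] by (auto simp: flats_def zero_set_def)

lemma flat_join_eq: "A \<subseteq> E \<Longrightarrow> B \<subseteq> E \<Longrightarrow> flat_join E L A B = cl (A \<union> B)"
  unfolding flat_join_def using cl_flat[of "A \<union> B"] subset_cl[of "A \<union> B"] cl_least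
  by (intro Least_equality) auto

text \<open>A flat strictly between \<open>X\<close> and \<open>E\<close> would let a longest chain
  below \<open>X\<close> be extended by two elements, so the rank would grow by at least
  two.\<close>

lemma coatom:
  assumes X: "X \<in> flats E L" and cor: "corank_one E L X"
  shows "X \<noteq> E" "\<And>Y. Y \<in> flats E L \<Longrightarrow> X \<subset> Y \<Longrightarrow> Y = E"
proof -
  show "X \<noteq> E" using cor by (auto simp: corank_one_def)
  fix Y assume Y: "Y \<in> flats E L" "X \<subset> Y"
  show "Y = E"
  proof (rule ccontr)
    assume "Y \<noteq> E"
    then have YE: "Y \<subset> E" using flat_subset[OF Y(1)] by blast
    let ?D = "\<lambda>X. {Y \<in> flats E L. Y \<subseteq> X}"
    have fin: "finite (?D Z)" for Z using finite_flats by simp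
    obtain C where C: "pred_on.chain (?D X) (<) C" "C \<noteq> {}" "poset_rank (?D X) = card C - 1"
      using poset_rank_attained[OF fin[of X]] X by blast
    have CX: "C \<subseteq> ?D X" "\<And>a b. a \<in> C \<Longrightarrow> b \<in> C \<Longrightarrow> (<)\<^sup>=\<^sup>= a b \<or> (<)\<^sup>=\<^sup>= b a"
      using C(1) unfolding pred_on.chain_def by blast+
    have finC: "finite C" using CX(1) fin[of X] finite_subset by blast
    have notin: "Y \<notin> C" "E \<notin> insert Y C" using CX(1) Y YE by auto
    have "pred_on.chain (?D E) (<) (insert E (insert Y C))"
      unfolding pred_on.chain_def
    proof (intro conjI ballI)
      show "insert E (insert Y C) \<subseteq> ?D E" using CX(1) Y YE flat_E flat_subset by auto
      have CY: "c \<subset> Y" "c \<subset> E" if "c \<in> C" for c using that CX(1) Y YE by auto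
      fix a b assume "a \<in> insert E (insert Y C)" "b \<in> insert E (insert Y C)"
      then show "(<)\<^sup>=\<^sup>= a b \<or> (<)\<^sup>=\<^sup>= b a"
        using CX(2)[of a b] CY YE by (elim insertE) simp_all
    qed
    from poset_rank_ge[OF fin this] have "card C + 1 \<le> poset_rank (?D E)"
      using finC notin by simp
    \<comment> \<open>Guards the truncated subtraction in \<open>card C - 1\<close>.\<close>
    moreover have "card C \<ge> 1" using C(2) finC by (simp add: Suc_le_eq card_gt_0_iff)
    ultimately show False
      using cor C(3) by (simp add: corank_one_def flat_rank_def)
  qed
qed

text \<open>The join of the coatom \<open>X\<close> with an element outside it is \<open>E\<close>.
  The modular law for \<open>cl {e}\<close> below \<open>Y\<close> therefore says that
  \<open>Y\<close> is the join of \<open>cl {e}\<close> with \<open>X \<inter> Y\<close>.\<close>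

lemma modular_coatom_closure:
  assumes X: "modular_flat E L X" "corank_one E L X"
    and Y: "Y \<in> flats E L" "e \<in> Y - X" and W: "W \<in> flats E L" "e \<in> W" "X \<inter> Y \<subseteq> W"
  shows "Y \<subseteq> W"
proof -
  have XF: "X \<in> flats E L" using X by (simp add: modular_flat_def)
  have sub: "X \<subseteq> E" "Y \<subseteq> E" "{e} \<subseteq> E" using flat_subset XF Y by auto
  let ?Z = "cl {e}"
  have Z: "?Z \<in> flats E L" "?Z \<subseteq> Y" "?Z \<subseteq> W" "e \<in> ?Z" "?Z \<subseteq> E"
    using cl_flat[OF sub(3)] cl_least[OF Y(1), of "{e}"] cl_least[OF W(1), of "{e}"] subset_cl[of "{e}"]
      Y W flat_subset by auto
  have J: "flat_join E L ?Z X = cl (?Z \<union> X)" "flat_join E L ?Z (X \<inter> Y) = cl (?Z \<union> (X \<inter> Y))"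
    using Z sub by (auto intro!: flat_join_eq)
  have "cl (?Z \<union> X) \<in> flats E L" using Z sub by (intro cl_flat) auto
  moreover have "X \<subset> cl (?Z \<union> X)" using subset_cl[of "?Z \<union> X"] Z Y by auto
  ultimately have "cl (?Z \<union> X) = E" using coatom(2)[OF XF X(2)] by blast
  moreover have "flat_join E L ?Z (X \<inter> Y) = flat_join E L ?Z X \<inter> Y"
    using X(1) Y(1) Z unfolding modular_flat_def by blast
  ultimately have "cl (?Z \<union> (X \<inter> Y)) = Y" using J sub by auto
  then show ?thesis using cl_least[OF W(1), of "?Z \<union> (X \<inter> Y)"] Z W by auto
qed

text \<open>By modularity two non-parallel elements outside \<open>X\<close> span a line that meets \<open>X\<close>, in an element
  \<open>h\<close> say, and the circuit on \<open>e\<close>, \<open>f\<close>, \<open>h\<close> determines the sign at \<open>f\<close>.\<close>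

lemma modular_coatom_determined:
  assumes X: "modular_flat E L X" "corank_one E L X"
    and Z: "Z \<in> flats E L" "e \<in> Z - X" "f \<in> Z - X"
    and ab: "\<alpha> \<in> L" "\<beta> \<in> L" "\<And>x. x \<in> X \<inter> Z \<Longrightarrow> \<alpha> x = \<beta> x" "\<alpha> e = 0" "\<beta> e = 0"
  shows "\<alpha> f = \<beta> f"
proof (cases "\<forall>\<sigma>\<in>L. \<sigma> e = 0 \<longrightarrow> \<sigma> f = 0")
  case True
  then have "\<alpha> f = 0" "\<beta> f = 0" using ab(1,2,4,5) by blast+
  then show ?thesis by simp
next
  case False
  then obtain \<sigma> where \<sigma>: "\<sigma> \<in> L" "\<sigma> e = 0" "\<sigma> f \<noteq> 0" by blast
  have efE: "{e, f} \<subseteq> E" "e \<in> E" "f \<in> E" using Z flat_subset by auto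
  define Y where "Y = cl {e, f}"
  have Y: "Y \<in> flats E L" "e \<in> Y - X" "f \<in> Y" "Y \<subseteq> Z"
    using cl_flat[OF efE(1)] subset_cl[of "{e, f}"] cl_least[OF Z(1), of "{e, f}"] Z by (auto simp: Y_def)
  \<comment> \<open>By modularity a covector that vanishes at \<open>e\<close> and on
    \<open>X \<inter> Y\<close> vanishes on all of \<open>Y\<close>, but \<open>\<sigma> f\<close>
    is nonzero. This produces the third element \<open>h\<close> of the line through
    \<open>e\<close> and \<open>f\<close>.\<close>
  have "\<not> X \<inter> Y \<subseteq> zero_set E \<sigma>"
  proof
    assume "X \<inter> Y \<subseteq> zero_set E \<sigma>"
    then have "Y \<subseteq> zero_set E \<sigma>"
      using modular_coatom_closure[OF X Y(1,2), of "zero_set E \<sigma>"] \<sigma> efE by (auto simp: flats_def zero_set_def)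
    then show False using Y(3) \<sigma> by (auto simp: zero_set_def)
  qed
  then obtain h where h: "h \<in> X \<inter> Y" "\<sigma> h \<noteq> 0" using Y flat_subset[of Y] by (auto simp: zero_set_def)
  have hE: "h \<in> E" using h Y flat_subset by blast
  have hY: "\<eta> h = 0" if "\<eta> \<in> L" "\<eta> e = 0" "\<eta> f = 0" for \<eta>
    using cl_zero[OF that(1) efE(1), of h] h that by (auto simp: Y_def)
  \<comment> \<open>\<open>f\<close> lies on the line through \<open>e\<close> and \<open>h\<close>:
    otherwise eliminating \<open>f\<close> between \<open>\<sigma>\<close> and \<open>\<eta>\<close>
    or its negative leaves a covector that vanishes at \<open>e\<close> and \<open>f\<close> but not
    at \<open>h\<close>.\<close>
  have claim: "\<eta> f = 0" if \<eta>: "\<eta> \<in> L" "\<eta> e = 0" "\<eta> h = 0" for \<eta>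
  proof (rule ccontr)
    assume f: "\<eta> f \<noteq> 0"
    obtain \<eta>' where \<eta>': "\<eta>' \<in> L" "\<eta>' e = 0" "\<eta>' h = 0" "\<sigma> f = - \<eta>' f"
    proof (cases "\<sigma> f = \<eta> f")
      case True
      then show ?thesis using that[of "- \<eta>"] uminus_mem[OF \<eta>(1)] \<eta> by simp
    next
      case False
      then have "\<sigma> f = - \<eta> f" using sign_trichotomy[OF f, of "\<sigma> f"] \<sigma> by auto
      then show ?thesis using that[of \<eta>] \<eta> by simp
    qed
    have "f \<in> separation \<sigma> \<eta>'" using \<eta>' \<sigma> by (simp add: separation_def)
    from elimination[OF \<sigma>(1) \<eta>'(1) this] obtain \<xi> where \<xi>: "\<xi> \<in> L" "\<xi> f = 0"
      "\<And>g. g \<in> E - separation \<sigma> \<eta>' \<Longrightarrow> \<xi> g = (\<sigma> \<circ>\<^sub>s \<eta>') g" by blast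
    have "e \<in> E - separation \<sigma> \<eta>'" "h \<in> E - separation \<sigma> \<eta>'"
      using efE hE \<sigma> \<eta>' h by (auto simp: separation_def)
    then have "\<xi> e = 0" "\<xi> h = \<sigma> h" using \<xi>(3)[of e] \<xi>(3)[of h] \<sigma> \<eta>' h by auto
    then show False using hY[OF \<xi>(1)] \<xi>(2) h by simp
  qed
  have abh: "\<alpha> h = \<beta> h" using ab(3)[of h] h Y by blast
  show ?thesis
  proof (cases "\<alpha> h = 0")
    case True
    then show ?thesis using claim[OF ab(1,4)] claim[OF ab(2,5)] abh by simp
  next
    case False
    have mb: "- \<beta> \<in> L" using uminus_mem[OF ab(2)] .
    \<comment> \<open>Eliminating \<open>h\<close> between \<open>\<alpha>\<close> and
      \<open>- \<beta>\<close> gives a covector zero at \<open>e\<close> and \<open>h\<close>, hence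
      at \<open>f\<close>. If \<open>\<alpha>\<close> and \<open>\<beta>\<close> differed at
      \<open>f\<close>, it would inherit a nonzero sign there.\<close>
    have "h \<in> separation \<alpha> (- \<beta>)" using False abh by (simp add: separation_def)
    from elimination[OF ab(1) mb this] obtain \<zeta> where \<zeta>: "\<zeta> \<in> L" "\<zeta> h = 0"
      "\<And>g. g \<in> E - separation \<alpha> (- \<beta>) \<Longrightarrow> \<zeta> g = (\<alpha> \<circ>\<^sub>s (- \<beta>)) g" by blast
    have "e \<in> E - separation \<alpha> (- \<beta>)" using ab efE by (auto simp: separation_def)
    then have "\<zeta> e = 0" using \<zeta>(3)[of e] ab by auto
    then have zf: "\<zeta> f = 0" using claim[OF \<zeta>(1) _ \<zeta>(2)] by blast
    show ?thesis
    proof (rule ccontr)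
      assume ne: "\<alpha> f \<noteq> \<beta> f"
      then have "f \<in> E - separation \<alpha> (- \<beta>)" using efE by (auto simp: separation_def)
      then have "(\<alpha> \<circ>\<^sub>s (- \<beta>)) f = 0" using \<zeta>(3)[of f] zf by simp
      then show False using ne by (auto split: if_splits)
    qed
  qed
qed

end

section \<open>Planar oriented matroids\<close>

definition sign_of :: "real \<Rightarrow> sign" where
  "sign_of x = (if x > 0 then Pos else if x < 0 then Neg else 0)"

lemma sign_simps [simp]: "Pos \<noteq> 0" "Neg \<noteq> 0" "- Pos = Neg" "- Neg = Pos"
  by (simp_all add: zero_sign_def)

lemma sign_of_simps [simp]:
  "sign_of x = 0 \<longleftrightarrow> x = 0" "sign_of x = Pos \<longleftrightarrow> x > 0" "sign_of x = Neg \<longleftrightarrow> x < 0"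
  "sign_of (- x) = - sign_of x" "sign_of 0 = 0"
  by (auto simp: sign_of_def)

lemma sign_of_eq_iff: "sign_of x = sign_of y \<longleftrightarrow> (x > 0 \<longleftrightarrow> y > 0) \<and> (x < 0 \<longleftrightarrow> y < 0)"
  by (auto simp: sign_of_def)

text \<open>The range consists of the covectors of the central arrangement in the plane with normal
  vectors \<open>(a i, b i)\<close>; a zero normal gives a loop.\<close>

definition planar :: "'i set \<Rightarrow> ('i \<Rightarrow> real) \<Rightarrow> ('i \<Rightarrow> real) \<Rightarrow> real \<times> real \<Rightarrow> 'i sign_vector" where
  "planar I a b = (\<lambda>(x, y) i. if i \<in> I then sign_of (a i * x + b i * y) else 0)"

lemma planar_apply: "planar I a b (x, y) i = (if i \<in> I then sign_of (a i * x + b i * y) else 0)"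
  by (simp add: planar_def)

text \<open>Composition is a small step from \<open>p\<close> in the direction \<open>q\<close>: at
  \<open>p + d q\<close> the forms that are nonzero at \<open>p\<close> keep their sign, and the
  others take the sign at \<open>q\<close>.\<close>

lemma planar_comp:
  assumes "finite I"
  shows "\<exists>r. planar I a b p \<circ>\<^sub>s planar I a b q = planar I a b r"
proof -
  obtain x y u v where pq: "p = (x, y)" "q = (u, v)" by (cases p; cases q)
  define f where "f = (\<lambda>i. a i * x + b i * y)"
  define g where "g = (\<lambda>i. a i * u + b i * v)"
  \<comment> \<open>The inserted 1 keeps the minimum defined when every form vanishes at
    \<open>p\<close>; the 1 in the denominator of \<open>d\<close> keeps it positive and makes the
    bound on \<open>d * g i\<close> strict.\<close>
  define c where "c = Min (insert 1 ((\<lambda>i. \<bar>f i\<bar>) ` {i \<in> I. f i \<noteq> 0}))"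
  define d where "d = c / (1 + (\<Sum>i\<in>I. \<bar>g i\<bar>))"
  have fin: "finite (insert 1 ((\<lambda>i. \<bar>f i\<bar>) ` {i \<in> I. f i \<noteq> 0}))" using assms by simp
  have c: "c > 0" using fin unfolding c_def by (subst Min_gr_iff) auto
  have cle: "c \<le> \<bar>f i\<bar>" if "i \<in> I" "f i \<noteq> 0" for i
    unfolding c_def using fin that by (intro Min_le) auto
  have S: "1 + (\<Sum>i\<in>I. \<bar>g i\<bar>) > 0" by (smt (verit) sum_nonneg abs_ge_zero)
  then have d: "d > 0" using c by (simp add: d_def)
  have small: "\<bar>d * g i\<bar> < \<bar>f i\<bar>" if i: "i \<in> I" "f i \<noteq> 0" for i
  proof -
    have "\<bar>g i\<bar> \<le> (\<Sum>i\<in>I. \<bar>g i\<bar>)" using assms i by (intro member_le_sum) auto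
    then have "d * \<bar>g i\<bar> \<le> d * (\<Sum>i\<in>I. \<bar>g i\<bar>)" using d by (intro mult_left_mono) auto
    also have "\<dots> < d * (1 + (\<Sum>i\<in>I. \<bar>g i\<bar>))" using d by (intro mult_strict_left_mono) auto
    also have "\<dots> = c" using S by (simp add: d_def)
    finally show ?thesis using cle[OF i] d by (simp add: abs_mult)
  qed
  have "planar I a b p \<circ>\<^sub>s planar I a b q = planar I a b (x + d * u, y + d * v)"
  proof
    fix i
    have e: "a i * (x + d * u) + b i * (y + d * v) = f i + d * g i"
      by (simp add: f_def g_def algebra_simps)
    show "(planar I a b p \<circ>\<^sub>s planar I a b q) i = planar I a b (x + d * u, y + d * v) i"
    proof (cases "i \<in> I")
      case True
      have "sign_of (f i + d * g i) = sign_of (f i)" if "f i \<noteq> 0"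
        using small[OF True that] unfolding sign_of_eq_iff by auto
      moreover have "sign_of (d * g i) = sign_of (g i)"
        using d by (simp add: sign_of_eq_iff zero_less_mult_iff mult_less_0_iff)
      ultimately show ?thesis
        using True by (auto simp: pq planar_apply e) (auto simp: f_def g_def)
    qed (simp add: planar_def pq)
  qed
  then show ?thesis by blast
qed

text \<open>The positive combination of \<open>p\<close> and \<open>q\<close> with weights
  \<open>\<bar>g e\<bar>\<close> and \<open>\<bar>f e\<bar>\<close> kills the form \<open>e\<close>.
  A form without opposite signs at \<open>p\<close> and \<open>q\<close> has the composed sign at
  any positive combination.\<close>

lemma planar_eliminate:
  assumes e: "e \<in> separation (planar I a b p) (planar I a b q)"
  shows "\<exists>r. planar I a b r e = 0 \<and> (\<forall>i\<in>I - separation (planar I a b p) (planar I a b q).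
    planar I a b r i = (planar I a b p \<circ>\<^sub>s planar I a b q) i \<and>
    (planar I a b p \<circ>\<^sub>s planar I a b q) i = (planar I a b q \<circ>\<^sub>s planar I a b p) i)"
proof -
  obtain x y u v where pq: "p = (x, y)" "q = (u, v)" by (cases p; cases q)
  define f where "f = (\<lambda>i. a i * x + b i * y)"
  define g where "g = (\<lambda>i. a i * u + b i * v)"
  have P: "planar I a b p i = sign_of (f i)" "planar I a b q i = sign_of (g i)" if "i \<in> I" for i
    using that by (auto simp: planar_apply pq f_def g_def)
  have eI: "e \<in> I" using e by (auto simp: separation_def pq planar_apply split: if_splits)
  have opp: "sign_of (f e) = - sign_of (g e)" "f e \<noteq> 0"
    using e P[OF eI] by (auto simp: separation_def)
  have opp': "f e > 0 \<and> g e < 0 \<or> f e < 0 \<and> g e > 0"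
    using opp by (auto simp: sign_of_def split: if_splits)
  define l where "l = \<bar>g e\<bar>"
  define m where "m = \<bar>f e\<bar>"
  have lm: "l > 0" "m > 0" using opp' by (auto simp: l_def m_def)
  define r where "r = (l * x + m * u, l * y + m * v)"
  have R: "planar I a b r i = sign_of (l * f i + m * g i)" if "i \<in> I" for i
    using that by (auto simp: planar_apply r_def f_def g_def algebra_simps)
  have "planar I a b r e = 0" using R[OF eI] opp' by (auto simp: l_def m_def)
  moreover have "planar I a b r i = (planar I a b p \<circ>\<^sub>s planar I a b q) i \<and>
    (planar I a b p \<circ>\<^sub>s planar I a b q) i = (planar I a b q \<circ>\<^sub>s planar I a b p) i"
    if i: "i \<in> I - separation (planar I a b p) (planar I a b q)" for i
  proof -
    have iI: "i \<in> I" using i by blast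
    have sc: "sign_of (l * f i) = sign_of (f i)" "sign_of (m * g i) = sign_of (g i)"
      using lm by (simp_all add: sign_of_eq_iff zero_less_mult_iff mult_less_0_iff)
    have "\<not> (f i > 0 \<and> g i < 0)" "\<not> (f i < 0 \<and> g i > 0)"
      using i P[OF iI] by (auto simp: separation_def sign_of_def)
    then consider "f i = 0" | "g i = 0" | "f i > 0" "g i > 0" | "f i < 0" "g i < 0" by linarith
    then show ?thesis
    proof cases
      case 3
      then have "l * f i + m * g i > 0" using lm by (simp add: add_pos_pos)
      then show ?thesis using 3 P[OF iI] R[OF iI] by (auto simp: sign_of_def)
    next
      case 4
      then have "l * f i + m * g i < 0" using lm by (simp add: add_neg_neg mult_pos_neg)
      then show ?thesis using 4 P[OF iI] R[OF iI] by (auto simp: sign_of_def)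
    qed (use P[OF iI] R[OF iI] sc in auto)
  qed
  ultimately show ?thesis by blast
qed

lemma planar_oriented_matroid:
  assumes "finite I"
  shows "oriented_matroid I (range (planar I a b))"
proof
  show "finite I" by (rule assms)
  show "range (planar I a b) \<subseteq> sign_vectors I"
    by (auto simp: sign_vectors_def planar_def split: prod.splits)
  have "(\<lambda>_. 0) = planar I a b (0, 0)" by (auto simp: planar_def fun_eq_iff)
  then show "(\<lambda>_. 0) \<in> range (planar I a b)" by blast
next
  fix \<sigma> assume "\<sigma> \<in> range (planar I a b)"
  then obtain x y where "\<sigma> = planar I a b (x, y)" by force
  then have "- \<sigma> = planar I a b (- x, - y)"
    by (auto simp: planar_def fun_eq_iff simp flip: sign_of_simps(4))
  then show "- \<sigma> \<in> range (planar I a b)" by blast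
next
  fix \<sigma> \<tau> assume "\<sigma> \<in> range (planar I a b)" "\<tau> \<in> range (planar I a b)"
  then show "\<sigma> \<circ>\<^sub>s \<tau> \<in> range (planar I a b)" using planar_comp[OF assms, of a b] by force
next
  fix \<sigma> \<tau> e assume "\<sigma> \<in> range (planar I a b)" "\<tau> \<in> range (planar I a b)" "e \<in> separation \<sigma> \<tau>"
  then show "\<exists>\<eta>\<in>range (planar I a b). \<eta> e = 0 \<and> (\<forall>f\<in>I - separation \<sigma> \<tau>.
      \<eta> f = (\<sigma> \<circ>\<^sub>s \<tau>) f \<and> (\<sigma> \<circ>\<^sub>s \<tau>) f = (\<tau> \<circ>\<^sub>s \<sigma>) f)"
    using planar_eliminate[of e I a b] by force
qed

text \<open>A coordinate \<open>i\<close> vanishing at \<open>q\<close> vanishes at the nonzero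
  point \<open>p\<close> too, together with some coordinate \<open>k\<close> that the step from
  \<open>p\<close> to \<open>q\<close> switches on. In the plane the form \<open>k\<close> is then a
  multiple of the form \<open>i\<close>, so it vanishes at \<open>q\<close>, a
  contradiction.\<close>

lemma planar_chain_step:
  assumes st: "planar I a b p < planar I a b q" and nz: "planar I a b p \<noteq> (\<lambda>_. 0)"
    and i: "i \<in> I" "a i \<noteq> 0 \<or> b i \<noteq> 0"
  shows "planar I a b q i \<noteq> 0"
proof
  assume qi: "planar I a b q i = 0"
  obtain x y u v where pq: "p = (x, y)" "q = (u, v)" by (cases p; cases q)
  have le: "planar I a b p \<le> planar I a b q" "planar I a b p \<noteq> planar I a b q" using st by auto
  then have pi: "planar I a b p i = 0" using qi unfolding sv_le_iff by metis
  obtain k where k: "planar I a b p k \<noteq> planar I a b q k" using le(2) by auto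
  then have pk: "planar I a b p k = 0" using le(1) unfolding sv_le_iff by blast
  have kI: "k \<in> I" using k by (auto simp: pq planar_apply split: if_splits)
  have eqs: "a i * x + b i * y = 0" "a k * x + b k * y = 0" "a i * u + b i * v = 0" "a k * u + b k * v \<noteq> 0"
    using pi pk qi k i kI by (auto simp: pq planar_apply)
  have "x \<noteq> 0 \<or> y \<noteq> 0" using nz by (auto simp: pq planar_def fun_eq_iff split: if_splits)
  moreover have "x * (a i * b k - a k * b i) = 0" "y * (a i * b k - a k * b i) = 0"
    using eqs(1,2) by algebra+
  ultimately have "a i * b k = a k * b i" by auto
  then have "a i * (a k * u + b k * v) = 0" "b i * (a k * u + b k * v) = 0"
    using eqs(3) by algebra+
  then show False using i(2) eqs(4) by auto
qed

text \<open>A strictly increasing height with values 0, 1, 2 (origin, point on a line, point off all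
  lines) bounds every chain by three elements; the two independent forms provide a chain of that
  size.\<close>

lemma planar_rank:
  assumes I: "finite I" "i \<in> I" "j \<in> I" and ij: "a i * b j \<noteq> a j * b i"
  shows "om_rank (range (planar I a b)) = 2"
proof -
  let ?L = "range (planar I a b)"
  interpret oriented_matroid I ?L using I by (intro planar_oriented_matroid)
  have finite_L: "finite ?L" using finite_subset[OF covectors finite_sign_vectors[OF I(1)]] .
  define h where "h = (\<lambda>\<sigma> :: 'a sign_vector. if \<sigma> = (\<lambda>_. 0) then 0
    else if \<exists>i\<in>I. (a i \<noteq> 0 \<or> b i \<noteq> 0) \<and> \<sigma> i = 0 then 1 else (2 :: nat))"
  have mono: "h \<sigma> < h \<tau>" if "\<sigma> \<in> ?L" "\<tau> \<in> ?L" "\<sigma> < \<tau>" for \<sigma> \<tau>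
  proof -
    have le: "\<sigma> \<le> \<tau>" "\<sigma> \<noteq> \<tau>" using that by auto
    have \<tau>0: "\<tau> \<noteq> (\<lambda>_. 0)"
    proof
      assume "\<tau> = (\<lambda>_. 0)"
      then have "\<sigma> = \<tau>" using le by (auto simp: sv_le_iff fun_eq_iff)
      with le show False by simp
    qed
    show ?thesis
    proof (cases "\<sigma> = (\<lambda>_. 0)")
      case True
      then show ?thesis using \<tau>0 by (simp add: h_def)
    next
      case False
      obtain k where k: "\<sigma> k \<noteq> \<tau> k" using le by auto
      then have \<sigma>k: "\<sigma> k = 0" using le unfolding sv_le_iff by blast
      obtain p where "\<tau> = planar I a b p" using \<open>\<tau> \<in> ?L\<close> by blast
      moreover obtain x y where "p = (x, y)" by (cases p)
      ultimately have "\<tau> = planar I a b (x, y)" by simp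
      then have "k \<in> I" "a k \<noteq> 0 \<or> b k \<noteq> 0" using k \<sigma>k by (auto simp: planar_apply split: if_splits)
      then have 1: "h \<sigma> = 1" using False \<sigma>k by (auto simp: h_def)
      have "\<tau> i \<noteq> 0" if i: "i \<in> I" "a i \<noteq> 0 \<or> b i \<noteq> 0" for i
        using planar_chain_step[of I a b _ _ i] that \<open>\<sigma> \<in> ?L\<close> \<open>\<tau> \<in> ?L\<close> \<open>\<sigma> < \<tau>\<close> False by blast
      then have "h \<tau> = 2" using \<tau>0 by (auto simp: h_def)
      then show ?thesis using 1 by simp
    qed
  qed
  have card3: "card C \<le> 3" if "pred_on.chain ?L (<) C" for C
  proof -
    have C: "C \<subseteq> ?L" "\<And>x y. x \<in> C \<Longrightarrow> y \<in> C \<Longrightarrow> x < y \<or> x = y \<or> y < x"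
      using that by (auto simp: pred_on.chain_def)
    have "h x \<noteq> h y" if "x \<in> C" "y \<in> C" "x \<noteq> y" for x y
    proof -
      have "x \<in> ?L" "y \<in> ?L" using that C(1) by blast+
      then show ?thesis using C(2)[OF that(1,2)] that(3) mono[of x y] mono[of y x] by linarith
    qed
    then have "inj_on h C" by (auto simp: inj_on_def)
    moreover have "h ` C \<subseteq> {0, 1, 2}" by (auto simp: h_def)
    ultimately have "card C \<le> card {0, 1, 2 :: nat}" by (metis card_inj_on_le finite.emptyI finite_insert)
    then show ?thesis by simp
  qed
  \<comment> \<open>A direction vector of the line \<open>i\<close>; composing with a direction
    vector of the line \<open>j\<close> then leaves the line \<open>i\<close>.\<close>
  define \<sigma> where "\<sigma> = planar I a b (b i, - a i)"
  define \<tau> where "\<tau> = \<sigma> \<circ>\<^sub>s planar I a b (b j, - a j)"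
  let ?C = "{(\<lambda>_. 0), \<sigma>, \<tau>}"
  have \<tau>L: "\<tau> \<in> ?L" unfolding \<tau>_def \<sigma>_def by (rule comp_mem) auto
  have \<sigma>L: "\<sigma> \<in> ?L" by (simp add: \<sigma>_def)
  have \<sigma>ij: "\<sigma> i = 0" "\<sigma> j \<noteq> 0" using I ij by (auto simp: \<sigma>_def planar_apply)
  have \<tau>i: "\<tau> i \<noteq> 0" using I ij \<sigma>ij by (auto simp: \<tau>_def planar_apply)
  have st: "\<sigma> \<le> \<tau>" "(\<lambda>_. 0) \<le> \<sigma>" "(\<lambda>_. 0) \<le> \<tau>" by (simp_all add: \<tau>_def sv_le_comp) (simp_all add: sv_le_iff)
  have ne: "\<sigma> \<noteq> \<tau>" "(\<lambda>_. 0) \<noteq> \<sigma>" "(\<lambda>_. 0) \<noteq> \<tau>" using \<sigma>ij \<tau>i by metis+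
  have C3: "card ?C = 3" using ne by simp
  have chainC: "pred_on.chain ?L (<) ?C"
    using \<tau>L zero_mem st ne \<sigma>L unfolding pred_on.chain_def by (auto simp: order.strict_iff_order)
  have "pred_on.maxchain ?L (<) ?C"
  proof -
    have "\<not> (pred_on.chain ?L (<) S \<and> ?C \<subset> S)" for S
    proof
      assume S: "pred_on.chain ?L (<) S \<and> ?C \<subset> S"
      then have "finite S" using finite_L finite_subset by (auto simp: pred_on.chain_def)
      then have "card ?C < card S" using S psubset_card_mono by blast
      then show False using card3[of S] S C3 by simp
    qed
    then show ?thesis using chainC by (simp add: pred_on.maxchain_def)
  qed
  then have "2 \<in> (\<lambda>C. card C - 1) ` {C. pred_on.maxchain ?L (<) C}"
    using C3 by (metis (mono_tags, lifting) diff_add_inverse2 image_eqI mem_Collect_eq numeral_Bit1 numeral_One one_add_one)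
  moreover have "n \<le> 2" if "n \<in> (\<lambda>C. card C - 1) ` {C. pred_on.maxchain ?L (<) C}" for n
    using that card3 pred_on.maxchain_imp_chain by fastforce
  moreover have "finite {C. pred_on.maxchain ?L (<) C}"
    by (rule finite_subset[of _ "Pow ?L"]) (use finite_L in \<open>auto simp: pred_on.maxchain_def pred_on.chain_def\<close>)
  ultimately show ?thesis
    unfolding om_rank_def poset_rank_def by (intro Max_eqI) auto
qed

lemma sign_of_rel:
  assumes "c e \<noteq> 0" "real_of_int (rel c \<sigma> e) = sgn z"
  shows "sign_of ((if c e = Pos then 1 else -1) * z) = \<sigma> e"
proof -
  have "z > 0 \<longleftrightarrow> rel c \<sigma> e = 1" "z < 0 \<longleftrightarrow> rel c \<sigma> e = -1"
    using assms(2) rel_range[of c \<sigma> e] by (auto simp: sgn_if split: if_splits)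
  then show ?thesis
    using assms(1) unfolding rel_def sign_of_def zero_sign_def
    by (cases "c e"; cases "\<sigma> e") auto
qed

section \<open>Lines over the localization at a modular coatom\<close>

text \<open>From here on modularity enters only through the assumption \<open>modular\<close>: with
  \<open>Z = E\<close> it makes points of lines unique, with smaller \<open>Z\<close> it permits
  amalgamation. \<open>\<kappa>\<close> fixes a common direction for all lines.\<close>

locale modular_coatom = oriented_matroid E L for E :: "'e set" and L +
  fixes X :: "'e set" and \<kappa> :: "'e sign_vector"
  assumes X: "X \<subseteq> E" "X \<noteq> E" and \<kappa>: "\<kappa> \<in> L" "zero_set E \<kappa> = X"
    and modular: "\<And>Z e f \<alpha> \<beta>. Z \<in> flats E L \<Longrightarrow> e \<in> Z - X \<Longrightarrow> f \<in> Z - X \<Longrightarrow> \<alpha> \<in> L \<Longrightarrow> \<beta> \<in> L \<Longrightarrow>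
      (\<And>x. x \<in> X \<inter> Z \<Longrightarrow> \<alpha> x = \<beta> x) \<Longrightarrow> \<alpha> e = 0 \<Longrightarrow> \<beta> e = 0 \<Longrightarrow> \<alpha> f = \<beta> f"
begin

section \<open>Points on the line over a covector of the localization\<close>

lemma \<kappa>_zero: "x \<in> X \<Longrightarrow> \<kappa> x = 0"
  using \<kappa> by (auto simp: zero_set_def)

lemma \<kappa>_nonzero: "e \<in> E - X \<Longrightarrow> \<kappa> e \<noteq> 0"
  using \<kappa> by (auto simp: zero_set_def)

lemma ext_eq:
  assumes "\<sigma> \<in> L" "\<tau> \<in> L" "\<forall>x\<in>X. \<sigma> x = \<tau> x" "\<And>f. f \<in> E - X \<Longrightarrow> \<sigma> f = \<tau> f"
  shows "\<sigma> = \<tau>"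
proof
  fix e show "\<sigma> e = \<tau> e"
    using assms outside[of \<sigma> e] outside[of \<tau> e] by (cases "e \<in> E"; cases "e \<in> X") auto
qed

text \<open>Elimination between \<open>\<sigma>\<close> and \<open>- c\<close> moves along the line
  away from \<open>c\<close> until \<open>e\<close> vanishes. As \<open>c\<close> is zero on
  \<open>X\<close>, the restriction to \<open>X\<close> is unchanged. Allowing both signs of
  \<open>\<kappa>\<close> covers both directions.\<close>

lemma eliminate:
  assumes c: "c \<in> {\<kappa>, - \<kappa>}" and \<sigma>: "\<sigma> \<in> L" and e: "e \<in> E - X" "\<sigma> e = c e"
  shows "\<exists>v\<in>L. (\<forall>x\<in>X. v x = \<sigma> x) \<and> v e = 0 \<and> (\<forall>f\<in>E - X. \<sigma> f \<noteq> c f \<longrightarrow> v f = - c f)"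
proof -
  have cL: "- c \<in> L" using c \<kappa> uminus_mem[of \<kappa>] by (auto simp: fun_eq_iff fun_Compl_def)
  have cX: "c x = 0" if "x \<in> X" for x using c \<kappa>_zero[OF that] by auto
  have cE: "c f \<noteq> 0" if "f \<in> E - X" for f using c \<kappa>_nonzero[OF that] by auto
  have "e \<in> separation \<sigma> (- c)" using e cE[OF e(1)] by (simp add: separation_def)
  from elimination[OF \<sigma> cL this] obtain v where v: "v \<in> L" "v e = 0"
    and vf: "\<And>f. f \<in> E - separation \<sigma> (- c) \<Longrightarrow> v f = (\<sigma> \<circ>\<^sub>s (- c)) f" by blast
  have "v x = \<sigma> x" if "x \<in> X" for x
  proof -
    have "x \<in> E - separation \<sigma> (- c)" using that X cX[OF that] by (auto simp: separation_def)
    then show ?thesis using vf[of x] cX[OF that] by simp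
  qed
  moreover have "v f = - c f" if f: "f \<in> E - X" "\<sigma> f \<noteq> c f" for f
    using vf[of f] f cE[OF f(1)] sign_trichotomy[OF cE[OF f(1)], of "\<sigma> f"] by (auto simp: separation_def)
  ultimately show ?thesis using v by blast
qed

lemma point_exists:
  assumes "\<sigma> \<in> L" "e \<in> E - X"
  shows "\<exists>v\<in>L. (\<forall>x\<in>X. v x = \<sigma> x) \<and> v e = 0"
proof -
    consider "\<sigma> e = 0" | "\<sigma> e = \<kappa> e" | "\<sigma> e = (- \<kappa>) e"
      using sign_trichotomy[OF \<kappa>_nonzero[OF assms(2)], of "\<sigma> e"] by auto
    then show ?thesis
    proof cases
      case 1
      then show ?thesis using assms by blast
    next
      case 2
      then show ?thesis using eliminate[of \<kappa> \<sigma> e] assms by blast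
    next
      case 3
      then show ?thesis using eliminate[of "- \<kappa>" \<sigma> e] assms by blast
    qed
qed

text \<open>The case \<open>Z = E\<close> of modularity: a line crosses \<open>e\<close> in a single
  point.\<close>

lemma point_unique:
  assumes "\<sigma> \<in> L" "v \<in> L" "\<forall>x\<in>X. v x = \<sigma> x" "e \<in> E - X" "v e = 0" "\<sigma> e = 0"
  shows "\<sigma> = v"
proof (rule ext_eq)
  fix f assume "f \<in> E - X"
  then show "\<sigma> f = v f" using modular[OF flat_E, of e f \<sigma> v] assms by auto
qed (use assms in auto)

text \<open>Moving from \<open>\<sigma>\<close> back to where \<open>e\<close> vanishes must end at
  \<open>v\<close>, the only such point. An element not yet of sign \<open>c\<close> at
  \<open>\<sigma>\<close> would have sign \<open>- c\<close> there.\<close>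

lemma cut:
  assumes c: "c \<in> {\<kappa>, - \<kappa>}" and \<sigma>: "\<sigma> \<in> L" "v \<in> L" "\<forall>x\<in>X. v x = \<sigma> x"
    and e: "e \<in> E - X" "v e = 0" "\<sigma> e = c e" and f: "f \<in> E - X" "v f \<noteq> - c f"
  shows "\<sigma> f = c f"
proof (rule ccontr)
  assume "\<sigma> f \<noteq> c f"
  moreover obtain u where u: "u \<in> L" "\<forall>x\<in>X. u x = \<sigma> x" "u e = 0" "\<forall>f\<in>E - X. \<sigma> f \<noteq> c f \<longrightarrow> u f = - c f"
    using eliminate[OF c \<sigma>(1) e(1,3)] by blast
  moreover have "u = v" using point_unique[of u v e] u \<sigma> e by auto
  ultimately show False using f by blast
qed

text \<open>The order of travel in direction \<open>\<kappa>\<close>. It ignores \<open>X\<close>,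
  and is antisymmetric and total only among covectors with the same restriction to
  \<open>X\<close>.\<close>

definition below :: "'e sign_vector \<Rightarrow> 'e sign_vector \<Rightarrow> bool" (infix \<open>\<sqsubseteq>\<close> 50) where
  "\<sigma> \<sqsubseteq> \<tau> \<longleftrightarrow> (\<forall>f\<in>E - X. rel \<kappa> \<sigma> f \<le> rel \<kappa> \<tau> f)"

lemma below_trans: "\<sigma> \<sqsubseteq> \<tau> \<Longrightarrow> \<tau> \<sqsubseteq> \<upsilon> \<Longrightarrow> \<sigma> \<sqsubseteq> \<upsilon>"
  unfolding below_def by (meson order_trans)

lemma below_refl [simp]: "\<sigma> \<sqsubseteq> \<sigma>"
  by (simp add: below_def)

lemma rel_simps:
  assumes "f \<in> E - X"
  shows "rel \<kappa> \<sigma> f = 1 \<longleftrightarrow> \<sigma> f = \<kappa> f" "rel \<kappa> \<sigma> f = 0 \<longleftrightarrow> \<sigma> f = 0" "rel \<kappa> \<sigma> f = -1 \<longleftrightarrow> \<sigma> f = - \<kappa> f"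
  by (rule rel_eq_iff[of \<kappa> f, OF \<kappa>_nonzero[OF assms]])+

lemma below_antisym:
  assumes "\<sigma> \<in> L" "\<tau> \<in> L" "\<forall>x\<in>X. \<sigma> x = \<tau> x" "\<sigma> \<sqsubseteq> \<tau>" "\<tau> \<sqsubseteq> \<sigma>"
  shows "\<sigma> = \<tau>"
proof (rule ext_eq[OF assms(1-3)])
  fix f assume f: "f \<in> E - X"
  then have "rel \<kappa> \<sigma> f = rel \<kappa> \<tau> f" using assms(4,5) unfolding below_def by (meson order.antisym)
  then show "\<sigma> f = \<tau> f" by (rule rel_inject[of \<kappa> f, OF \<kappa>_nonzero[OF f]])
qed

text \<open>By \<open>cut\<close>, beyond \<open>e\<close> every element has sign
  \<open>\<kappa>\<close> unless \<open>v\<close> has sign \<open>- \<kappa>\<close> there, and in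
  that case the relative sign of \<open>v\<close> is already the least possible.\<close>

lemma point_below:
  assumes "\<sigma> \<in> L" "v \<in> L" "\<forall>x\<in>X. v x = \<sigma> x" "e \<in> E - X" "v e = 0" "rel \<kappa> \<sigma> e \<ge> 0"
  shows "v \<sqsubseteq> \<sigma>"
proof (cases "\<sigma> e = 0")
  case True
  then show ?thesis using point_unique[of \<sigma> v e] assms by simp
next
  case False
  then have "\<sigma> e = \<kappa> e" using assms(6) by (auto simp: rel_def split: if_splits)
  then have "\<sigma> f = \<kappa> f" if "f \<in> E - X" "v f \<noteq> - \<kappa> f" for f
    using cut[of \<kappa> \<sigma> v e f] assms that by simp
  then show ?thesis
    unfolding below_def using rel_simps rel_range[of \<kappa> \<sigma>] rel_range[of \<kappa> v]
    by (smt (verit, best) insertE singletonD)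
qed

lemma below_point:
  assumes "\<sigma> \<in> L" "v \<in> L" "\<forall>x\<in>X. v x = \<sigma> x" "e \<in> E - X" "v e = 0" "rel \<kappa> \<sigma> e \<le> 0"
  shows "\<sigma> \<sqsubseteq> v"
proof (cases "\<sigma> e = 0")
  case True
  then show ?thesis using point_unique[of \<sigma> v e] assms by simp
next
  case False
  then have "\<sigma> e = - \<kappa> e" using assms(6) rel_simps[OF assms(4), of \<sigma>] rel_range[of \<kappa> \<sigma> e] by auto
  then have "\<sigma> f = - \<kappa> f" if "f \<in> E - X" "v f \<noteq> \<kappa> f" for f
    using cut[of "- \<kappa>" \<sigma> v e f] assms that by simp
  then show ?thesis
    unfolding below_def using rel_simps rel_range[of \<kappa> \<sigma>] rel_range[of \<kappa> v]
    by (smt (verit, best) insertE singletonD)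
qed

text \<open>A coordinate \<open>f\<close> at which \<open>\<tau>\<close> is strictly behind
  \<open>\<sigma>\<close> provides the point where \<open>f\<close> vanishes, and this point lies
  between them.\<close>

lemma below_total:
  assumes "\<sigma> \<in> L" "\<tau> \<in> L" "\<forall>x\<in>X. \<sigma> x = \<tau> x"
  shows "\<sigma> \<sqsubseteq> \<tau> \<or> \<tau> \<sqsubseteq> \<sigma>"
proof (cases "\<sigma> \<sqsubseteq> \<tau>")
  case False
  then obtain f where f: "f \<in> E - X" "rel \<kappa> \<tau> f < rel \<kappa> \<sigma> f" by (auto simp: below_def)
  obtain v where v: "v \<in> L" "\<forall>x\<in>X. v x = \<sigma> x" "v f = 0" using point_exists[OF assms(1) f(1)] by blast
  have "rel \<kappa> \<tau> f \<le> 0" "rel \<kappa> \<sigma> f \<ge> 0"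
    using f(2) rel_range[of \<kappa> \<tau> f] rel_range[of \<kappa> \<sigma> f] by auto
  then have "\<tau> \<sqsubseteq> v" "v \<sqsubseteq> \<sigma>"
    using below_point[of \<tau> v f] point_below[of \<sigma> v f] v f assms by auto
  then show ?thesis using below_trans by blast
qed simp

lemma rel_sign_iff:
  assumes "f \<in> E - X"
  shows "rel \<kappa> \<sigma> f \<le> 0 \<longleftrightarrow> \<sigma> f \<noteq> \<kappa> f" "0 \<le> rel \<kappa> \<sigma> f \<longleftrightarrow> \<sigma> f \<noteq> - \<kappa> f"
  using \<kappa>_nonzero[OF assms] sign_trichotomy[OF \<kappa>_nonzero[OF assms], of "\<sigma> f"] by (auto simp: rel_def)

lemma comp_\<kappa>:
  assumes "c \<in> {\<kappa>, - \<kappa>}" "\<sigma> \<in> L"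
  shows "\<sigma> \<circ>\<^sub>s c \<in> L" "c \<circ>\<^sub>s \<sigma> \<in> L" "\<And>x. x \<in> X \<Longrightarrow> (\<sigma> \<circ>\<^sub>s c) x = \<sigma> x" "\<And>x. x \<in> X \<Longrightarrow> (c \<circ>\<^sub>s \<sigma>) x = \<sigma> x"
  using assms \<kappa> uminus_mem[of \<kappa>] comp_mem \<kappa>_zero by auto

text \<open>Whatever is strictly before the point \<open>m\<close> has sign
  \<open>- \<kappa>\<close> at each element that vanishes at \<open>m\<close> or is still ahead, so
  it is at most the open interval \<open>m \<circ>\<^sub>s (- \<kappa>)\<close> that ends at
  \<open>m\<close>.\<close>

lemma not_above_point:
  assumes "m \<in> L" "q \<in> L" "\<forall>x\<in>X. m x = q x" "q \<sqsubseteq> m" "q \<noteq> m" and e: "e \<in> E - X" "m e = 0"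
  shows "q \<sqsubseteq> m \<circ>\<^sub>s (- \<kappa>)" "\<And>f. f \<in> E - X \<Longrightarrow> m f \<noteq> \<kappa> f \<Longrightarrow> q f = - \<kappa> f"
proof -
  have "q e \<noteq> 0"
    using point_unique[of q m e] assms by auto
  moreover have "rel \<kappa> q e \<le> rel \<kappa> m e" using assms(4) e unfolding below_def by blast
  then have "q e \<noteq> \<kappa> e" using e rel_sign_iff(1)[OF e(1), of q] by (simp add: rel_def)
  ultimately have "q e = - \<kappa> e" using sign_trichotomy[OF \<kappa>_nonzero[OF e(1)], of "q e"] by blast
  then show *: "q f = - \<kappa> f" if "f \<in> E - X" "m f \<noteq> \<kappa> f" for f
    using cut[of "- \<kappa>" q m e f] assms that by simp
  show "q \<sqsubseteq> m \<circ>\<^sub>s (- \<kappa>)"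
    unfolding below_def
  proof
    fix f assume f: "f \<in> E - X"
    show "rel \<kappa> q f \<le> rel \<kappa> (m \<circ>\<^sub>s (- \<kappa>)) f"
    proof (cases "m f = \<kappa> f")
      case True
      then show ?thesis using \<kappa>_nonzero[OF f] by (simp add: rel_def)
    next
      case False
      then have "q f = - \<kappa> f" using *[OF f] by simp
      then have "rel \<kappa> q f = -1" using rel_simps(3)[OF f] by simp
      then show ?thesis using rel_range[of \<kappa> "m \<circ>\<^sub>s (- \<kappa>)" f] by auto
    qed
  qed
qed

lemma line_max:
  assumes "S \<subseteq> L" "S \<noteq> {}" "\<And>\<sigma> \<tau>. \<sigma> \<in> S \<Longrightarrow> \<tau> \<in> S \<Longrightarrow> \<forall>x\<in>X. \<sigma> x = \<tau> x"
  shows "\<exists>m\<in>S. \<forall>s\<in>S. s \<sqsubseteq> m"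
proof -
  have "finite S" using finite_L assms(1) finite_subset by blast
  have "\<exists>m\<in>T. \<forall>s\<in>T. s \<sqsubseteq> m" if "finite T" "T \<noteq> {}" "T \<subseteq> S" for T
    using that
  proof (induction rule: finite_ne_induct)
    case (singleton x)
    then show ?case by simp
  next
    case (insert x F)
    then obtain m where m: "m \<in> F" "\<forall>s\<in>F. s \<sqsubseteq> m" by auto
    have S: "x \<in> S" "m \<in> S" using insert.prems m by auto
    then have "x \<sqsubseteq> m \<or> m \<sqsubseteq> x" using below_total[of x m] assms(1) assms(3)[OF S] by blast
    then show ?case
    proof
      assume "m \<sqsubseteq> x"
      then have "\<forall>s\<in>insert x F. s \<sqsubseteq> x" using m below_trans by auto
      then show ?thesis by blast
    qed (use m in blast)
  qed
  from this[OF \<open>finite S\<close> assms(2) order_refl] show ?thesis .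
qed

text \<open>The last among the points defined by elements of \<open>F\<close>: each element of
  \<open>F\<close> vanishes at some point not beyond it, hence has been reached there.\<close>

lemma highest_point:
  assumes \<alpha>: "\<alpha> \<in> L" and F: "F \<subseteq> E - X" "F \<noteq> {}"
  shows "\<exists>e\<in>F. \<exists>v\<in>L. (\<forall>x\<in>X. v x = \<alpha> x) \<and> v e = 0 \<and> (\<forall>f\<in>F. v f = 0 \<or> v f = \<kappa> f)"
proof -
  define V where "V = {v \<in> L. (\<forall>x\<in>X. v x = \<alpha> x) \<and> (\<exists>f\<in>F. v f = 0)}"
  have ptV: "\<exists>w\<in>V. w f = 0" if f: "f \<in> F" for f
  proof -
    have "f \<in> E - X" using f F by blast
    from point_exists[OF \<alpha> this] show ?thesis using f unfolding V_def by blast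
  qed
  have "V \<noteq> {}" using ptV F by blast
  then have "\<exists>v\<in>V. \<forall>w\<in>V. w \<sqsubseteq> v" by (intro line_max) (auto simp: V_def)
  then obtain v where v: "v \<in> V" and vmax: "\<And>w. w \<in> V \<Longrightarrow> w \<sqsubseteq> v" by blast
  have "v f = 0 \<or> v f = \<kappa> f" if f: "f \<in> F" for f
  proof -
    have fE: "f \<in> E - X" using f F by blast
    obtain w where w: "w \<in> V" "w f = 0" using ptV[OF f] by blast
    have "rel \<kappa> w f \<le> rel \<kappa> v f" using vmax[OF w(1)] fE unfolding below_def by blast
    then have "v f \<noteq> - \<kappa> f" using w(2) rel_simps(3)[OF fE, of v] by (auto simp: rel_def)
    then show ?thesis using sign_trichotomy[OF \<kappa>_nonzero[OF fE], of "v f"] by blast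
  qed
  then show ?thesis using v unfolding V_def by blast
qed

text \<open>The covectors over a fixed covector of the localization form a line, along which points and
  open intervals alternate. Hence the last element of a convex set is comparable in the face order
  to its predecessor only.\<close>

lemma line_remove_last:
  assumes Q: "Q \<subseteq> L" "\<And>\<sigma> \<tau>. \<sigma> \<in> Q \<Longrightarrow> \<tau> \<in> Q \<Longrightarrow> \<forall>x\<in>X. \<sigma> x = \<tau> x"
    and conv: "\<And>\<alpha> \<beta> \<gamma>. \<alpha> \<in> Q \<Longrightarrow> \<beta> \<in> Q \<Longrightarrow> \<gamma> \<in> L \<Longrightarrow> \<forall>x\<in>X. \<gamma> x = \<alpha> x \<Longrightarrow>
      \<alpha> \<sqsubseteq> \<gamma> \<Longrightarrow> \<gamma> \<sqsubseteq> \<beta> \<Longrightarrow> \<gamma> \<in> Q"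
    and m: "m \<in> Q" "\<And>q. q \<in> Q \<Longrightarrow> q \<sqsubseteq> m" and Q': "Q - {m} \<noteq> {}"
  shows "\<exists>u\<in>Q - {m}. {q \<in> Q - {m}. m \<le> q} = {u} \<or> {q \<in> Q - {m}. q \<le> m} = {u}"
proof -
  obtain q0 where q0: "q0 \<in> Q - {m}" using Q' by blast
  have mL: "m \<in> L" using m Q by blast
  show ?thesis
  proof (cases "\<exists>e\<in>E - X. m e = 0")
    case True
    then obtain e where e: "e \<in> E - X" "m e = 0" by blast
    \<comment> \<open>\<open>m\<close> is a point, and \<open>u\<close> is the open interval just
      before it.\<close>
    define u where "u = m \<circ>\<^sub>s (- \<kappa>)"
    have uL: "u \<in> L" "\<forall>x\<in>X. u x = m x" using comp_\<kappa>[of "- \<kappa>" m] mL by (auto simp: u_def)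
    have below: "q \<sqsubseteq> u" "\<And>f. f \<in> E - X \<Longrightarrow> m f \<noteq> \<kappa> f \<Longrightarrow> q f = - \<kappa> f" if "q \<in> Q - {m}" for q
      using not_above_point[of m q e] that m Q(1) Q(2)[of m q] mL e unfolding u_def by blast+
    have "u \<sqsubseteq> m"
      unfolding below_def
    proof
      fix f assume f: "f \<in> E - X"
      show "rel \<kappa> u f \<le> rel \<kappa> m f" using \<kappa>_nonzero[OF f] by (auto simp: rel_def u_def)
    qed
    then have "u \<in> Q" using conv[of q0 m u] q0 m below(1)[OF q0] uL Q(2)[of m q0] by auto
    moreover have "u \<noteq> m" using e \<kappa>_nonzero[OF e(1)] by (auto simp: u_def fun_eq_iff)
    ultimately have uQ: "u \<in> Q - {m}" by blast
    have uniq: "q = u" if q: "q \<in> Q - {m}" "m \<le> q" for q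
    proof (rule ext_eq)
      show "q \<in> L" "\<forall>x\<in>X. q x = u x" using q Q(1) Q(2)[of q m] m uL by auto
      fix f assume f: "f \<in> E - X"
      show "q f = u f"
      proof (cases "m f = 0")
        case True
        then have "q f = - \<kappa> f" using below(2)[OF q(1) f] \<kappa>_nonzero[OF f] by auto
        then show ?thesis using True by (simp add: u_def)
      next
        case False
        then show ?thesis using q(2) by (auto simp: u_def sv_le_iff)
      qed
    qed (rule uL)
    have "m \<le> u" by (simp add: u_def sv_le_comp)
    then have "{q \<in> Q - {m}. m \<le> q} = {u}" using uniq uQ by blast
    then show ?thesis using uQ by blast
  next
    case False
    \<comment> \<open>\<open>m\<close> is an open interval and \<open>F\<close> are the elements
      already crossed; the last crossing \<open>v\<close> is the point at which the interval
      begins.\<close>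
    define F where "F = {f \<in> E - X. m f = \<kappa> f}"
    have mneg: "m f = - \<kappa> f" if "f \<in> E - X" "f \<notin> F" for f
      using that False sign_trichotomy[OF \<kappa>_nonzero[OF that(1)], of "m f"] by (auto simp: F_def)
    have lower: "\<exists>f\<in>F. rel \<kappa> q f \<le> 0" if q: "q \<in> Q - {m}" for q
    proof -
      have "\<not> m \<sqsubseteq> q" using below_antisym[of q m] q m Q(1) Q(2)[of q m] by blast
      then obtain f where f: "f \<in> E - X" "rel \<kappa> q f < rel \<kappa> m f" unfolding below_def by force
      then have "m f \<noteq> - \<kappa> f" using rel_simps(3)[OF f(1), of m] rel_range[of \<kappa> q f] by auto
      then have "f \<in> F" using mneg f by blast
      moreover have "rel \<kappa> q f \<le> 0" using f(2) rel_range[of \<kappa> m f] rel_range[of \<kappa> q f] by auto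
      ultimately show ?thesis by blast
    qed
    have F: "F \<subseteq> E - X" "F \<noteq> {}" using lower[OF q0] by (auto simp: F_def)
    obtain f0 v where f0: "f0 \<in> F" "v f0 = 0" "v \<in> L" "\<forall>x\<in>X. v x = m x"
      and vF: "\<forall>f\<in>F. v f = 0 \<or> v f = \<kappa> f"
      using highest_point[OF mL F] by blast
    have f0E: "f0 \<in> E - X" "m f0 = \<kappa> f0" using f0 by (auto simp: F_def)
    have vm: "v \<sqsubseteq> m"
      using point_below[of m v f0] f0 f0E mL rel_simps(1)[OF f0E(1), of m] by auto
    have vk: "m f = (v \<circ>\<^sub>s \<kappa>) f" if f: "f \<in> E - X" for f
    proof (cases "f \<in> F")
      case True
      then show ?thesis using vF by (auto simp: F_def)
    next
      case False
      then have mf: "m f = - \<kappa> f" using mneg f by blast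
      then have m1: "rel \<kappa> m f = -1" using rel_simps(3)[OF f, of m] by blast
      have "rel \<kappa> v f \<le> rel \<kappa> m f" using vm f unfolding below_def by blast
      then have "rel \<kappa> v f = -1" using m1 rel_range[of \<kappa> v f] by auto
      then have "v f = - \<kappa> f" using rel_simps(3)[OF f, of v] by blast
      then show ?thesis using mf \<kappa>_nonzero[OF f] by simp
    qed
    have "m = v \<circ>\<^sub>s \<kappa>"
      by (rule ext_eq) (use mL vk comp_\<kappa>[of \<kappa> v] f0 in auto)
    then have vle: "v \<le> m" using sv_le_comp by metis
    have "v \<in> Q"
    proof -
      \<comment> \<open>An element of \<open>F\<close> that \<open>q0\<close> has not passed
        vanishes at a point between \<open>q0\<close> and \<open>v\<close>, so \<open>v\<close> lies
        in the convex set.\<close>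
      obtain f where f: "f \<in> F" "rel \<kappa> q0 f \<le> 0" using lower[OF q0] by blast
      have fE: "f \<in> E - X" using f by (simp add: F_def)
      obtain w where w: "w \<in> L" "\<forall>x\<in>X. w x = m x" "w f = 0" using point_exists[OF mL fE] by blast
      have "q0 \<sqsubseteq> w"
        using below_point[of q0 w f] w f(2) fE q0 Q(1) Q(2)[of q0 m] m by auto
      moreover have "w \<sqsubseteq> v"
        using point_below[of v w f] w f0 fE vF f(1) rel_sign_iff(2)[OF fE, of v] \<kappa>_nonzero[OF fE] by auto
      ultimately have "q0 \<sqsubseteq> v" by (rule below_trans)
      then show ?thesis using conv[of q0 m v] q0 m vm f0 Q(2)[of q0 m] by auto
    qed
    moreover have "v \<noteq> m" using f0 f0E \<kappa>_nonzero[OF f0E(1)] by auto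
    ultimately have vQ: "v \<in> Q - {m}" by blast
    have uniq: "q = v" if q: "q \<in> Q - {m}" "q \<le> m" for q
    proof -
      have qL: "q \<in> L" "\<forall>x\<in>X. q x = m x" using q Q(1) Q(2)[of q m] m by auto
      obtain g where g: "g \<in> F" "rel \<kappa> q g \<le> 0" using lower[OF q(1)] by blast
      have gE: "g \<in> E - X" "m g = \<kappa> g" using g by (auto simp: F_def)
      have "q g = 0"
        using q(2) g(2) gE \<kappa>_nonzero[OF gE(1)] unfolding sv_le_iff by (metis rel_def not_one_le_zero)
      show "q = v"
      proof (rule ccontr)
        assume "q \<noteq> v"
        \<comment> \<open>Another face \<open>q\<close> of \<open>m\<close> is a point that
          \<open>v\<close> has passed at \<open>g\<close>. Then \<open>q\<close> is still on the
          negative side at \<open>f0\<close>, although as a face of \<open>m\<close> it cannot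
          be.\<close>
        have "v g \<noteq> 0" using point_unique[of v q g] qL f0 gE \<open>q g = 0\<close> \<open>q \<noteq> v\<close> by auto
        then have "v g = \<kappa> g" using vF g(1) by blast
        have "q f0 = - \<kappa> f0"
        proof (rule ccontr)
          assume "q f0 \<noteq> - \<kappa> f0"
          then have "v f0 = \<kappa> f0"
            using cut[of \<kappa> v q g f0] qL f0 f0E gE \<open>q g = 0\<close> \<open>v g = \<kappa> g\<close> by auto
          then show False using f0 \<kappa>_nonzero[OF f0E(1)] by simp
        qed
        moreover have "q f0 = 0 \<or> q f0 = m f0" using q(2) by (simp add: sv_le_iff)
        ultimately show False using f0E \<kappa>_nonzero[OF f0E(1)] by auto
      qed
    qed
    have "{q \<in> Q - {m}. q \<le> m} = {v}" using uniq vle vQ by blast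
    then show ?thesis using vQ by blast
  qed
qed

text \<open>Induction on the size, removing the last element. Its single neighbour is the fibre over
  it: a point has it above and needs upper fibres, an interval has it below and needs lower
  fibres.\<close>

lemma convex_contractible:
  assumes "Q \<subseteq> L" "Q \<noteq> {}" "\<And>\<sigma> \<tau>. \<sigma> \<in> Q \<Longrightarrow> \<tau> \<in> Q \<Longrightarrow> \<forall>x\<in>X. \<sigma> x = \<tau> x"
    and "\<And>\<alpha> \<beta> \<gamma>. \<alpha> \<in> Q \<Longrightarrow> \<beta> \<in> Q \<Longrightarrow> \<gamma> \<in> L \<Longrightarrow> \<forall>x\<in>X. \<gamma> x = \<alpha> x \<Longrightarrow>
      \<alpha> \<sqsubseteq> \<gamma> \<Longrightarrow> \<gamma> \<sqsubseteq> \<beta> \<Longrightarrow> \<gamma> \<in> Q"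
  shows "contractible_poset Q (\<le>)"
  using assms
proof (induction "card Q" arbitrary: Q rule: less_induct)
  case less
  note Q = less.prems
  have fin: "finite Q" using finite_L Q(1) finite_subset by blast
  obtain m where m: "m \<in> Q" "\<And>q. q \<in> Q \<Longrightarrow> q \<sqsubseteq> m"
    using line_max[OF Q(1,2,3)] by blast
  show ?case
  proof (cases "Q - {m} = {}")
    case True
    then have "Q = {m}" using m by blast
    then show ?thesis by (intro contractible_poset_cone[of _ m]) auto
  next
    case False
    have conv': "\<gamma> \<in> Q - {m}" if "\<alpha> \<in> Q - {m}" "\<beta> \<in> Q - {m}" "\<gamma> \<in> L" "\<forall>x\<in>X. \<gamma> x = \<alpha> x" "\<alpha> \<sqsubseteq> \<gamma>" "\<gamma> \<sqsubseteq> \<beta>" for \<alpha> \<beta> \<gamma>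
    proof -
      have "\<gamma> \<in> Q" using Q(4)[of \<alpha> \<beta> \<gamma>] that by blast
      moreover have "\<gamma> \<noteq> m"
        using below_antisym[of \<beta> m] m that Q(1) Q(3)[of \<beta> m] by blast
      ultimately show ?thesis by blast
    qed
    have "card (Q - {m}) < card Q" using fin m(1) by (rule card_Diff1_less)
    then have c': "contractible_poset (Q - {m}) (\<le>)"
    proof (rule less.hyps)
      show "\<forall>x\<in>X. \<sigma> x = \<tau> x" if "\<sigma> \<in> Q - {m}" "\<tau> \<in> Q - {m}" for \<sigma> \<tau>
        using Q(3)[of \<sigma> \<tau>] that by blast
    qed (use Q(1) False conv' in blast)+
    have "\<exists>u\<in>Q - {m}. {q \<in> Q - {m}. m \<le> q} = {u} \<or> {q \<in> Q - {m}. q \<le> m} = {u}"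
      by (rule line_remove_last[OF Q(1) _ _ m(1) _ False]) (fact Q(3) Q(4) m(2))+
    then obtain u where u: "u \<in> Q - {m}"
      "{q \<in> Q - {m}. m \<le> q} = {u} \<or> {q \<in> Q - {m}. q \<le> m} = {u}" by blast
    have sing: "contractible_poset {u} (\<le>)" "contractible_poset {u} (\<lambda>x y. y \<le> x)"
      by (rule contractible_poset_cone[of _ u]; simp)+
    have refl: "contractible_poset {q \<in> Q - {m}. q \<le> p} (\<le>)" "contractible_poset {q \<in> Q - {m}. p \<le> q} (\<lambda>x y. y \<le> x)"
      if "p \<in> Q - {m}" for p
      by (rule contractible_poset_cone[of _ p]; use that fin in auto)+
    from u(2) have "poset_space (Q - {m}) (\<le>) homotopy_equivalent_space poset_space Q (\<le>)"
    proof
      assume up: "{q \<in> Q - {m}. m \<le> q} = {u}"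
      have "homotopy_equivalence_map (poset_space (Q - {m}) (\<lambda>x y. y \<le> x)) (poset_space Q (\<lambda>x y. y \<le> x)) id"
      proof (rule quillen_inclusion[OF fin])
        show "contractible_poset {q \<in> Q - {m}. p \<le> q} (\<lambda>x y. y \<le> x)" if "p \<in> Q" for p
          using refl(2)[of p] that up sing by (cases "p = m") auto
      qed (auto simp: poset_on_def)
      then show ?thesis
        unfolding poset_space_dual[of Q "(\<le>)"] poset_space_dual[of "Q - {m}" "(\<le>)"]
        by (rule homotopy_equivalence_map_imp_space)
    next
      assume dn: "{q \<in> Q - {m}. q \<le> m} = {u}"
      have "homotopy_equivalence_map (poset_space (Q - {m}) (\<le>)) (poset_space Q (\<le>)) id"
      proof (rule quillen_inclusion[OF fin])
        show "contractible_poset {q \<in> Q - {m}. q \<le> p} (\<le>)" if "p \<in> Q" for p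
          using refl(1)[of p] that dn sing by (cases "p = m") auto
      qed (auto simp: poset_on_def)
      then show ?thesis by (rule homotopy_equivalence_map_imp_space)
    qed
    then show ?thesis using contractible_poset_equiv[OF _ Q(2) c'] by blast
  qed
qed

text \<open>Relative signs are monotone along a line, so prescribing signs at some elements cuts out
  a convex part; \<open>\<alpha>\<close> witnesses that it is nonempty.\<close>

lemma line_contractible:
  assumes \<alpha>: "\<alpha> \<in> L" "\<And>x. x \<in> X \<Longrightarrow> \<alpha> x = d x" "\<And>e. e \<in> E - X \<Longrightarrow> C e \<Longrightarrow> \<alpha> e = c e"
  shows "contractible_poset {q \<in> L. (\<forall>x\<in>X. q x = d x) \<and> (\<forall>e\<in>E - X. C e \<longrightarrow> q e = c e)} (\<le>)"
    (is "contractible_poset ?Q _")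
proof (rule convex_contractible)
  fix \<beta> \<beta>' \<gamma>
  assume *: "\<beta> \<in> ?Q" "\<beta>' \<in> ?Q" "\<gamma> \<in> L" "\<forall>x\<in>X. \<gamma> x = \<beta> x" "\<beta> \<sqsubseteq> \<gamma>" "\<gamma> \<sqsubseteq> \<beta>'"
  have "\<gamma> e = c e" if e: "e \<in> E - X" "C e" for e
  proof -
    have "\<beta> e = c e" "\<beta>' e = c e" using * e by auto
    then have "rel \<kappa> \<beta> e = rel \<kappa> \<beta>' e" by (simp add: rel_def)
    moreover have "rel \<kappa> \<beta> e \<le> rel \<kappa> \<gamma> e" "rel \<kappa> \<gamma> e \<le> rel \<kappa> \<beta>' e"
      using *(5,6) e(1) unfolding below_def by blast+
    ultimately have "rel \<kappa> \<gamma> e = rel \<kappa> \<beta> e" by simp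
    then have "\<gamma> e = \<beta> e" by (rule rel_inject[of \<kappa> e, OF \<kappa>_nonzero[OF e(1)]])
    then show ?thesis using \<open>\<beta> e = c e\<close> by simp
  qed
  then show "\<gamma> \<in> ?Q" using * by auto
qed (use \<alpha> in auto)

text \<open>As far as \<open>Z\<close> can see, \<open>\<beta>\<close> is a position on a line, and
  the same position exists over \<open>\<alpha>\<close>. It is the point at a zero of
  \<open>\<beta>\<close> in \<open>Z - X\<close>, or the interval after the last element of
  \<open>Z\<close> crossed by \<open>\<beta>\<close>, or the initial interval if none is
  crossed.\<close>

lemma amalgamate:
  assumes Z: "Z \<in> flats E L" and \<alpha>: "\<alpha> \<in> L" and \<beta>: "\<beta> \<in> L" and eq: "\<And>x. x \<in> X \<inter> Z \<Longrightarrow> \<alpha> x = \<beta> x"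
  obtains \<gamma> where "\<gamma> \<in> L" "\<forall>x\<in>X. \<gamma> x = \<alpha> x" "\<forall>z\<in>Z. \<gamma> z = \<beta> z"
proof -
  have ZE: "Z \<subseteq> E" using Z by (auto simp: flats_def zero_set_def)
  have "\<exists>\<gamma>\<in>L. (\<forall>x\<in>X. \<gamma> x = \<alpha> x) \<and> (\<forall>f\<in>Z - X. \<gamma> f = \<beta> f)"
  proof (cases "\<exists>e\<in>Z - X. \<beta> e = 0")
    case True
    then obtain e where e: "e \<in> Z - X" "\<beta> e = 0" by blast
    then have "e \<in> E - X" using ZE by blast
    from point_exists[OF \<alpha> this] obtain v where v: "v \<in> L" "\<forall>x\<in>X. v x = \<alpha> x" "v e = 0" by blast
    have "v f = \<beta> f" if "f \<in> Z - X" for f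
      using modular[OF Z e(1) that v(1) \<beta> _ v(3) e(2)] v(2) eq by auto
    then show ?thesis using v by blast
  next
    case False
    define F where "F = {f \<in> Z - X. \<beta> f = \<kappa> f}"
    have neg: "\<beta> f = - \<kappa> f" if "f \<in> Z - X" "f \<notin> F" for f
    proof -
      have "f \<in> E - X" using that ZE by blast
      from sign_trichotomy[OF \<kappa>_nonzero[OF this], of "\<beta> f"] show ?thesis
        using that False by (auto simp: F_def)
    qed
    show ?thesis
    proof (cases "F = {}")
      case True
      then have "\<beta> f = (- \<kappa> \<circ>\<^sub>s \<alpha>) f" if "f \<in> Z - X" for f
        using neg[OF that] \<kappa>_nonzero[of f] that ZE by auto
      then show ?thesis using comp_\<kappa>[of "- \<kappa>" \<alpha>] \<alpha> by (intro bexI[of _ "- \<kappa> \<circ>\<^sub>s \<alpha>"]) auto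
    next
      case False
      have FE: "F \<subseteq> E - X" using ZE by (auto simp: F_def)
      obtain e v where e: "e \<in> F" "v e = 0" "v \<in> L" "\<forall>x\<in>X. v x = \<alpha> x"
        and vF: "\<forall>f\<in>F. v f = 0 \<or> v f = \<kappa> f"
        using highest_point[OF \<alpha> FE False] by blast
      have eZ: "e \<in> Z - X" "e \<in> E - X" "\<beta> e = \<kappa> e" using e ZE by (auto simp: F_def)
      \<comment> \<open>Moving \<open>\<beta>\<close> back to \<open>e\<close> gives a point that
        agrees with \<open>v\<close> on \<open>Z - X\<close> by modularity. It shows that
        \<open>v\<close> has not reached the elements that \<open>\<beta>\<close> has not
        reached.\<close>
      obtain \<beta>' where \<beta>': "\<beta>' \<in> L" "\<forall>x\<in>X. \<beta>' x = \<beta> x" "\<beta>' e = 0"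
        "\<forall>f\<in>E - X. \<beta> f \<noteq> \<kappa> f \<longrightarrow> \<beta>' f = - \<kappa> f"
        using eliminate[of \<kappa> \<beta> e] \<beta> eZ by blast
      have "(v \<circ>\<^sub>s \<kappa>) f = \<beta> f" if f: "f \<in> Z - X" for f
      proof (cases "f \<in> F")
        case True
        then show ?thesis using vF by (auto simp: F_def)
      next
        case False
        have fE: "f \<in> E - X" using f ZE by blast
        have bf: "\<beta> f = - \<kappa> f" using neg[OF f False] .
        have "v f = \<beta>' f"
          by (rule modular[OF Z eZ(1) f e(3) \<beta>'(1) _ e(2) \<beta>'(3)]) (use e \<beta>' eq in auto)
        also have "\<dots> = - \<kappa> f" using \<beta>'(4) fE bf \<kappa>_nonzero[OF fE] by auto
        finally show ?thesis using bf \<kappa>_nonzero[OF fE] by simp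
      qed
      then show ?thesis using comp_\<kappa>[of \<kappa> v] e by (intro bexI[of _ "v \<circ>\<^sub>s \<kappa>"]) auto
    qed
  qed
  then obtain \<gamma> where "\<gamma> \<in> L" "\<forall>x\<in>X. \<gamma> x = \<alpha> x" "\<forall>f\<in>Z - X. \<gamma> f = \<beta> f" by blast
  then show ?thesis using eq by (intro that[of \<gamma>]) auto
qed

section \<open>Fibres of the restriction map\<close>

abbreviation loc :: "'e sign_vector set" where "loc \<equiv> localization X L"

abbreviation fiber where
  "fiber s R \<equiv> poset_fiber (salvetti L) salvetti_le (salvetti_restrict X) (s, R)"

section \<open>Topes of the localization and membership in fibres\<close>

lemma restrict_loc: "\<sigma> \<in> L \<Longrightarrow> sv_restrict X \<sigma> \<in> loc"
  by (simp add: localization_def)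

lemma locE: "d \<in> loc \<Longrightarrow> (\<And>\<alpha>. \<alpha> \<in> L \<Longrightarrow> d = sv_restrict X \<alpha> \<Longrightarrow> thesis) \<Longrightarrow> thesis"
  by (auto simp: localization_def)

lemma finite_loc: "finite loc"
  using finite_L by (simp add: localization_def)

lemma tope_iff: "T \<in> topes L \<longleftrightarrow> T \<in> L \<and> (\<forall>e. T e = 0 \<longrightarrow> (\<forall>\<sigma>\<in>L. \<sigma> e = 0))"
  using comp_mem by (rule topes_iff)

lemma tope_loc_iff: "R \<in> topes loc \<longleftrightarrow> R \<in> loc \<and> (\<forall>e. R e = 0 \<longrightarrow> (\<forall>\<rho>\<in>loc. \<rho> e = 0))"
  by (rule topes_iff) (auto simp: localization_def sv_restrict_comp[symmetric] comp_mem)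

lemma tope_loc_zero: "R \<in> topes loc \<Longrightarrow> x \<in> X \<Longrightarrow> R x = 0 \<Longrightarrow> \<sigma> \<in> L \<Longrightarrow> \<sigma> x = 0"
  using restrict_loc[of \<sigma>] by (force simp: tope_loc_iff)

lemma tope_nonzero: "T \<in> topes L \<Longrightarrow> e \<in> E - X \<Longrightarrow> T e \<noteq> 0"
  using \<kappa>_nonzero \<kappa>(1) by (auto simp: tope_iff)

lemma topeI:
  assumes "R \<in> topes loc" "T \<in> L" "\<And>x. x \<in> X \<Longrightarrow> T x = 0 \<Longrightarrow> R x = 0" "\<And>e. e \<in> E - X \<Longrightarrow> T e \<noteq> 0"
  shows "T \<in> topes L"
  using assms outside tope_loc_zero[OF assms(1)] unfolding tope_iff by blast

lemma mem_fiber: "(\<sigma>, T) \<in> fiber s R \<longleftrightarrow> \<sigma> \<in> L \<and> T \<in> topes L \<and> \<sigma> \<le> T \<and>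
    s \<le> sv_restrict X \<sigma> \<and> sv_restrict X \<sigma> \<circ>\<^sub>s R = sv_restrict X T"
  by (auto simp: poset_fiber_def salvetti_def salvetti_restrict_def salvetti_le_iff)

lemma fiber_salvetti: "fiber s R \<subseteq> salvetti L"
  by (auto simp: poset_fiber_def)

lemma finite_salvetti: "finite (salvetti L)"
  by (rule finite_subset[of _ "L \<times> L"]) (use finite_L in \<open>auto simp: salvetti_def topes_def\<close>)

text \<open>Where the tope \<open>R\<close> vanishes on \<open>X\<close> every covector vanishes, so
  lying above \<open>R\<close> on \<open>X\<close> is the same as being equal to it.\<close>

lemma fiber_tope:
  assumes R: "R \<in> topes loc" and k: "(\<tau>, J) \<in> fiber R R"
  shows "\<tau> \<in> L" "J \<in> topes L" "J \<in> L" "\<tau> \<le> J" "\<And>x. x \<in> X \<Longrightarrow> \<tau> x = R x" "\<And>x. x \<in> X \<Longrightarrow> J x = R x"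
proof -
  show *: "\<tau> \<in> L" "J \<in> topes L" "J \<in> L" "\<tau> \<le> J" using k by (auto simp: mem_fiber tope_iff)
  show \<tau>: "\<tau> x = R x" if "x \<in> X" for x
    using k that tope_loc_zero[OF R that _ *(1)] by (force simp: mem_fiber sv_le_iff)
  show "J x = R x" if x: "x \<in> X" for x
  proof (cases "R x = 0")
    case True
    then show ?thesis using tope_loc_zero[OF R x _ *(3)] by simp
  next
    case False
    then show ?thesis using \<tau>[OF x] *(4) unfolding sv_le_iff by metis
  qed
qed

lemma fiber_topeI:
  assumes R: "R \<in> topes loc" and "\<tau> \<in> L" "J \<in> topes L" "\<tau> \<le> J" "\<And>x. x \<in> X \<Longrightarrow> \<tau> x = R x"
  shows "(\<tau>, J) \<in> fiber R R"
proof -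
  have Rout: "R x = 0" if "x \<notin> X" for x
    using R that by (auto simp: tope_loc_iff elim!: locE)
  have \<tau>: "sv_restrict X \<tau> = R" using assms(5) Rout by (auto simp: fun_eq_iff)
  have "J x = R x" if x: "x \<in> X" for x
  proof (cases "R x = 0")
    case True
    then show ?thesis using tope_loc_zero[OF R x] assms(3) by (auto simp: tope_iff)
  next
    case False
    then show ?thesis using assms(4,5) x unfolding sv_le_iff by metis
  qed
  then have "sv_restrict X J = R" using Rout by (auto simp: fun_eq_iff)
  moreover have "R \<circ>\<^sub>s R = R" by (auto simp: fun_eq_iff)
  ultimately show ?thesis using assms \<tau> by (simp add: mem_fiber)
qed

text \<open>Quillen's argument over the star \<open>D\<close> of \<open>s\<close>, a cone with apex
  \<open>s\<close>, relating a covector to everything above its restriction. The part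
  \<open>P d\<close> over \<open>d\<close> has the homotopy type of the line \<open>Q d\<close>
  exactly over \<open>d\<close>, because the elements of that line above a given \<open>p\<close>
  are again a convex part of it.\<close>

lemma half_space_contractible:
  assumes s: "s \<in> loc" and R: "R \<in> topes loc" and k: "(\<tau>, J) \<in> fiber R R"
  shows "contractible_poset {\<sigma> \<in> L. s \<le> sv_restrict X \<sigma> \<and> (\<forall>e\<in>E - X. \<tau> e = 0 \<longrightarrow> \<sigma> e = J e)} (\<le>)"
    (is "contractible_poset ?A _")
proof -
  note k = fiber_tope[OF R k]
  define D where "D = {d \<in> loc. s \<le> d}"
  define P where "P = (\<lambda>d. {a \<in> ?A. sv_restrict X a \<le> d})"
  define Q where "Q = (\<lambda>d. {q \<in> L. (\<forall>x\<in>X. q x = d x) \<and> (\<forall>e\<in>E - X. \<tau> e = 0 \<longrightarrow> q e = J e)})"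
  have finA: "finite ?A" using finite_L by simp
  have finD: "finite D" using finite_L by (simp add: D_def localization_def)
  have cP: "contractible_poset (P d) (\<le>)" if d: "d \<in> D" for d
  proof -
    obtain \<alpha> where \<alpha>: "\<alpha> \<in> L" "d = sv_restrict X \<alpha>" using d by (auto simp: D_def elim: locE)
    have sd: "s \<le> d" using d by (simp add: D_def)
    have "zero_set E \<tau> \<in> flats E L" using k by (simp add: flats_def)
    \<comment> \<open>On \<open>X\<close> a zero of \<open>\<tau>\<close> is a zero of the tope
      \<open>R\<close>, hence of all covectors.\<close>
    moreover have "\<alpha> x = J x" if "x \<in> X \<inter> zero_set E \<tau>" for x
      using that k(5)[of x] k(6)[of x] tope_loc_zero[OF R _ _ \<alpha>(1), of x] by (auto simp: zero_set_def)
    ultimately obtain \<gamma> where \<gamma>: "\<gamma> \<in> L" "\<forall>x\<in>X. \<gamma> x = \<alpha> x" "\<forall>z\<in>zero_set E \<tau>. \<gamma> z = J z"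
      using amalgamate[OF _ \<alpha>(1) k(3)] by metis
    have cQ: "contractible_poset (Q d) (\<le>)"
      unfolding Q_def by (rule line_contractible[of \<gamma>]) (use \<gamma> \<alpha> in \<open>auto simp: zero_set_def\<close>)
    have Qd: "sv_restrict X q = d" if "q \<in> Q d" for q
      using that \<alpha>(2) by (auto simp: Q_def fun_eq_iff)
    have sub: "Q d \<subseteq> P d"
    proof
      fix q assume q: "q \<in> Q d"
      then show "q \<in> P d" using Qd[OF q] sd by (auto simp: P_def Q_def)
    qed
    have finP: "finite (P d)" using finite_L by (simp add: P_def)
    have up: "contractible_poset {q \<in> Q d. p \<le> q} (\<le>)" if p: "p \<in> P d" for p
    proof -
      have pL: "p \<in> L" "sv_restrict X p \<le> d" and pJ: "\<And>e. e \<in> E - X \<Longrightarrow> \<tau> e = 0 \<Longrightarrow> p e = J e"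
        using p by (auto simp: P_def)
      have pX: "p x = 0 \<or> p x = d x" if "x \<in> X" for x
        using pL(2) that unfolding sv_le_iff by (metis sv_restrict_apply)
      \<comment> \<open>At the zeros of \<open>\<tau>\<close> outside \<open>X\<close> the covector
        \<open>p\<close> already has the signs of \<open>J\<close>, which are nonzero; being above
        \<open>p\<close> therefore includes the conditions from \<open>J\<close>.\<close>
      have "{q \<in> Q d. p \<le> q} = {q \<in> L. (\<forall>x\<in>X. q x = d x) \<and> (\<forall>e\<in>E - X. p e \<noteq> 0 \<longrightarrow> q e = p e)}"
        (is "?S = ?T")
      proof (intro equalityI subsetI)
        fix q assume "q \<in> ?S"
        then show "q \<in> ?T" unfolding Q_def sv_le_iff mem_Collect_eq by metis
      next
        fix q assume q: "q \<in> ?T"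
        have "p e = 0 \<or> p e = q e" for e
        proof (cases "e \<in> X")
          case True
          then show ?thesis using pX[OF True] q by auto
        next
          case False
          then show ?thesis using q outside[OF pL(1), of e] by (cases "e \<in> E") auto
        qed
        moreover have "q e = J e" if "e \<in> E - X" "\<tau> e = 0" for e
          using q pJ[OF that] tope_nonzero[OF k(2) that(1)] that(1) by auto
        ultimately show "q \<in> ?S" using q by (auto simp: Q_def sv_le_iff)
      qed
      moreover have "contractible_poset ?T (\<le>)"
      proof (rule line_contractible[of "p \<circ>\<^sub>s \<alpha>"])
        show "p \<circ>\<^sub>s \<alpha> \<in> L" using comp_mem pL \<alpha> by blast
        show "(p \<circ>\<^sub>s \<alpha>) x = d x" if "x \<in> X" for x using pX[OF that] \<alpha> that by auto
      qed auto
      ultimately show ?thesis by simp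
    qed
    have "homotopy_equivalence_map (poset_space (Q d) (\<lambda>x y. y \<le> x)) (poset_space (P d) (\<lambda>x y. y \<le> x)) id"
    proof (rule quillen_inclusion[OF finP _ sub])
      show "contractible_poset {q \<in> Q d. p \<le> q} (\<lambda>x y. y \<le> x)" if "p \<in> P d" for p
        by (rule iffD2[OF contractible_poset_dual up[OF that]])
    qed (auto simp: poset_on_def)
    then have "poset_space (Q d) (\<le>) homotopy_equivalent_space poset_space (P d) (\<le>)"
      unfolding poset_space_dual[of "P d" "(\<le>)"] poset_space_dual[of "Q d" "(\<le>)"]
      by (rule homotopy_equivalence_map_imp_space)
    moreover have "P d \<noteq> {}" using cQ sub by (auto simp: contractible_poset_def)
    ultimately show ?thesis using contractible_poset_equiv cQ by blast
  qed
  have sD: "s \<in> D" using s by (simp add: D_def)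
  interpret poset_relation ?A "(\<le>)" D "\<lambda>x y. y \<le> x" "\<lambda>a d. sv_restrict X a \<le> d"
  proof
    show "poset_on ?A (\<le>)" "poset_on D (\<lambda>x y. y \<le> x)" by (auto simp: poset_on_def)
    show "sv_restrict X p' \<le> d'" if "p' \<le> p" "d \<le> d'" "sv_restrict X p \<le> d" for p p' :: "'e sign_vector" and d d'
      using that sv_restrict_mono order_trans by metis
    show "contractible_poset {d \<in> D. sv_restrict X p \<le> d} (\<lambda>x y. y \<le> x)" if "p \<in> ?A" for p
      by (rule contractible_poset_cone[of _ "sv_restrict X p"])
         (use that finite_loc restrict_loc in \<open>auto simp: D_def\<close>)
    show "contractible_poset {p \<in> ?A. sv_restrict X p \<le> d} (\<le>)" if "d \<in> D" for d
      using cP[OF that] by (simp add: P_def)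
  qed (fact finA finD)+
  show ?thesis
  proof (rule fib_imp_contractible)
    show "contractible_poset D (\<lambda>x y. y \<le> x)"
      by (rule contractible_poset_cone[of _ s]) (use sD finite_loc in \<open>auto simp: D_def\<close>)
    show "?A \<noteq> {}" using cP[OF sD] by (auto simp: P_def contractible_poset_def)
  qed
qed

text \<open>The elements \<open>(\<tau>, J)\<close> of the fibre over \<open>(R, R)\<close> are the vertices and edges of a graph. With
  \<open>R\<close> read as imaginary part, the points missing from the fibre over \<open>(s, R)\<close> lie at distinct heights
  whose order does not change along the fibre. A vertex is a horizontal strip between two
  consecutive points, an edge passes one point on the side prescribed by \<open>J\<close>, and a cell is linked
  to the vertices and edges that it meets.\<close>

definition linked :: "'e sign_vector \<times> 'e sign_vector \<Rightarrow> 'e sign_vector \<times> 'e sign_vector \<Rightarrow> bool" where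
  "linked = (\<lambda>(\<sigma>, T) (\<tau>, J). \<sigma> \<circ>\<^sub>s \<tau> = T \<and> (\<forall>e\<in>E - X. \<tau> e = 0 \<longrightarrow> \<sigma> e = J e))"

lemma linked_iff: "linked (\<sigma>, T) (\<tau>, J) \<longleftrightarrow> \<sigma> \<circ>\<^sub>s \<tau> = T \<and> (\<forall>e\<in>E - X. \<tau> e = 0 \<longrightarrow> \<sigma> e = J e)"
  by (simp add: linked_def)

text \<open>When the topes arise from one common \<open>\<omega>\<close>, the Salvetti order is the
  reversed face order of the first components.\<close>

lemma contractible_poset_salvetti_iso:
  assumes "contractible_poset A (\<le>)" "finite A"
  shows "contractible_poset ((\<lambda>\<sigma>. (\<sigma>, \<sigma> \<circ>\<^sub>s \<omega>)) ` A) salvetti_le"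
proof (rule contractible_poset_iso[of A "\<lambda>x y. y \<le> x"])
  show "contractible_poset A (\<lambda>x y. y \<le> x)" by (rule iffD2[OF contractible_poset_dual assms(1)])
  show "bij_betw (\<lambda>\<sigma>. (\<sigma>, \<sigma> \<circ>\<^sub>s \<omega>)) A ((\<lambda>\<sigma>. (\<sigma>, \<sigma> \<circ>\<^sub>s \<omega>)) ` A)"
    by (auto simp: bij_betw_def inj_on_def)
qed (use assms salvetti_le_comp_iff in auto)

text \<open>A linked cell is determined by \<open>\<sigma>\<close>, its tope being
  \<open>\<sigma> \<circ>\<^sub>s \<tau>\<close>, so these cells form a half-space over the star of
  \<open>s\<close>. The second tope \<open>R'\<close> allows two uses: \<open>R' = R\<close> for the
  large fibre, and \<open>s = R' = t\<close> for the fibre over \<open>(t, t)\<close>.\<close>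

lemma linked_cells_contractible:
  assumes s: "s \<in> loc" and R: "R \<in> topes loc" and sR: "s \<circ>\<^sub>s R' = s \<circ>\<^sub>s R" and k: "k \<in> fiber R R"
  shows "contractible_poset {p \<in> fiber s R'. linked p k} salvetti_le"
proof -
  obtain \<tau> J where kk: "k = (\<tau>, J)" by (cases k)
  have kf: "(\<tau>, J) \<in> fiber R R" using k kk by simp
  note f = fiber_tope[OF R kf]
  define A where "A = {\<sigma> \<in> L. s \<le> sv_restrict X \<sigma> \<and> (\<forall>e\<in>E - X. \<tau> e = 0 \<longrightarrow> \<sigma> e = J e)}"
  have \<tau>R: "sv_restrict X \<tau> = R"
    using f(5) R by (auto simp: fun_eq_iff tope_loc_iff elim!: locE)
  have "{p \<in> fiber s R'. linked p k} = (\<lambda>\<sigma>. (\<sigma>, \<sigma> \<circ>\<^sub>s \<tau>)) ` A"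
  proof (intro equalityI subsetI)
    fix p assume "p \<in> {p \<in> fiber s R'. linked p k}"
    then show "p \<in> (\<lambda>\<sigma>. (\<sigma>, \<sigma> \<circ>\<^sub>s \<tau>)) ` A"
      by (cases p) (auto simp: kk linked_iff mem_fiber A_def)
  next
    fix p assume "p \<in> (\<lambda>\<sigma>. (\<sigma>, \<sigma> \<circ>\<^sub>s \<tau>)) ` A"
    then obtain \<sigma> where \<sigma>: "\<sigma> \<in> A" "p = (\<sigma>, \<sigma> \<circ>\<^sub>s \<tau>)" by blast
    then have \<sigma>L: "\<sigma> \<in> L" "s \<le> sv_restrict X \<sigma>" and \<sigma>J: "\<And>e. e \<in> E - X \<Longrightarrow> \<tau> e = 0 \<Longrightarrow> \<sigma> e = J e"
      by (auto simp: A_def)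
    have "\<sigma> \<circ>\<^sub>s \<tau> \<in> topes L"
    proof (rule topeI[OF R])
      show "\<sigma> \<circ>\<^sub>s \<tau> \<in> L" using comp_mem \<sigma>L f by blast
      show "R x = 0" if "x \<in> X" "(\<sigma> \<circ>\<^sub>s \<tau>) x = 0" for x
        using that f(5)[of x] by (auto split: if_splits)
      show "(\<sigma> \<circ>\<^sub>s \<tau>) e \<noteq> 0" if "e \<in> E - X" for e
        using \<sigma>J[OF that] tope_nonzero[OF f(2) that] by auto
    qed
    moreover have "sv_restrict X \<sigma> \<circ>\<^sub>s R' = sv_restrict X (\<sigma> \<circ>\<^sub>s \<tau>)"
    proof -
      have "sv_restrict X \<sigma> \<circ>\<^sub>s R' = sv_restrict X \<sigma> \<circ>\<^sub>s (s \<circ>\<^sub>s R')"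
        using sv_comp_absorb[OF \<sigma>L(2)] by simp
      also have "\<dots> = sv_restrict X \<sigma> \<circ>\<^sub>s R" unfolding sR using sv_comp_absorb[OF \<sigma>L(2)] by simp
      finally show ?thesis by (simp add: sv_restrict_comp \<tau>R)
    qed
    ultimately show "p \<in> {p \<in> fiber s R'. linked p k}"
      using \<sigma> \<sigma>L \<sigma>J by (auto simp: kk linked_iff mem_fiber sv_le_comp)
  qed
  moreover have "contractible_poset A (\<le>)"
    unfolding A_def by (rule half_space_contractible[OF s R kf])
  moreover have "finite A" using finite_L by (simp add: A_def)
  ultimately show ?thesis using contractible_poset_salvetti_iso by simp
qed

text \<open>Symmetrically \<open>J\<close> must be \<open>\<tau> \<circ>\<^sub>s \<sigma>\<close>,
  so \<open>\<tau>\<close> runs through the part of the line over \<open>R\<close> with the signs of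
  \<open>T\<close> at the zeros of \<open>\<sigma>\<close>. Amalgamation of \<open>R\<close> with
  \<open>T\<close> shows that it is nonempty.\<close>

lemma linked_edges_contractible:
  assumes R: "R \<in> topes loc" and p: "p \<in> fiber s R"
  shows "contractible_poset {k \<in> fiber R R. linked p k} salvetti_le"
proof -
  obtain \<sigma> T where pp: "p = (\<sigma>, T)" by (cases p)
  have f: "\<sigma> \<in> L" "T \<in> topes L" "\<sigma> \<le> T" "sv_restrict X \<sigma> \<circ>\<^sub>s R = sv_restrict X T"
    using p pp by (auto simp: mem_fiber)
  have TL: "T \<in> L" using f by (simp add: tope_iff)
  define A where "A = {\<tau> \<in> L. (\<forall>x\<in>X. \<tau> x = R x) \<and> (\<forall>e\<in>E - X. \<sigma> e = 0 \<longrightarrow> \<tau> e = T e)}"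
  have TX: "T x = R x" if "x \<in> X" "\<sigma> x = 0" for x
    using fun_cong[OF f(4), of x] that by simp
  have "{k \<in> fiber R R. linked p k} = (\<lambda>\<tau>. (\<tau>, \<tau> \<circ>\<^sub>s \<sigma>)) ` A"
  proof (intro equalityI subsetI)
    fix k assume k: "k \<in> {k \<in> fiber R R. linked p k}"
    obtain \<tau> J where kk: "k = (\<tau>, J)" by (cases k)
    have kf: "(\<tau>, J) \<in> fiber R R" and l: "\<sigma> \<circ>\<^sub>s \<tau> = T" "\<And>e. e \<in> E - X \<Longrightarrow> \<tau> e = 0 \<Longrightarrow> \<sigma> e = J e"
      using k by (auto simp: kk pp linked_iff)
    note g = fiber_tope[OF R kf]
    have "\<tau> e = T e" if "\<sigma> e = 0" for e using l(1) that by auto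
    then have "\<tau> \<in> A" using g by (auto simp: A_def)
    moreover have "J = \<tau> \<circ>\<^sub>s \<sigma>"
    proof (rule ext_eq)
      show "\<forall>x\<in>X. J x = (\<tau> \<circ>\<^sub>s \<sigma>) x"
        using g(5,6) tope_loc_zero[OF R _ _ f(1)] by auto
      show "J e = (\<tau> \<circ>\<^sub>s \<sigma>) e" if "e \<in> E - X" for e
        using l(2)[OF that] g(4) by (auto simp: sv_le_iff)
    qed (use g f comp_mem in auto)
    ultimately show "k \<in> (\<lambda>\<tau>. (\<tau>, \<tau> \<circ>\<^sub>s \<sigma>)) ` A" using kk by blast
  next
    fix k assume "k \<in> (\<lambda>\<tau>. (\<tau>, \<tau> \<circ>\<^sub>s \<sigma>)) ` A"
    then obtain \<tau> where k: "k = (\<tau>, \<tau> \<circ>\<^sub>s \<sigma>)" and \<tau>: "\<tau> \<in> L" "\<And>x. x \<in> X \<Longrightarrow> \<tau> x = R x"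
      "\<And>e. e \<in> E - X \<Longrightarrow> \<sigma> e = 0 \<Longrightarrow> \<tau> e = T e"
      by (auto simp: A_def)
    have "\<tau> \<circ>\<^sub>s \<sigma> \<in> topes L"
    proof (rule topeI[OF R])
      show "\<tau> \<circ>\<^sub>s \<sigma> \<in> L" using comp_mem \<tau> f by blast
      show "R x = 0" if "x \<in> X" "(\<tau> \<circ>\<^sub>s \<sigma>) x = 0" for x
        using that \<tau>(2)[of x] by (auto split: if_splits)
      show "(\<tau> \<circ>\<^sub>s \<sigma>) e \<noteq> 0" if "e \<in> E - X" for e
        using \<tau>(3)[OF that] tope_nonzero[OF f(2) that] by auto
    qed
    then have "k \<in> fiber R R" unfolding k by (intro fiber_topeI R \<tau> sv_le_comp)
    moreover have "\<sigma> \<circ>\<^sub>s \<tau> = T"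
    proof (rule ext_eq)
      show "\<forall>x\<in>X. (\<sigma> \<circ>\<^sub>s \<tau>) x = T x"
        using \<tau>(2) TX f(3) by (auto simp: sv_le_iff)
      show "(\<sigma> \<circ>\<^sub>s \<tau>) e = T e" if "e \<in> E - X" for e
        using \<tau>(3)[OF that] f(3) by (auto simp: sv_le_iff)
    qed (use f TL \<tau> comp_mem in auto)
    ultimately show "k \<in> {k \<in> fiber R R. linked p k}" by (auto simp: k pp linked_iff)
  qed
  moreover have "contractible_poset A (\<le>)"
  proof -
    obtain \<alpha> where \<alpha>: "\<alpha> \<in> L" "R = sv_restrict X \<alpha>" using R by (auto simp: tope_loc_iff elim: locE)
    have "zero_set E \<sigma> \<in> flats E L" using f by (simp add: flats_def)
    moreover have "\<alpha> x = T x" if "x \<in> X \<inter> zero_set E \<sigma>" for x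
      using that TX[of x] \<alpha> by (auto simp: zero_set_def)
    ultimately obtain \<gamma> where \<gamma>: "\<gamma> \<in> L" "\<forall>x\<in>X. \<gamma> x = \<alpha> x" "\<forall>z\<in>zero_set E \<sigma>. \<gamma> z = T z"
      using amalgamate[OF _ \<alpha>(1) TL] by metis
    show ?thesis
      unfolding A_def by (rule line_contractible[of \<gamma>]) (use \<gamma> \<alpha> in \<open>auto simp: zero_set_def\<close>)
  qed
  moreover have "finite A" using finite_L by (simp add: A_def)
  ultimately show ?thesis using contractible_poset_salvetti_iso by simp
qed

text \<open>Going down in the Salvetti order enlarges \<open>\<sigma>\<close> and
  \<open>\<tau>\<close>: fewer zeros of \<open>\<tau>\<close> impose conditions, and the signs
  already matched with \<open>J\<close> are nonzero and persist.\<close>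

lemma linked_closed:
  assumes J: "snd k \<in> topes L" "fst k' \<in> L" "snd p \<in> topes L"
    and le: "salvetti_le p' p" "salvetti_le k' k" and l: "linked p k"
  shows "linked p' k'"
proof -
  obtain \<sigma> T \<sigma>' T' \<tau> J \<tau>' J' where eq: "p = (\<sigma>, T)" "p' = (\<sigma>', T')" "k = (\<tau>, J)" "k' = (\<tau>', J')"
    by (metis surj_pair)
  have \<sigma>: "\<sigma> \<le> \<sigma>'" "\<sigma>' \<circ>\<^sub>s T = T'" and \<tau>: "\<tau> \<le> \<tau>'" "\<tau>' \<circ>\<^sub>s J = J'"
    and l: "\<sigma> \<circ>\<^sub>s \<tau> = T" "\<And>e. e \<in> E - X \<Longrightarrow> \<tau> e = 0 \<Longrightarrow> \<sigma> e = J e"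
    using le l by (auto simp: eq salvetti_le_iff linked_iff)
  have "\<sigma>' e = J' e" if e: "e \<in> E - X" "\<tau>' e = 0" for e
  proof -
    have "\<tau> e = 0" using \<tau>(1) e unfolding sv_le_iff by metis
    then have "\<sigma> e = J e" using l e by blast
    moreover have "J e \<noteq> 0" using tope_nonzero[OF _ e(1)] J eq by simp
    ultimately have "\<sigma>' e = J e" using \<sigma>(1) unfolding sv_le_iff by metis
    then show ?thesis using \<tau>(2) e(2) by auto
  qed
  moreover have "\<sigma>' \<circ>\<^sub>s \<tau>' = T'"
  proof
    fix e
    show "(\<sigma>' \<circ>\<^sub>s \<tau>') e = T' e"
    proof (cases "\<sigma>' e = 0")
      case False
      then show ?thesis using \<sigma>(2) by auto
    next
      case True
      then have "\<sigma> e = 0" using \<sigma>(1) unfolding sv_le_iff by metis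
      then have T': "T' e = \<tau> e" using True \<sigma>(2) l(1) by auto
      show ?thesis
      proof (cases "\<tau> e = 0")
        case False
        then have "\<tau>' e = \<tau> e" using \<tau>(1) unfolding sv_le_iff by metis
        then show ?thesis using True T' by simp
      next
        case True': True
        \<comment> \<open>A zero of the tope \<open>T\<close> is a loop, where
          \<open>\<tau>'\<close> vanishes as well.\<close>
        have "T e = 0" using \<open>\<sigma> e = 0\<close> True' l(1) by auto
        moreover have "T \<in> topes L" "\<tau>' \<in> L" using J eq by simp_all
        ultimately have "\<tau>' e = 0" unfolding tope_iff by blast
        then show ?thesis using True T' True' by simp
      qed
    qed
  qed
  ultimately show ?thesis by (simp add: eq linked_iff)
qed

lemma tope_loc_comp: "t \<in> topes loc \<Longrightarrow> R \<in> loc \<Longrightarrow> t \<circ>\<^sub>s R = t"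
  by (auto simp: fun_eq_iff tope_loc_iff)

text \<open>The relation to the fibre over \<open>(R, R)\<close> restricts well to the fibre over
  \<open>(t, t)\<close>, since \<open>t \<circ>\<^sub>s R = t\<close> makes the latter an instance
  of \<open>linked_cells_contractible\<close> with the same \<open>k\<close>.\<close>

lemma tope_fiber_inclusion:
  assumes s: "s \<in> loc" and R: "R \<in> topes loc" and t: "t \<in> topes loc" "s \<le> t"
  shows "homotopy_equivalence_map (poset_space (fiber t t) salvetti_le) (poset_space (fiber s R) salvetti_le) id"
proof -
  have tl: "t \<in> loc" "R \<in> loc" using t R by (auto simp: tope_loc_iff)
  interpret poset_relation "fiber s R" salvetti_le "fiber R R" salvetti_le linked
  proof
    show "finite (fiber s R)" "finite (fiber R R)"
      using finite_subset[OF fiber_salvetti finite_salvetti] by auto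
    show "poset_on (fiber s R) salvetti_le" "poset_on (fiber R R) salvetti_le"
      using poset_on_subset[OF poset_on_salvetti_le fiber_salvetti] by auto
    show "contractible_poset {k \<in> fiber R R. linked p k} salvetti_le" if "p \<in> fiber s R" for p
      using linked_edges_contractible[OF R that] .
    show "contractible_poset {p \<in> fiber s R. linked p k} salvetti_le" if "k \<in> fiber R R" for k
      using linked_cells_contractible[OF s R refl that] .
    show "linked p' k'"
      if "p \<in> fiber s R" "p' \<in> fiber s R" "k \<in> fiber R R" "k' \<in> fiber R R"
        "salvetti_le p' p" "salvetti_le k' k" "linked p k" for p p' k k'
    proof (rule linked_closed[OF _ _ _ that(5-7)])
      show "snd k \<in> topes L" "fst k' \<in> L" "snd p \<in> topes L"
        using that(1,3,4) by (cases k; cases k'; cases p; simp add: mem_fiber)+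
    qed
  qed
  show ?thesis
  proof (rule subposet_homotopy_equivalence)
    show "fiber t t \<subseteq> fiber s R"
    proof
      fix p assume p: "p \<in> fiber t t"
      obtain \<sigma> T where pp: "p = (\<sigma>, T)" by (cases p)
      have pf: "(\<sigma>, T) \<in> fiber t t" using p pp by simp
      note f = fiber_tope[OF t(1) pf]
      have tout: "t x = 0" if "x \<notin> X" for x using tl(1) that by (auto elim: locE)
      have "sv_restrict X \<sigma> = t" "sv_restrict X T = t"
        using f(5,6) tout by (auto simp: fun_eq_iff)
      then show "p \<in> fiber s R"
        using f t(2) tope_loc_comp[OF t(1) tl(2)] by (simp add: pp mem_fiber)
    qed
    show "contractible_poset {p \<in> fiber t t. linked p k} salvetti_le" if "k \<in> fiber R R" for k
      using tope_loc_comp[OF t(1)] tl by (intro linked_cells_contractible[OF tl(1) R _ that]) simp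
  qed
qed

lemma tope_restrict: "T \<in> topes L \<Longrightarrow> sv_restrict X T \<in> topes loc"
  unfolding tope_loc_iff tope_iff by (auto simp: localization_def)

lemma salvetti_restrict_mem: "p \<in> salvetti L \<Longrightarrow> salvetti_restrict X p \<in> salvetti loc"
  by (auto simp: salvetti_def salvetti_restrict_def restrict_loc tope_restrict sv_restrict_mono)

lemma salvetti_restrict_mono: "salvetti_le p q \<Longrightarrow> salvetti_le (salvetti_restrict X p) (salvetti_restrict X q)"
  by (cases p; cases q)
     (auto simp: salvetti_restrict_def salvetti_le_iff sv_restrict_mono sv_restrict_comp[symmetric])

theorem restrict_quasi_fibration:
  "poset_quasi_fibration (salvetti L) salvetti_le (salvetti loc) salvetti_le (salvetti_restrict X)"
  unfolding poset_quasi_fibration_def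
proof (intro conjI ballI impI)
  show "salvetti_restrict X \<in> salvetti L \<rightarrow> salvetti loc" using salvetti_restrict_mem by blast
  show "monotone_on (salvetti L) salvetti_le salvetti_le (salvetti_restrict X)"
    using salvetti_restrict_mono by (auto simp: monotone_on_def)
  fix a b assume a: "a \<in> salvetti loc" and b: "b \<in> salvetti loc" and ab: "salvetti_le a b"
  obtain s R s' R' where eq: "a = (s, R)" "b = (s', R')" by (cases a; cases b)
  have m: "s \<in> loc" "R \<in> topes loc" "s \<le> R" "s' \<in> loc" "R' \<in> topes loc" "s' \<le> s"
    using a b ab by (auto simp: eq salvetti_def salvetti_le_iff)
  have "homotopy_equivalence_map (poset_space (fiber R R) salvetti_le) (poset_space (fiber s R) salvetti_le) id"
    by (rule tope_fiber_inclusion) (use m in auto)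
  \<comment> \<open>Now \<open>R\<close> is a tope above \<open>s'\<close> that may differ from
    \<open>R'\<close>: the case that requires comparison through a third poset.\<close>
  moreover have "homotopy_equivalence_map (poset_space (fiber R R) salvetti_le)
      (poset_space (fiber s' R') salvetti_le) (id \<circ> id)"
    unfolding comp_id by (rule tope_fiber_inclusion) (use m in auto)
  moreover have "fiber s R \<subseteq> fiber s' R'"
  proof
    fix p assume p: "p \<in> fiber s R"
    then have "p \<in> salvetti L" "salvetti_le (salvetti_restrict X p) a" by (auto simp: poset_fiber_def eq)
    then have "salvetti_le (salvetti_restrict X p) b"
      using poset_on_salvetti_le[of loc] salvetti_restrict_mem[of p] a b ab unfolding poset_on_def by blast
    then show "p \<in> fiber s' R'" using \<open>p \<in> salvetti L\<close> by (simp add: poset_fiber_def eq)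
  qed
  then have "continuous_map (poset_space (fiber s R) salvetti_le) (poset_space (fiber s' R') salvetti_le) id"
    by (rule continuous_map_poset_inclusion)
  ultimately show "homotopy_equivalence_map
      (poset_space (poset_fiber (salvetti L) salvetti_le (salvetti_restrict X) a) salvetti_le)
      (poset_space (poset_fiber (salvetti L) salvetti_le (salvetti_restrict X) b) salvetti_le) id"
    unfolding eq by (rule homotopy_equivalence_map_cancel_right)
qed

text \<open>The fibre over a tope is a line; recording the heights of its points as slopes realizes it
  as the affine part of an arrangement of lines in the plane.\<close>

lemma line_heights:
  assumes \<alpha>: "\<alpha> \<in> L"
  obtains r :: "'e \<Rightarrow> nat" where
    "\<And>\<sigma>. \<sigma> \<in> L \<Longrightarrow> \<forall>x\<in>X. \<sigma> x = \<alpha> x \<Longrightarrow> \<exists>t::real. \<forall>e\<in>E - X. rel \<kappa> \<sigma> e = sgn (t - r e)"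
    "\<And>t::real. \<exists>\<sigma>\<in>L. (\<forall>x\<in>X. \<sigma> x = \<alpha> x) \<and> (\<forall>e\<in>E - X. rel \<kappa> \<sigma> e = sgn (t - r e))"
proof -
  have "\<forall>e\<in>E - X. \<exists>v. v \<in> L \<and> (\<forall>x\<in>X. v x = \<alpha> x) \<and> v e = 0"
    using point_exists[OF \<alpha>] by blast
  from bchoice[OF this] obtain v
    where v: "\<And>e. e \<in> E - X \<Longrightarrow> v e \<in> L" "\<And>e x. e \<in> E - X \<Longrightarrow> x \<in> X \<Longrightarrow> v e x = \<alpha> x"
      "\<And>e. e \<in> E - X \<Longrightarrow> v e e = 0" by blast
  \<comment> \<open>The height of \<open>e\<close> counts the elements whose point is not beyond the
    point of \<open>e\<close>. Equal points get equal heights, and all heights are at least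
    1.\<close>
  define r where "r = (\<lambda>e. card {f \<in> E - X. v f \<sqsubseteq> v e})"
  have tot: "v e \<sqsubseteq> v g \<or> v g \<sqsubseteq> v e" if "e \<in> E - X" "g \<in> E - X" for e g
    using below_total[of "v e" "v g"] v that by auto
  have fin: "finite {f \<in> E - X. v f \<sqsubseteq> v e}" for e using finite_ground by simp
  have mono: "r e \<le> r g" if "v e \<sqsubseteq> v g" for e g
    unfolding r_def using fin below_trans that by (intro card_mono) auto
  have strict: "r e < r g" if e: "e \<in> E - X" and g: "g \<in> E - X" and lt: "\<not> v g \<sqsubseteq> v e" for e g
  proof -
    have "v e \<sqsubseteq> v g" using tot[OF e g] lt by blast
    then have "{f \<in> E - X. v f \<sqsubseteq> v e} \<subset> {f \<in> E - X. v f \<sqsubseteq> v g}"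
      using below_trans g lt below_refl[of "v g"] by blast
    then show ?thesis unfolding r_def using fin psubset_card_mono by blast
  qed
  have r_iff: "v e \<sqsubseteq> v g \<longleftrightarrow> r e \<le> r g" if "e \<in> E - X" "g \<in> E - X" for e g
    using mono[of e g] strict[OF that(2,1)] by (meson not_less)
  have pt: "rel \<kappa> (v g) e = sgn (real (r g) - real (r e))" if g: "g \<in> E - X" and e: "e \<in> E - X" for g e
  proof (cases "v g e = 0")
    case True
    then have "v g = v e" using point_unique[of "v g" "v e" e] v g e by auto
    then have "r g = r e" by (simp add: r_def)
    then show ?thesis using True by (simp add: rel_def)
  next
    case False
    have ne: "\<not> (v g \<sqsubseteq> v e \<and> v e \<sqsubseteq> v g)"
      using below_antisym[of "v g" "v e"] v g e False by auto
    show ?thesis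
    proof (cases "v g e = \<kappa> e")
      case True
      then have "rel \<kappa> (v g) e = 1" using False by (simp add: rel_def)
      moreover from this have "v e \<sqsubseteq> v g" using point_below[of "v g" "v e" e] v g e by auto
      then have "r e < r g" using ne strict[OF e g] by blast
      ultimately show ?thesis by simp
    next
      case neg: False
      then have "rel \<kappa> (v g) e = -1" using False by (simp add: rel_def)
      moreover from this have "v g \<sqsubseteq> v e" using below_point[of "v g" "v e" e] v g e by auto
      then have "r g < r e" using ne strict[OF g e] by blast
      ultimately show ?thesis by simp
    qed
  qed
  have r1: "r e \<ge> 1" if "e \<in> E - X" for e
  proof -
    have "{f \<in> E - X. v f \<sqsubseteq> v e} \<noteq> {}" using that by auto
    then show ?thesis unfolding r_def using fin[of e] by (simp add: Suc_le_eq card_gt_0_iff)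
  qed
  have highest: "\<exists>g\<in>P. \<forall>e\<in>P. r e \<le> r g" if "P \<subseteq> E - X" "P \<noteq> {}" for P
  proof -
    have fin: "finite (r ` P)" using that(1) finite_ground finite_subset by blast
    have "Max (r ` P) \<in> r ` P" using fin that(2) by (intro Max_in) auto
    then show ?thesis using Max_ge[OF fin] by fastforce
  qed
  show ?thesis
  proof (rule that[of r])
    fix \<sigma> assume \<sigma>: "\<sigma> \<in> L" "\<forall>x\<in>X. \<sigma> x = \<alpha> x"
    show "\<exists>t::real. \<forall>e\<in>E - X. rel \<kappa> \<sigma> e = sgn (t - r e)"
    proof (cases "\<exists>g\<in>E - X. \<sigma> g = 0")
      case True
      then obtain g where g: "g \<in> E - X" "\<sigma> g = 0" by blast
      then have "\<sigma> = v g" using point_unique[of \<sigma> "v g" g] v \<sigma> by auto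
      then show ?thesis using pt[OF g(1)] by blast
    next
      case False
      define P where "P = {e \<in> E - X. \<sigma> e = \<kappa> e}"
      have neg: "\<sigma> e = - \<kappa> e" if "e \<in> E - X" "e \<notin> P" for e
        using that False sign_trichotomy[OF \<kappa>_nonzero[OF that(1)], of "\<sigma> e"] by (auto simp: P_def)
      have relP: "rel \<kappa> \<sigma> e = 1" if "e \<in> P" for e using that rel_simps(1)[of e \<sigma>] by (auto simp: P_def)
      have relN: "rel \<kappa> \<sigma> e = -1" if "e \<in> E - X" "e \<notin> P" for e
        using neg[OF that] rel_simps(3)[OF that(1)] by blast
      show ?thesis
      proof (cases "P = {}")
        case True
        \<comment> \<open>Height 0 is before all points, so it represents the initial
          interval.\<close>
        then have "\<forall>e\<in>E - X. rel \<kappa> \<sigma> e = sgn (0 - real (r e))" using relN r1 by force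
        then show ?thesis by blast
      next
        case False
        obtain g where g: "g \<in> P" "\<And>e. e \<in> P \<Longrightarrow> r e \<le> r g"
          using highest[of P] False by (auto simp: P_def)
        have gE: "g \<in> E - X" using g by (simp add: P_def)
        \<comment> \<open>Heights are integers, so half a unit above the last crossed point is still
          below the next one.\<close>
        have "rel \<kappa> \<sigma> e = sgn (real (r g) + 1/2 - real (r e))" if e: "e \<in> E - X" for e
        proof (cases "e \<in> P")
          case True
          then show ?thesis using g(2)[OF True] relP by simp
        next
          case False
          have "v g \<sqsubseteq> \<sigma>" using point_below[of \<sigma> "v g" g] v \<sigma> gE relP[OF g(1)] by auto
          moreover have "\<sigma> \<sqsubseteq> v e" using below_point[of \<sigma> "v e" e] v \<sigma> e relN[OF e False] by auto
          moreover have "\<not> v e \<sqsubseteq> v g"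
          proof
            assume "v e \<sqsubseteq> v g"
            then have "v e \<sqsubseteq> \<sigma>" using \<open>v g \<sqsubseteq> \<sigma>\<close> below_trans by blast
            then have "\<sigma> = v e" using below_antisym[of \<sigma> "v e"] \<open>\<sigma> \<sqsubseteq> v e\<close> v \<sigma> e by auto
            then show False using v(3)[OF e] relN[OF e False] by (simp add: rel_def)
          qed
          ultimately have "r g < r e" using strict[OF gE e] by blast
          then show ?thesis using relN[OF e False] by simp
        qed
        then show ?thesis by blast
      qed
    qed
  next
    fix t :: real
    show "\<exists>\<sigma>\<in>L. (\<forall>x\<in>X. \<sigma> x = \<alpha> x) \<and> (\<forall>e\<in>E - X. rel \<kappa> \<sigma> e = sgn (t - r e))"
    proof (cases "\<exists>g\<in>E - X. t = r g")
      case True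
      then obtain g where "g \<in> E - X" "t = r g" by blast
      then show ?thesis using pt v by blast
    next
      case neq: False
      \<comment> \<open>A \<open>t\<close> that is no height belongs to the open interval following
        the last point below \<open>t\<close>, or to the initial interval if there is none.\<close>
      define P where "P = {e \<in> E - X. real (r e) < t}"
      show ?thesis
      proof (cases "P = {}")
        case True
        have "rel \<kappa> (- \<kappa> \<circ>\<^sub>s \<alpha>) e = sgn (t - r e)" if e: "e \<in> E - X" for e
        proof -
          have "t < r e" using True neq e by (force simp: P_def)
          moreover have "(- \<kappa> \<circ>\<^sub>s \<alpha>) e = - \<kappa> e" using \<kappa>_nonzero[OF e] by simp
          then have "rel \<kappa> (- \<kappa> \<circ>\<^sub>s \<alpha>) e = -1" using rel_simps(3)[OF e] by blast
          ultimately show ?thesis by simp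
        qed
        then show ?thesis using comp_\<kappa>[of "- \<kappa>" \<alpha>] \<alpha> by blast
      next
        case False
        obtain g where g: "g \<in> P" "\<And>e. e \<in> P \<Longrightarrow> r e \<le> r g"
          using highest[of P] False by (auto simp: P_def)
        have gE: "g \<in> E - X" "r g < t" using g by (auto simp: P_def)
        have "rel \<kappa> (v g \<circ>\<^sub>s \<kappa>) e = sgn (t - r e)" if e: "e \<in> E - X" for e
        proof (cases "e \<in> P")
          case True
          then have "r e \<le> r g" "r e < t" using g by (auto simp: P_def)
          then have "v e \<sqsubseteq> v g" using r_iff[OF e gE(1)] by simp
          then have "rel \<kappa> (v e) e \<le> rel \<kappa> (v g) e" using e by (simp add: below_def)
          then have "v g e \<noteq> - \<kappa> e" using v(3)[OF e] rel_sign_iff(2)[OF e, of "v g"] by (simp add: rel_def)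
          then have "(v g \<circ>\<^sub>s \<kappa>) e = \<kappa> e"
            using sign_trichotomy[OF \<kappa>_nonzero[OF e], of "v g e"] by auto
          then have "rel \<kappa> (v g \<circ>\<^sub>s \<kappa>) e = 1" using rel_simps(1)[OF e] by blast
          then show ?thesis using \<open>r e < t\<close> by simp
        next
          case False
          then have te: "t < r e" using neq e by (force simp: P_def)
          then have "rel \<kappa> (v g) e = -1" using pt[OF gE(1) e] gE(2) by (simp add: sgn_if)
          then have "v g e = - \<kappa> e" using rel_simps(3)[OF e] by blast
          then have "(v g \<circ>\<^sub>s \<kappa>) e = - \<kappa> e" using \<kappa>_nonzero[OF e] by simp
          then have "rel \<kappa> (v g \<circ>\<^sub>s \<kappa>) e = -1" using rel_simps(3)[OF e] by blast
          then show ?thesis using te by simp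
        qed
        moreover have "v g \<circ>\<^sub>s \<kappa> \<in> L" "\<forall>x\<in>X. (v g \<circ>\<^sub>s \<kappa>) x = \<alpha> x"
          using comp_\<kappa>[of \<kappa> "v g"] v gE by auto
        ultimately show ?thesis by blast
      qed
    qed
  qed
qed

text \<open>Index 0 carries the form \<open>x\<close>, and each \<open>e\<close> outside
  \<open>X\<close> the form \<open>y - r e * x\<close> up to sign. In the half-plane
  \<open>x > 0\<close> the signs depend only on the height \<open>y / x\<close>, so this half-plane
  reproduces the line over \<open>R\<close>.\<close>

theorem tope_fiber_affine:
  assumes R: "R \<in> topes loc"
  shows "\<exists>(I :: nat set) L' g. oriented_matroid I L' \<and> om_rank L' = 2 \<and> g \<in> I \<and>
    poset_space (fiber R R) salvetti_le homotopy_equivalent_space poset_space (affine_salvetti g L') salvetti_le"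
proof -
  obtain \<alpha> where \<alpha>: "\<alpha> \<in> L" "R = sv_restrict X \<alpha>" using R by (auto simp: tope_loc_iff elim: locE)
  obtain r :: "'e \<Rightarrow> nat" where
    r1: "\<And>\<sigma>. \<sigma> \<in> L \<Longrightarrow> \<forall>x\<in>X. \<sigma> x = \<alpha> x \<Longrightarrow> \<exists>t::real. \<forall>e\<in>E - X. rel \<kappa> \<sigma> e = sgn (t - r e)" and
    r2: "\<And>t::real. \<exists>\<sigma>\<in>L. (\<forall>x\<in>X. \<sigma> x = \<alpha> x) \<and> (\<forall>e\<in>E - X. rel \<kappa> \<sigma> e = sgn (t - r e))"
    by (rule line_heights[OF \<alpha>(1)]) blast
  have "finite (E - X)" using finite_ground by simp
  then obtain n f where f: "f ` (E - X) = {i::nat. i < n}" "inj_on f (E - X)"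
    using finite_imp_inj_to_nat_seg by metis
  \<comment> \<open>The shift reserves index 0 for the distinguished element.\<close>
  define \<iota> where "\<iota> = (\<lambda>e. Suc (f e))"
  define k where "k = inv_into (E - X) \<iota>"
  have inj: "inj_on \<iota> (E - X)" using f(2) by (auto simp: \<iota>_def inj_on_def)
  have k\<iota>: "k (\<iota> e) = e" if "e \<in> E - X" for e using inj that by (simp add: k_def)
  have \<iota>0: "\<iota> e \<noteq> 0" for e by (simp add: \<iota>_def)
  define I where "I = insert 0 (\<iota> ` (E - X))"
  \<comment> \<open>Converts signs relative to \<open>\<kappa>\<close> back into absolute
    ones.\<close>
  define s where "s = (\<lambda>e. if \<kappa> e = Pos then 1 else -1 :: real)"
  define a where "a = (\<lambda>i. if i = 0 then 1 else - s (k i) * r (k i))"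
  define b where "b = (\<lambda>i. if i = 0 then 0 else s (k i))"
  define N where "N = range (planar I a b)"
  define \<Phi> where "\<Phi> = (\<lambda>\<sigma> i. if i = 0 then Pos else if i \<in> I then \<sigma> (k i) else 0 :: sign)"
  define line where "line = {\<sigma> \<in> L. \<forall>x\<in>X. \<sigma> x = \<alpha> x}"
  have finI: "finite I" using finite_ground by (simp add: I_def)
  have s0: "s e \<noteq> 0" for e by (simp add: s_def)
  interpret N: oriented_matroid I N unfolding N_def by (rule planar_oriented_matroid[OF finI])
  \<comment> \<open>Any element outside \<open>X\<close> gives a form independent of
    \<open>x\<close>, so the rank is 2.\<close>
  obtain e0 where e0: "e0 \<in> E - X" using X by blast
  have rank: "om_rank N = 2"
    unfolding N_def
    by (rule planar_rank[OF finI, of 0 "\<iota> e0"])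
       (use e0 s0 k\<iota> \<iota>0 in \<open>auto simp: I_def a_def b_def\<close>)
  have planar0: "planar I a b (x, y) 0 = sign_of x" for x y
    by (simp add: planar_apply I_def a_def b_def)
  have planar1: "planar I a b (x, y) (\<iota> e) = sign_of (s e * (y - r e * x))" if "e \<in> E - X" for x y :: real and e
    using that k\<iota>[OF that] \<iota>0[of e] by (simp add: planar_apply I_def a_def b_def algebra_simps)
  have \<Phi>0: "\<Phi> \<sigma> 0 = Pos" for \<sigma> by (simp add: \<Phi>_def)
  have \<Phi>1: "\<Phi> \<sigma> (\<iota> e) = \<sigma> e" if "e \<in> E - X" for \<sigma> e
    using that k\<iota>[OF that] \<iota>0[of e] by (simp add: \<Phi>_def I_def)
  have ext: "\<tau> = \<tau>'" if "\<tau> 0 = \<tau>' 0" "\<And>e. e \<in> E - X \<Longrightarrow> \<tau> (\<iota> e) = \<tau>' (\<iota> e)"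
      "\<And>i. i \<notin> I \<Longrightarrow> \<tau> i = 0" "\<And>i. i \<notin> I \<Longrightarrow> \<tau>' i = 0" for \<tau> \<tau>' :: "nat sign_vector"
  proof
    fix i show "\<tau> i = \<tau>' i" using that unfolding I_def by (cases "i \<in> I") (auto simp: I_def)
  qed
  have \<Phi>out: "\<Phi> \<sigma> i = 0" if "i \<notin> I" for \<sigma> i using that by (auto simp: \<Phi>_def I_def)
  have planar_out: "planar I a b p i = 0" if "i \<notin> I" for p i using that by (cases p) (simp add: planar_apply)
  have \<Phi>N: "\<Phi> \<sigma> \<in> N" if \<sigma>: "\<sigma> \<in> line" for \<sigma>
  proof -
    obtain t :: real where t: "\<forall>e\<in>E - X. rel \<kappa> \<sigma> e = sgn (t - r e)" using r1[of \<sigma>] \<sigma> unfolding line_def by blast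
    have "\<Phi> \<sigma> = planar I a b (1, t)"
    proof (rule ext)
      show "\<Phi> \<sigma> (\<iota> e) = planar I a b (1, t) (\<iota> e)" if e: "e \<in> E - X" for e
        using sign_of_rel[of \<kappa> e \<sigma> "t - r e"] \<kappa>_nonzero[OF e] t e by (simp add: \<Phi>1 planar1 s_def)
    qed (simp_all add: \<Phi>0 planar0 \<Phi>out planar_out sign_of_def)
    then show ?thesis by (simp add: N_def)
  qed
  have surj: "\<exists>\<sigma>\<in>line. \<Phi> \<sigma> = \<tau>" if \<tau>: "\<tau> \<in> N" "\<tau> 0 = Pos" for \<tau>
  proof -
    obtain p where "\<tau> = planar I a b p" using \<tau> by (auto simp: N_def)
    moreover obtain x y where "p = (x, y)" by (cases p)
    ultimately have xy: "\<tau> = planar I a b (x, y)" by simp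
    have x: "x > 0" using \<tau>(2) by (simp add: xy planar0)
    obtain \<sigma> where \<sigma>: "\<sigma> \<in> L" "\<forall>x\<in>X. \<sigma> x = \<alpha> x" "\<forall>e\<in>E - X. rel \<kappa> \<sigma> e = sgn (y / x - r e)"
      using r2[of "y / x"] by blast
    have "\<Phi> \<sigma> = \<tau>"
    proof (rule ext)
      show "\<Phi> \<sigma> (\<iota> e) = \<tau> (\<iota> e)" if e: "e \<in> E - X" for e
      proof -
        have "rel \<kappa> \<sigma> e = sgn (y / x - r e)" using \<sigma>(3) e by blast
        \<comment> \<open>Scaling by the positive \<open>x\<close> passes from the affine line back
          to the central arrangement.\<close>
        also have "\<dots> = sgn (x * (y / x - r e))" using x by (simp add: sgn_mult)
        also have "x * (y / x - r e) = y - r e * x" using x by (simp add: field_simps)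
        finally show ?thesis
          using sign_of_rel[of \<kappa> e \<sigma>] \<kappa>_nonzero[OF e] e by (simp add: \<Phi>1 xy planar1 s_def)
      qed
    qed (simp_all add: \<Phi>0 xy planar0 x \<Phi>out planar_out sign_of_def)
    then show ?thesis using \<sigma> by (auto simp: line_def)
  qed
  have injP: "\<sigma> = \<tau>" if "\<sigma> \<in> line" "\<tau> \<in> line" "\<Phi> \<sigma> = \<Phi> \<tau>" for \<sigma> \<tau>
  proof (rule ext_eq)
    show "\<sigma> e = \<tau> e" if "e \<in> E - X" for e using \<Phi>1[OF that] \<open>\<Phi> \<sigma> = \<Phi> \<tau>\<close> by metis
  qed (use that in \<open>auto simp: line_def\<close>)
  have le: "\<Phi> \<sigma> \<le> \<Phi> \<tau> \<longleftrightarrow> \<sigma> \<le> \<tau>" if "\<sigma> \<in> line" "\<tau> \<in> line" for \<sigma> \<tau>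
  proof
    assume l: "\<Phi> \<sigma> \<le> \<Phi> \<tau>"
    have "\<sigma> e = 0 \<or> \<sigma> e = \<tau> e" for e
    proof (cases "e \<in> E - X")
      case True
      then show ?thesis using l \<Phi>1[OF True] unfolding sv_le_iff by metis
    next
      case False
      then show ?thesis using that outside[of \<sigma> e] by (auto simp: line_def)
    qed
    then show "\<sigma> \<le> \<tau>" by (simp add: sv_le_iff)
  qed (auto simp: sv_le_iff \<Phi>_def)
  have \<Phi>comp: "\<Phi> \<sigma> \<circ>\<^sub>s \<Phi> \<tau> = \<Phi> (\<sigma> \<circ>\<^sub>s \<tau>)" for \<sigma> \<tau> by (auto simp: fun_eq_iff \<Phi>_def)
  have line_comp: "\<sigma> \<circ>\<^sub>s \<tau> \<in> line" if "\<sigma> \<in> line" "\<tau> \<in> line" for \<sigma> \<tau>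
    using that comp_mem by (auto simp: line_def)
  have N_topes: "T \<in> topes N \<longleftrightarrow> T \<in> N \<and> (\<forall>e. T e = 0 \<longrightarrow> (\<forall>\<sigma>\<in>N. \<sigma> e = 0))" for T
    using N.comp_mem by (rule topes_iff)
  have RX: "R x = \<alpha> x" if "x \<in> X" for x using \<alpha>(2) that by simp
  have topes_iff': "\<Phi> T \<in> topes N \<longleftrightarrow> T \<in> topes L" if T: "T \<in> line" for T
  proof
    assume tN: "\<Phi> T \<in> topes N"
    show "T \<in> topes L"
    proof (rule topeI[OF R])
      show "T \<in> L" using T by (simp add: line_def)
      show "R x = 0" if "x \<in> X" "T x = 0" for x using that T RX by (simp add: line_def)
      show "T e \<noteq> 0" if e: "e \<in> E - X" for e
      proof
        assume "T e = 0"
        then have "\<Phi> T (\<iota> e) = 0" using \<Phi>1[OF e] by simp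
        \<comment> \<open>The vertical direction lies on none of the lines \<open>\<iota> e\<close>,
          so no such index is a loop of \<open>N\<close>.\<close>
        moreover have "planar I a b (0, 1) \<in> N" by (simp add: N_def)
        ultimately have "planar I a b (0, 1) (\<iota> e) = 0" using tN unfolding N_topes by blast
        then show False using planar1[OF e] s0 by simp
      qed
    qed
  next
    assume tL: "T \<in> topes L"
    have "i \<notin> I" if "\<Phi> T i = 0" for i
    proof
      assume "i \<in> I"
      then consider "i = 0" | e where "e \<in> E - X" "i = \<iota> e" by (auto simp: I_def)
      then show False
      proof cases
        case 1
        then show False using that \<Phi>0[of T] by simp
      next
        case 2
        then show False using that \<Phi>1[OF 2(1)] tope_nonzero[OF tL 2(1)] by simp
      qed
    qed
    then show "\<Phi> T \<in> topes N" unfolding N_topes using \<Phi>N[OF T] planar_out by (auto simp: N_def)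
  qed
  have fib: "(\<sigma>, T) \<in> fiber R R \<longleftrightarrow> \<sigma> \<in> line \<and> T \<in> line \<and> T \<in> topes L \<and> \<sigma> \<le> T" for \<sigma> T
    using fiber_tope[OF R, of \<sigma> T] fiber_topeI[OF R, of \<sigma> T] RX by (auto simp: line_def)
  have "bij_betw (\<lambda>(\<sigma>, T). (\<Phi> \<sigma>, \<Phi> T)) (fiber R R) (affine_salvetti 0 N)"
    unfolding bij_betw_def
  proof
    show "inj_on (\<lambda>(\<sigma>, T). (\<Phi> \<sigma>, \<Phi> T)) (fiber R R)"
      using injP by (auto simp: inj_on_def fib)
    show "(\<lambda>(\<sigma>, T). (\<Phi> \<sigma>, \<Phi> T)) ` fiber R R = affine_salvetti 0 N"
    proof (intro equalityI subsetI)
      fix q assume "q \<in> (\<lambda>(\<sigma>, T). (\<Phi> \<sigma>, \<Phi> T)) ` fiber R R"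
      then obtain \<sigma> T where "q = (\<Phi> \<sigma>, \<Phi> T)" "(\<sigma>, T) \<in> fiber R R" by auto
      then have "q = (\<Phi> \<sigma>, \<Phi> T)" "\<sigma> \<in> line" "T \<in> line" "T \<in> topes L" "\<sigma> \<le> T" unfolding fib by blast+
      then show "q \<in> affine_salvetti 0 N"
        using \<Phi>N \<Phi>0 le topes_iff' by (simp add: affine_salvetti_def salvetti_def)
    next
      fix q assume q: "q \<in> affine_salvetti 0 N"
      obtain \<tau> S where qq: "q = (\<tau>, S)" by (cases q)
      have *: "\<tau> \<in> N" "S \<in> topes N" "\<tau> \<le> S" "\<tau> 0 = Pos" "S 0 = Pos"
        using q by (auto simp: qq affine_salvetti_def salvetti_def)
      then have "S \<in> N" by (simp add: N_topes)
      obtain \<sigma> T where "\<sigma> \<in> line" "\<Phi> \<sigma> = \<tau>" "T \<in> line" "\<Phi> T = S"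
        using surj[OF *(1,4)] surj[OF \<open>S \<in> N\<close> *(5)] by blast
      then have "(\<sigma>, T) \<in> fiber R R" "q = (\<Phi> \<sigma>, \<Phi> T)"
        using * le topes_iff' by (auto simp: fib qq)
      then show "q \<in> (\<lambda>(\<sigma>, T). (\<Phi> \<sigma>, \<Phi> T)) ` fiber R R" by force
    qed
  qed
  then have "poset_space (fiber R R) salvetti_le homotopy_equivalent_space poset_space (affine_salvetti 0 N) salvetti_le"
  proof (rule poset_iso_homotopy_equivalent[rotated])
    show "finite (fiber R R)" by (rule finite_subset[OF fiber_salvetti finite_salvetti])
    fix p q assume pq: "p \<in> fiber R R" "q \<in> fiber R R"
    obtain \<sigma> T \<tau> S where eq: "p = (\<sigma>, T)" "q = (\<tau>, S)" by (cases p; cases q)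
    have l: "\<sigma> \<in> line" "T \<in> line" "\<tau> \<in> line" "S \<in> line" using pq by (auto simp: eq fib)
    show "salvetti_le (case p of (\<sigma>, T) \<Rightarrow> (\<Phi> \<sigma>, \<Phi> T)) (case q of (\<sigma>, T) \<Rightarrow> (\<Phi> \<sigma>, \<Phi> T)) \<longleftrightarrow> salvetti_le p q"
      using le[OF l(3,1)] injP[OF line_comp[OF l(1,4)] l(2)] by (auto simp: eq salvetti_le_iff \<Phi>comp)
  qed
  then show ?thesis using N.oriented_matroid_axioms rank by (intro exI[of _ I] exI[of _ N] exI[of _ 0]) (auto simp: I_def)
qed

text \<open>The case \<open>t = R\<close> of \<open>tope_fiber_inclusion\<close> reduces an
  arbitrary fibre to the one over the tope \<open>R\<close>.\<close>

theorem fiber_affine: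
  assumes "a \<in> salvetti loc"
  shows "\<exists>(I :: nat set) L' g. oriented_matroid I L' \<and> om_rank L' = 2 \<and> g \<in> I \<and>
    poset_space (poset_fiber (salvetti L) salvetti_le (salvetti_restrict X) a) salvetti_le
      homotopy_equivalent_space poset_space (affine_salvetti g L') salvetti_le"
proof -
  obtain s R where a: "a = (s, R)" "s \<in> loc" "R \<in> topes loc" "s \<le> R"
    using assms by (auto simp: salvetti_def)
  have "poset_space (fiber s R) salvetti_le homotopy_equivalent_space poset_space (fiber R R) salvetti_le"
    by (rule iffD1[OF homotopy_equivalent_space_sym],
        rule homotopy_equivalence_map_imp_space[OF tope_fiber_inclusion[OF a(2,3,3,4)]])
  then show ?thesis
    using tope_fiber_affine[OF a(3)] homotopy_eqv_trans unfolding a(1) by meson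
qed

end

lemma (in oriented_matroid) modular_coatomI:
  assumes "modular_flat E L X" "corank_one E L X"
  obtains \<kappa> where "modular_coatom E L X \<kappa>"
proof -
  have XF: "X \<in> flats E L" using assms by (simp add: modular_flat_def)
  then obtain \<kappa> where \<kappa>: "\<kappa> \<in> L" "zero_set E \<kappa> = X" by (auto simp: flats_def)
  have "modular_coatom E L X \<kappa>"
  proof
    show "X \<subseteq> E" "X \<noteq> E" using flat_subset[OF XF] coatom(1)[OF XF assms(2)] by auto
  qed (use \<kappa> modular_coatom_determined[OF assms] in blast)+
  then show ?thesis by (rule that)
qed

theorem theorem6p4:
  fixes E X :: "'e set" and L :: "'e sign_vector set"
  assumes "oriented_matroid E L"
    and "X \<in> flats E L"
    and "modular_flat E L X"
    and "corank_one E L X"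
  shows "poset_quasi_fibration (salvetti L) salvetti_le
           (salvetti (localization X L)) salvetti_le (salvetti_restrict X)
    \<and> (\<forall>a \<in> salvetti (localization X L).
        \<exists>(E' :: nat set) L' g. oriented_matroid E' L' \<and> om_rank L' = 2 \<and> g \<in> E' \<and>
          poset_space (poset_fiber (salvetti L) salvetti_le (salvetti_restrict X) a) salvetti_le
            homotopy_equivalent_space
          poset_space (affine_salvetti g L') salvetti_le)"
proof -
  interpret oriented_matroid E L by (rule assms(1))
  obtain \<kappa> where "modular_coatom E L X \<kappa>"
    using modular_coatomI[OF assms(3,4)] by blast
  then interpret modular_coatom E L X \<kappa> .
  show ?thesis using restrict_quasi_fibration fiber_affine by blast
qed

end
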